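(* Let $M^n$ be a connected, simply connected $n$-dimensional manifold and let $N^l$ be a connected compact $l$-dimensional submanifold of the tangent bundle $TM^n$ which is transverse to the fibers it meets and which projects (under $\pi:TM^n\to M^n$) onto a simply connected $l$-dimensional submanifold $F^l$ of $M^n$. Then $F^l$ is compact and there is a vector field $\xi$ on $M^n$ along $F^l$ such that $\xi(F^l)=N^l$.
   Context: All manifolds, maps and vector fields are smooth ($C^\infty$). Superscripts on manifolds denote dimensions. $N\subset TM^n$ is transverse to the fiber at $z\in N$ if $T_zN\cap\ker(d\pi_z)=\{0\}$; "transverse to the fibers it meets" means this holds at all $z\in N$. A vector field on $M^n$ along a submanifold $F\subset M^n$ is a smooth map $\xi:F\to TM^n$ with $\pi\circ\xi=\mathrm{Id}_F$ (not necessarily tangent to $F$); $\xi(F)\subset TM^n$ denotes its image. *)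

theory Defs
  imports "HOL-Analysis.Analysis"
begin

text \<open>\<open>k\<close> times continuously differentiable; intended for open \<open>T\<close>.\<close>

fun Ck_on :: "nat \<Rightarrow> 'e::euclidean_space set \<Rightarrow> ('e \<Rightarrow> 'f::euclidean_space) \<Rightarrow> bool" where
  "Ck_on 0 T f \<longleftrightarrow> continuous_on T f"
| "Ck_on (Suc k) T f \<longleftrightarrow>
     (\<forall>x\<in>T. f differentiable at x) \<and> (\<forall>v. Ck_on k T (\<lambda>x. frechet_derivative f (at x) v))"

text \<open>On an arbitrary subset, a map is smooth if it extends locally to a smooth map on an open
  subset of the ambient space. For a relatively open subset of a linear subspace this is ordinary
  smoothness on that subspace.\<close>

definition smooth_on :: "'e::euclidean_space set \<Rightarrow> ('e \<Rightarrow> 'f::euclidean_space) \<Rightarrow> bool" where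
  "smooth_on S f \<longleftrightarrow>
     (\<forall>x\<in>S. \<exists>T g. open T \<and> x \<in> T \<and> (\<forall>k. Ck_on k T g) \<and> (\<forall>y\<in>S \<inter> T. g y = f y))"

text \<open>A chart is a domain together with a coordinate map; the values of the coordinate map outside
  the domain are irrelevant.\<close>

type_synonym ('a, 'e) chart = "'a set \<times> ('a \<Rightarrow> 'e)"

abbreviation cdom :: "('a, 'e) chart \<Rightarrow> 'a set" where
  "cdom c \<equiv> fst c"

abbreviation coord :: "('a, 'e) chart \<Rightarrow> 'a \<Rightarrow> 'e" where
  "coord c \<equiv> snd c"

abbreviation param :: "('a, 'e) chart \<Rightarrow> 'e \<Rightarrow> 'a" where
  "param c \<equiv> inv_into (cdom c) (coord c)"

text \<open>Charts take values in an \<open>n\<close>-dimensional linear subspace \<^emph>\<open>model\<close> of a Euclidean space,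
  not in a whole type, so that \<open>n\<close> is an ordinary natural number which may be \<open>0\<close>.\<close>

record ('a, 'e) mfd =
  model :: "'e set"
  mtop :: "'a topology"
  atlas :: "('a, 'e) chart set"

definition is_chart :: "('a, 'e::euclidean_space) mfd \<Rightarrow> ('a, 'e) chart \<Rightarrow> bool" where
  "is_chart M c \<longleftrightarrow>
     openin (mtop M) (cdom c) \<and>
     openin (top_of_set (model M)) (coord c ` cdom c) \<and>
     homeomorphic_map (subtopology (mtop M) (cdom c)) (top_of_set (coord c ` cdom c)) (coord c)"

definition compatible :: "('a, 'e::euclidean_space) chart \<Rightarrow> ('a, 'e) chart \<Rightarrow> bool" where
  "compatible c d \<longleftrightarrow>
     smooth_on (coord c ` (cdom c \<inter> cdom d)) (coord d \<circ> param c) \<and>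
     smooth_on (coord d ` (cdom c \<inter> cdom d)) (coord c \<circ> param d)"

text \<open>The atlas need not be maximal; it determines the smooth structure.\<close>

definition smooth_manifold :: "nat \<Rightarrow> ('a, 'e::euclidean_space) mfd \<Rightarrow> bool" where
  "smooth_manifold n M \<longleftrightarrow>
     subspace (model M) \<and> dim (model M) = n \<and>
     Hausdorff_space (mtop M) \<and> second_countable (mtop M) \<and>
     (\<forall>c\<in>atlas M. is_chart M c) \<and>
     (\<forall>c\<in>atlas M. \<forall>d\<in>atlas M. compatible c d) \<and>
     (\<Union>c\<in>atlas M. cdom c) = topspace (mtop M)"

definition max_atlas :: "('a, 'e::euclidean_space) mfd \<Rightarrow> ('a, 'e) chart set" where
  "max_atlas M = {c. is_chart M c \<and> (\<forall>d\<in>atlas M. compatible c d)}"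

text \<open>Embedded submanifolds without boundary, via slice charts.\<close>

definition submanifold :: "('a, 'e::euclidean_space) mfd \<Rightarrow> nat \<Rightarrow> 'a set \<Rightarrow> bool" where
  "submanifold M l S \<longleftrightarrow>
     S \<subseteq> topspace (mtop M) \<and>
     (\<forall>p\<in>S. \<exists>c\<in>max_atlas M. \<exists>L. p \<in> cdom c \<and> subspace L \<and> L \<subseteq> model M \<and> dim L = l \<and>
        coord c ` (cdom c \<inter> S) = coord c ` cdom c \<inter> L)"

text \<open>Smoothness of a map given on a subset \<open>S\<close>; for a submanifold \<open>S\<close> this is smoothness
  for its induced smooth structure.\<close>

definition smooth_map ::
  "('a, 'e::euclidean_space) mfd \<Rightarrow> 'a set \<Rightarrow> ('b, 'f::euclidean_space) mfd \<Rightarrow> ('a \<Rightarrow> 'b) \<Rightarrow> bool"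
  where
  "smooth_map M S M' f \<longleftrightarrow>
     continuous_map (subtopology (mtop M) S) (mtop M') f \<and>
     (\<forall>c\<in>atlas M. \<forall>d\<in>atlas M'.
        smooth_on (coord c ` {p \<in> S \<inter> cdom c. f p \<in> cdom d}) (coord d \<circ> f \<circ> param c))"

definition real_mfd :: "(real, real) mfd" where
  "real_mfd = \<lparr>model = UNIV, mtop = euclidean, atlas = {(UNIV, \<lambda>t. t)}\<rparr>"

text \<open>A tangent vector at \<open>p\<close> is a family of coordinate vectors, indexed by the charts around \<open>p\<close>,
  transforming by the differentials of the coordinate changes. The family is set to \<open>0\<close> at all
  other indices, so that the zero vector is \<open>\<lambda>_. 0\<close>.\<close>

type_synonym ('a, 'e) tvec = "('a, 'e) chart \<Rightarrow> 'e"

definition tangent_space :: "('a, 'e::euclidean_space) mfd \<Rightarrow> 'a \<Rightarrow> ('a, 'e) tvec set" where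
  "tangent_space M p =
     {v. (\<forall>c. c \<in> atlas M \<and> p \<in> cdom c \<longrightarrow> v c \<in> model M) \<and>
         (\<forall>c. \<not> (c \<in> atlas M \<and> p \<in> cdom c) \<longrightarrow> v c = 0) \<and>
         (\<forall>c\<in>atlas M. \<forall>d\<in>atlas M. p \<in> cdom c \<and> p \<in> cdom d \<longrightarrow>
            ((\<lambda>t. coord d (param c (coord c p + t *\<^sub>R v c))) has_vector_derivative v d) (at 0))}"

definition differential ::
  "('a, 'e::euclidean_space) mfd \<Rightarrow> ('b, 'f::euclidean_space) mfd \<Rightarrow> ('a \<Rightarrow> 'b) \<Rightarrow> 'a
     \<Rightarrow> ('a, 'e) tvec \<Rightarrow> ('b, 'f) tvec" where
  "differential M M' f p v =
     (THE w. w \<in> tangent_space M' (f p) \<and>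
        (\<forall>c\<in>atlas M. \<forall>d\<in>atlas M'. p \<in> cdom c \<and> f p \<in> cdom d \<longrightarrow>
           ((\<lambda>t. coord d (f (param c (coord c p + t *\<^sub>R v c)))) has_vector_derivative w d) (at 0)))"

text \<open>The tangent space of a submanifold \<open>S\<close>, as a subspace of the ambient tangent space: the
  velocities of the smooth curves in \<open>S\<close>.\<close>

definition tangent_space_sub ::
  "('a, 'e::euclidean_space) mfd \<Rightarrow> 'a set \<Rightarrow> 'a \<Rightarrow> ('a, 'e) tvec set" where
  "tangent_space_sub M S p =
     {v \<in> tangent_space M p.
        \<exists>\<gamma> \<epsilon>. \<epsilon> > 0 \<and> \<gamma> 0 = p \<and> \<gamma> ` {-\<epsilon><..<\<epsilon>} \<subseteq> S \<and> smooth_map real_mfd {-\<epsilon><..<\<epsilon>} M \<gamma> \<and>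
          (\<forall>c\<in>atlas M. p \<in> cdom c \<longrightarrow> ((\<lambda>t. coord c (\<gamma> t)) has_vector_derivative v c) (at 0))}"

definition tangent_total :: "('a, 'e::euclidean_space) mfd \<Rightarrow> ('a \<times> ('a, 'e) tvec) set" where
  "tangent_total M = (SIGMA p:topspace (mtop M). tangent_space M p)"

definition bundle_chart ::
  "('a, 'e::euclidean_space) mfd \<Rightarrow> ('a, 'e) chart \<Rightarrow> ('a \<times> ('a, 'e) tvec, 'e \<times> 'e) chart" where
  "bundle_chart M c =
     ({z \<in> tangent_total M. fst z \<in> cdom c}, \<lambda>z. (coord c (fst z), snd z c))"

text \<open>The bundle projection is \<^const>\<open>fst\<close>. The topology is generated by the preimages of open sets
  under the bundle charts.\<close>

definition tangent_bundle ::
  "('a, 'e::euclidean_space) mfd \<Rightarrow> ('a \<times> ('a, 'e) tvec, 'e \<times> 'e) mfd" where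
  "tangent_bundle M =
     \<lparr>model = model M \<times> model M,
      mtop = topology_generated_by
        {{z \<in> cdom (bundle_chart M c). coord (bundle_chart M c) z \<in> W} | c W. c \<in> atlas M \<and> open W},
      atlas = bundle_chart M ` atlas M\<rparr>"

definition transverse_to_fibers ::
  "('a, 'e::euclidean_space) mfd \<Rightarrow> ('a \<times> ('a, 'e) tvec) set \<Rightarrow> bool" where
  "transverse_to_fibers M N \<longleftrightarrow>
     (\<forall>z\<in>N. tangent_space_sub (tangent_bundle M) N z \<inter>
        {w \<in> tangent_space (tangent_bundle M) z.
           differential (tangent_bundle M) M fst z w = (\<lambda>_. 0)} = {\<lambda>_. 0})"

definition vector_field_along ::
  "('a, 'e::euclidean_space) mfd \<Rightarrow> 'a set \<Rightarrow> ('a \<Rightarrow> 'a \<times> ('a, 'e) tvec) \<Rightarrow> bool" where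
  "vector_field_along M F \<xi> \<longleftrightarrow>
     smooth_map M F (tangent_bundle M) \<xi> \<and> (\<forall>p\<in>F. fst (\<xi> p) = p)"

text \<open>The library's \<^const>\<open>simply_connected\<close>, for abstract topologies.\<close>

definition simply_connected_space :: "'a topology \<Rightarrow> bool" where
  "simply_connected_space X \<longleftrightarrow>
     (\<forall>p q. pathin X p \<and> p 1 = p 0 \<and> pathin X q \<and> q 1 = q 0 \<longrightarrow>
        homotopic_with (\<lambda>r. r 1 = r 0) (top_of_set {0..1}) X p q)"

lemma simply_connected_space_top_of_set:
  "simply_connected_space (top_of_set S) \<longleftrightarrow> simply_connected S"
  unfolding simply_connected_space_def simply_connected_def homotopic_loops_def
    pathin_def path_def path_image_def pathstart_def pathfinish_def continuous_map_in_subtopology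
  by (auto simp: image_subset_iff_funcset)

end

theory Submission
  imports Defs
begin

text \<open>Transversality says that the projection \<open>N \<rightarrow> F\<close> is an immersion, and as both sides have
  dimension \<open>l\<close> it is a local diffeomorphism by the inverse function theorem. It is proper because
  \<open>N\<close> is compact, hence a covering; as \<open>F\<close> is simply connected and \<open>N\<close> is connected, it is
  injective. The inverse of the resulting diffeomorphism is the vector field \<open>\<xi>\<close>.\<close>

section \<open>Maps of class \<open>C\<^sup>k\<close>\<close>

text \<open>Charts take values in linear subspaces and smoothness means local extendability, so the
  inverse function theorem has to be carried from a whole Euclidean space to the slices
  \<open>L\<close> and \<open>L'\<close> that cut out \<open>N\<close> and \<open>F\<close>; the
  inverse must moreover be of class \<open>C\<^sup>k\<close> for every \<open>k\<close>, which comes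
  from the formula for its derivative. A slice direction killed by the projection becomes a straight
  coordinate curve in \<open>N\<close> with vertical velocity, which transversality excludes. No
  covering is constructed. Compactness of \<open>N\<close> gives around each point of
  \<open>F\<close> one open set on which some section passes through any given preimage; this
  suffices to lift maps of a rectangle, by bisection. Simple connectedness is stated with free
  homotopies of loops, so the base point may move; it traces the same path on both horizontal sides
  of the square, and uniqueness of lifts compares the two lifted sides. Once the projection is
  injective, its inverse is continuous because \<open>N\<close> is compact and \<open>F\<close> is
  Hausdorff, and smooth because it agrees locally with the smooth sections.\<close>

lemma Ck_on_SucD: "Ck_on (Suc k) T f \<Longrightarrow> Ck_on k T f"
proof (induction k arbitrary: f)
  case 0
  then show ?case
    by (auto simp: continuous_at_imp_continuous_on differentiable_imp_continuous_within)
next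
  case (Suc k)
  show ?case
    using Suc.prems Suc.IH unfolding Ck_on.simps(2)[of "Suc k"] Ck_on.simps(2)[of k] by blast
qed

lemma Ck_on_subset: "Ck_on k T f \<Longrightarrow> S \<subseteq> T \<Longrightarrow> Ck_on k S f"
  by (induction k arbitrary: f) (auto intro: continuous_on_subset)

lemma Ck_on_cong:
  assumes "open T" "\<And>x. x \<in> T \<Longrightarrow> f x = g x" "Ck_on k T f"
  shows "Ck_on k T g"
  using assms(2,3)
proof (induction k arbitrary: f g)
  case 0
  then show ?case using continuous_on_cong by auto
next
  case (Suc k)
  have D: "(g has_derivative frechet_derivative f (at x)) (at x)" if "x \<in> T" for x
  proof (rule has_derivative_transform_within_open[OF _ \<open>open T\<close> that Suc.prems(1)])
    show "(f has_derivative frechet_derivative f (at x)) (at x)"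
      using Suc.prems(2) that by (simp add: frechet_derivative_works[symmetric])
  qed
  moreover have "Ck_on k T (\<lambda>x. frechet_derivative g (at x) v)" for v
  proof (rule Suc.IH)
    show "Ck_on k T (\<lambda>x. frechet_derivative f (at x) v)" using Suc.prems by simp
    show "frechet_derivative f (at x) v = frechet_derivative g (at x) v" if "x \<in> T" for x
      using frechet_derivative_at[OF D[OF that]] by simp
  qed
  ultimately show ?case by (auto simp: differentiable_def)
qed

text \<open>Lets the derivative be named explicitly: by uniqueness \<open>D x\<close> is
  \<open>frechet_derivative f (at x)\<close> on the open set, and \<open>Ck_on_cong\<close>
  transports the regularity.\<close>

lemma Ck_on_SucI:
  assumes "open T" "\<And>x. x \<in> T \<Longrightarrow> (f has_derivative D x) (at x)" "\<And>v. Ck_on k T (\<lambda>x. D x v)"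
  shows "Ck_on (Suc k) T f"
proof -
  have "Ck_on k T (\<lambda>x. frechet_derivative f (at x) v)" for v
    by (rule Ck_on_cong[OF assms(1) _ assms(3)[of v]]) (simp add: frechet_derivative_at[OF assms(2), symmetric])
  with assms(2) show ?thesis by (auto simp: differentiable_def)
qed

lemma Ck_on_Suc_has_derivative:
  "Ck_on (Suc k) T f \<Longrightarrow> x \<in> T \<Longrightarrow> (f has_derivative frechet_derivative f (at x)) (at x)"
  by (simp add: frechet_derivative_works[symmetric])

lemma Ck_on_frechet_derivative:
  assumes "\<And>k. Ck_on k T f"
  shows "Ck_on k T (\<lambda>x. frechet_derivative f (at x) v)"
  using assms[of "Suc k"] by simp

lemma Ck_on_const: "open T \<Longrightarrow> Ck_on k T (\<lambda>x. c)"
  by (induction k arbitrary: c) (auto intro!: Ck_on_SucI derivative_eq_intros simp del: Ck_on.simps(2))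

lemma Ck_on_linear:
  fixes f :: "'a::euclidean_space \<Rightarrow> 'b::euclidean_space"
  assumes "linear f" "open T"
  shows "Ck_on k T f"
proof (cases k)
  case 0
  then show ?thesis using assms linear_continuous_on linear_conv_bounded_linear by auto
next
  case (Suc m)
  then show ?thesis
    using assms Ck_on_SucI[OF \<open>open T\<close>, of f "\<lambda>x. f"] Ck_on_const[OF \<open>open T\<close>]
      linear_imp_has_derivative by blast
qed

lemma Ck_on_add:
  assumes "open T" "Ck_on k T f" "Ck_on k T g"
  shows "Ck_on k T (\<lambda>x. f x + g x)"
  using assms(2,3)
proof (induction k arbitrary: f g)
  case 0
  then show ?case by (simp add: continuous_on_add)
next
  case (Suc k)
  show ?case
  proof (rule Ck_on_SucI[OF \<open>open T\<close>])
    show "((\<lambda>x. f x + g x) has_derivative (\<lambda>v. frechet_derivative f (at x) v + frechet_derivative g (at x) v)) (at x)"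
      if "x \<in> T" for x
      using Suc.prems that by (intro has_derivative_add Ck_on_Suc_has_derivative)
  qed (use Suc in auto)
qed

lemma Ck_on_sum:
  assumes "open T" "\<And>i. i \<in> I \<Longrightarrow> Ck_on k T (f i)"
  shows "Ck_on k T (\<lambda>x. \<Sum>i\<in>I. f i x)"
  using assms(2)
  by (induction I rule: infinite_finite_induct) (auto intro: Ck_on_const Ck_on_add assms(1))

lemma Ck_on_bilinear:
  fixes prod :: "'b::euclidean_space \<Rightarrow> 'c::euclidean_space \<Rightarrow> 'd::euclidean_space"
  assumes "bounded_bilinear prod" "open T" "Ck_on k T f" "Ck_on k T g"
  shows "Ck_on k T (\<lambda>x. prod (f x) (g x))"
  using assms(3,4)
proof (induction k arbitrary: f g)
  case 0
  then show ?case by (simp add: bounded_bilinear.continuous_on[OF assms(1)])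
next
  case (Suc k)
  show ?case
  proof (rule Ck_on_SucI[OF \<open>open T\<close>])
    show "((\<lambda>x. prod (f x) (g x)) has_derivative
        (\<lambda>v. prod (f x) (frechet_derivative g (at x) v) + prod (frechet_derivative f (at x) v) (g x))) (at x)"
      if "x \<in> T" for x
      using Suc.prems that by (intro bounded_bilinear.FDERIV[OF assms(1)] Ck_on_Suc_has_derivative)
    fix v
    show "Ck_on k T (\<lambda>x. prod (f x) (frechet_derivative g (at x) v) + prod (frechet_derivative f (at x) v) (g x))"
      using Suc.prems Suc.prems[THEN Ck_on_SucD] by (intro Ck_on_add \<open>open T\<close> Suc.IH) auto
  qed
qed

lemmas Ck_on_scaleR = Ck_on_bilinear[OF bounded_bilinear_scaleR]

lemma linear_eq_sum_Basis:
  fixes A :: "'a::euclidean_space \<Rightarrow> 'b::real_vector"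
  assumes "linear A"
  shows "A v = (\<Sum>b\<in>Basis. (v \<bullet> b) *\<^sub>R A b)"
  using euclidean_representation[of v] assms linear_sum linear_scale by (metis (no_types, lifting) sum.cong)

lemma Ck_on_inner_const:
  fixes f :: "'a::euclidean_space \<Rightarrow> 'b::euclidean_space"
  assumes "open T" "Ck_on k T f"
  shows "Ck_on k T (\<lambda>x. f x \<bullet> b)"
  by (rule Ck_on_bilinear[OF bounded_bilinear_inner assms Ck_on_const[OF assms(1)]])

text \<open>In \<open>Ck_on\<close> an operator family is tested only on fixed vectors. Expanding
  the moving argument in \<open>Basis\<close> reduces its evaluation to a finite sum of
  products.\<close>

lemma Ck_on_linear_family_apply:
  fixes f :: "'a::euclidean_space \<Rightarrow> 'b::euclidean_space" and A :: "'a \<Rightarrow> 'b \<Rightarrow> 'c::euclidean_space"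
  assumes "open T" "Ck_on k T f" "\<And>v. Ck_on k T (\<lambda>x. A x v)" "\<And>x. x \<in> T \<Longrightarrow> linear (A x)"
  shows "Ck_on k T (\<lambda>x. A x (f x))"
proof (rule Ck_on_cong[OF assms(1)])
  show "Ck_on k T (\<lambda>x. \<Sum>b\<in>Basis. (f x \<bullet> b) *\<^sub>R A x b)"
    by (intro Ck_on_sum Ck_on_scaleR Ck_on_inner_const assms)
  show "(\<Sum>b\<in>Basis. (f x \<bullet> b) *\<^sub>R A x b) = A x (f x)" if "x \<in> T" for x
    using linear_eq_sum_Basis[OF assms(4)[OF that], of "f x"] by simp
qed

text \<open>The derivative of the composite is the family
  \<open>frechet_derivative g (at (f x))\<close> applied to a moving vector, which
  \<open>Ck_on_linear_family_apply\<close> handles. The induction generalizes \<open>g\<close>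
  because it is reapplied to a directional derivative of \<open>g\<close> composed with the same
  \<open>f\<close>.\<close>

lemma Ck_on_compose:
  fixes f :: "'a::euclidean_space \<Rightarrow> 'b::euclidean_space" and g :: "'b \<Rightarrow> 'c::euclidean_space"
  assumes "open T" "open S" "f ` T \<subseteq> S" "Ck_on k T f" "Ck_on k S g"
  shows "Ck_on k T (g \<circ> f)"
  using assms(4,5)
proof (induction k arbitrary: g)
  case 0
  then show ?case using continuous_on_compose[of T f g] continuous_on_subset[OF _ assms(3), of g] by simp
next
  case (Suc k)
  note Df = Ck_on_Suc_has_derivative[OF Suc.prems(1)]
  note Dg = Ck_on_Suc_has_derivative[OF Suc.prems(2)]
  have inS: "f x \<in> S" if "x \<in> T" for x using that assms(3) by auto
  show ?case
  proof (rule Ck_on_SucI[OF \<open>open T\<close>])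
    show "((g \<circ> f) has_derivative (frechet_derivative g (at (f x)) \<circ> frechet_derivative f (at x))) (at x)"
      if "x \<in> T" for x
      using diff_chain_at[OF Df[OF that] Dg[OF inS[OF that]]] .
    fix v
    have "Ck_on k T (\<lambda>x. frechet_derivative g (at (f x)) v)" for v
      using Suc.IH[of "\<lambda>y. frechet_derivative g (at y) v"] Suc.prems Ck_on_SucD[OF Suc.prems(1)]
      by (simp add: o_def)
    moreover have "Ck_on k T (\<lambda>x. frechet_derivative f (at x) v)" using Suc.prems by simp
    moreover have "linear (frechet_derivative g (at (f x)))" if "x \<in> T" for x
      using Dg[OF inS[OF that]] has_derivative_linear by blast
    ultimately show "Ck_on k T (\<lambda>x. (frechet_derivative g (at (f x)) \<circ> frechet_derivative f (at x)) v)"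
      using Ck_on_linear_family_apply[OF \<open>open T\<close>, of k "\<lambda>x. frechet_derivative f (at x) v" 
        "\<lambda>x. frechet_derivative g (at (f x))"] by (simp add: o_def)
  qed
qed

text \<open>The pair is the sum of its two entries, each composed with the linear embedding of an
  axis.\<close>

lemma Ck_on_Pair:
  fixes f :: "'a::euclidean_space \<Rightarrow> 'b::euclidean_space" and g :: "'a \<Rightarrow> 'c::euclidean_space"
  assumes "open T" "Ck_on k T f" "Ck_on k T g"
  shows "Ck_on k T (\<lambda>x. (f x, g x))"
proof -
  have lin: "linear (\<lambda>y. (y, 0) :: 'b \<times> 'c)" "linear (\<lambda>y. (0, y) :: 'b \<times> 'c)"
    by (auto intro!: linearI)
  have "Ck_on k T ((\<lambda>y. (y, 0) :: 'b \<times> 'c) \<circ> f)"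
    by (rule Ck_on_compose[OF assms(1) open_UNIV subset_UNIV assms(2) Ck_on_linear[OF lin(1) open_UNIV]])
  moreover have "Ck_on k T ((\<lambda>y. (0, y) :: 'b \<times> 'c) \<circ> g)"
    by (rule Ck_on_compose[OF assms(1) open_UNIV subset_UNIV assms(3) Ck_on_linear[OF lin(2) open_UNIV]])
  ultimately have "Ck_on k T (\<lambda>x. ((\<lambda>y. (y, 0) :: 'b \<times> 'c) \<circ> f) x + ((\<lambda>y. (0, y) :: 'b \<times> 'c) \<circ> g) x)"
    by (rule Ck_on_add[OF assms(1)])
  then show ?thesis by simp
qed

section \<open>Smoothness of inverses of operator families\<close>

text \<open>At a zero of \<open>f\<close> the product rule asks only for continuity of
  \<open>g\<close>: the remainder is \<open>(f y - f' (y - x)) *\<^sub>R g y + f' (y - x) *\<^sub>R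
  (g y - g x)\<close>, and each term is small against \<open>norm (y - x)\<close>. This suits
  inverse families, whose differentiability is still to be shown.\<close>

lemma has_derivative_scaleR_vanishing:
  fixes f :: "'a::real_normed_vector \<Rightarrow> real" and g :: "'a \<Rightarrow> 'b::real_normed_vector"
  assumes f: "(f has_derivative f') (at x)" and "f x = 0" and g: "isCont g x"
  shows "((\<lambda>y. f y *\<^sub>R g y) has_derivative (\<lambda>h. f' h *\<^sub>R g x)) (at x)"
proof -
  interpret bounded_linear f' using f by (rule has_derivative_bounded_linear)
  obtain K where K: "\<And>h. norm (f' h) \<le> norm h * K" using bounded by blast
  have lim: "((\<lambda>y. (f y - f' (y - x)) /\<^sub>R norm (y - x)) \<longlongrightarrow> 0) (at x)"
    using f \<open>f x = 0\<close> by (simp add: has_derivative_def netlimit_at_vector)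
  have g0: "((\<lambda>y. g y - g x) \<longlongrightarrow> 0) (at x)"
    using g by (simp add: isCont_def LIM_zero)
  have quot: "((\<lambda>y. (f' (y - x) / norm (y - x)) *\<^sub>R (g y - g x)) \<longlongrightarrow> 0) (at x)"
  proof (rule Lim_null_comparison)
    show "\<forall>\<^sub>F y in at x. norm ((f' (y - x) / norm (y - x)) *\<^sub>R (g y - g x)) \<le> K * norm (g y - g x)"
    proof (rule eventually_at_filter[THEN iffD2], rule always_eventually, intro allI impI)
      fix y assume "y \<noteq> x"
      then have "\<bar>f' (y - x)\<bar> / norm (y - x) \<le> K"
        using K[of "y - x"] by (simp add: divide_le_eq mult.commute)
      then show "norm ((f' (y - x) / norm (y - x)) *\<^sub>R (g y - g x)) \<le> K * norm (g y - g x)"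
        using mult_right_mono[of "\<bar>f' (y - x)\<bar> / norm (y - x)" K "norm (g y - g x)"] by simp
    qed
    show "((\<lambda>y. K * norm (g y - g x)) \<longlongrightarrow> 0) (at x)"
      using tendsto_mult_right_zero[OF tendsto_norm_zero[OF g0]] .
  qed
  have "((\<lambda>y. ((f y - f' (y - x)) /\<^sub>R norm (y - x)) *\<^sub>R g y + (f' (y - x) / norm (y - x)) *\<^sub>R (g y - g x)) \<longlongrightarrow> 0 *\<^sub>R g x + 0) (at x)"
    by (intro tendsto_add tendsto_scaleR lim quot) (use g in \<open>simp add: isCont_def\<close>)
  moreover have "bounded_linear (\<lambda>h. f' h *\<^sub>R g x)"
    by (intro bounded_linear_intros bounded_linear_axioms)
  ultimately show ?thesis
    using \<open>f x = 0\<close> by (simp add: has_derivative_def netlimit_at_vector algebra_simps divide_inverse)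
qed

text \<open>The operators \<open>A x\<close> are bounded below uniformly near \<open>x0\<close>, which makes \<open>B\<close> continuous.\<close>

lemma isCont_inverse_linear_family:
  fixes A B :: "'a::euclidean_space \<Rightarrow> 'b::euclidean_space \<Rightarrow> 'b"
  assumes "open T" "x0 \<in> T"
    and A: "\<And>x. x \<in> T \<Longrightarrow> linear (A x)" and B: "\<And>x. x \<in> T \<Longrightarrow> linear (B x)"
    and AB: "\<And>x v. x \<in> T \<Longrightarrow> A x (B x v) = v" "\<And>x v. x \<in> T \<Longrightarrow> B x (A x v) = v"
    and cont: "\<And>v. isCont (\<lambda>x. A x v) x0"
  shows "isCont (\<lambda>x. B x v) x0"
proof -
  have "inj (A x0)" using AB(2)[OF \<open>x0 \<in> T\<close>] by (metis injI)
  then obtain m where "m > 0" and m: "\<And>y. m * norm y \<le> norm (A x0 y)"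
    using linear_inj_bounded_below_pos[OF A[OF \<open>x0 \<in> T\<close>]] by blast
  have lim: "((\<lambda>x. A x u - A x0 u) \<longlongrightarrow> 0) (at x0)" for u
    using cont[of u] by (simp add: isCont_def LIM_zero)
  have "((\<lambda>x. \<Sum>b\<in>Basis. norm (A x b - A x0 b)) \<longlongrightarrow> 0) (at x0)"
    by (intro tendsto_null_sum tendsto_norm_zero lim)
  \<comment> \<open>Half of the lower bound \<open>m\<close> of \<open>A x0\<close> absorbs the
    perturbation, so \<open>A x\<close> keeps the lower bound \<open>m/2\<close>; its reciprocal is
    the constant \<open>2/m\<close> in \<open>ev\<close>.\<close>
  then have "\<forall>\<^sub>F x in at x0. (\<Sum>b\<in>Basis. norm (A x b - A x0 b)) < m/2"
    using \<open>m > 0\<close> by (auto dest: order_tendstoD(2)[of _ 0 _ "m/2"])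
  moreover have "\<forall>\<^sub>F x in at x0. x \<in> T" 
    using assms(1,2) by (simp add: eventually_at_in_open')
  ultimately have ev: "\<forall>\<^sub>F x in at x0. norm (B x v - B x0 v) \<le> (2/m) * norm (A x (B x0 v) - A x0 (B x0 v))"
  proof eventually_elim
    case (elim x)
    define u where "u = B x0 v"
    define y where "y = B x v - u"
    have "norm (A x y - A x0 y) = norm (\<Sum>b\<in>Basis. (y \<bullet> b) *\<^sub>R (A x b - A x0 b))"
      using linear_eq_sum_Basis[OF A[OF elim(2)], of y] linear_eq_sum_Basis[OF A[OF \<open>x0 \<in> T\<close>], of y]
      by (simp add: scaleR_diff_right sum_subtractf)
    also have "\<dots> \<le> (\<Sum>b\<in>Basis. norm y * norm (A x b - A x0 b))"
      by (rule sum_norm_le) (auto intro!: mult_right_mono Basis_le_norm)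
    also have "\<dots> \<le> norm y * (m/2)"
      unfolding sum_distrib_left[symmetric] using elim(1) by (intro mult_left_mono) auto
    finally have 1: "m/2 * norm y \<le> norm (A x y)"
      using m[of y] norm_triangle_ineq2[of "A x0 y" "A x y"] norm_minus_commute[of "A x0 y" "A x y"] by argo
    have "A x y = v - A x u"
      unfolding y_def using linear_diff[OF A[OF elim(2)]] AB(1)[OF elim(2)] by simp
    moreover have "A x0 u = v" unfolding u_def using AB(1)[OF \<open>x0 \<in> T\<close>] by simp
    ultimately have "norm (A x y) = norm (A x u - A x0 u)" by (simp add: norm_minus_commute)
    with 1 \<open>m > 0\<close> show ?case unfolding u_def[symmetric] y_def[symmetric] by (simp add: field_simps)
  qed
  have "((\<lambda>x. B x v - B x0 v) \<longlongrightarrow> 0) (at x0)"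
    using Lim_null_comparison[OF ev] tendsto_mult_right_zero[OF tendsto_norm_zero[OF lim[of "B x0 v"]]] by blast
  then show ?thesis by (simp add: isCont_def LIM_zero_iff)
qed

text \<open>With \<open>u = B x0 v\<close>, the identity \<open>B x v = u - B x (A x u - v)\<close>
  moves the variation into the argument of \<open>B x\<close>. That argument vanishes at
  \<open>x0\<close>, so after expansion in \<open>Basis\<close> the rule
  \<open>has_derivative_scaleR_vanishing\<close> applies with nothing but continuity of
  \<open>B\<close>.\<close>

lemma has_derivative_inverse_linear_family:
  fixes A B :: "'a::euclidean_space \<Rightarrow> 'b::euclidean_space \<Rightarrow> 'b"
  assumes "open T" "x0 \<in> T"
    and A: "\<And>x. x \<in> T \<Longrightarrow> linear (A x)" and B: "\<And>x. x \<in> T \<Longrightarrow> linear (B x)"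
    and AB: "\<And>x v. x \<in> T \<Longrightarrow> A x (B x v) = v" "\<And>x v. x \<in> T \<Longrightarrow> B x (A x v) = v"
    and D: "\<And>v. ((\<lambda>x. A x v) has_derivative (\<lambda>w. A' w v)) (at x0)"
  shows "((\<lambda>x. B x v) has_derivative (\<lambda>w. - B x0 (A' w (B x0 v)))) (at x0)"
proof -
  define u where "u = B x0 v"
  have contB: "isCont (\<lambda>x. B x c) x0" for c
  proof (rule isCont_inverse_linear_family[of T x0 A B, OF assms(1-6)])
    show "isCont (\<lambda>x. A x v) x0" for v using D[of v] has_derivative_continuous by blast
  qed
  have "((\<lambda>x. ((A x u - v) \<bullet> c) *\<^sub>R B x c) has_derivative (\<lambda>w. (A' w u \<bullet> c) *\<^sub>R B x0 c)) (at x0)" for c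
  proof (rule has_derivative_scaleR_vanishing)
    show "((\<lambda>x. (A x u - v) \<bullet> c) has_derivative (\<lambda>w. A' w u \<bullet> c)) (at x0)"
      by (rule has_derivative_inner_left) (use has_derivative_diff[OF D has_derivative_const] in simp)
    show "(A x0 u - v) \<bullet> c = 0" using AB(1)[OF \<open>x0 \<in> T\<close>] by (simp add: u_def)
  qed (rule contB)
  then have "((\<lambda>x. u - (\<Sum>c\<in>Basis. ((A x u - v) \<bullet> c) *\<^sub>R B x c)) has_derivative 
      (\<lambda>w. 0 - (\<Sum>c\<in>Basis. (A' w u \<bullet> c) *\<^sub>R B x0 c))) (at x0)"
    by (intro has_derivative_diff has_derivative_const has_derivative_sum) 
  then have "((\<lambda>x. u - (\<Sum>c\<in>Basis. ((A x u - v) \<bullet> c) *\<^sub>R B x c)) has_derivative (\<lambda>w. - B x0 (A' w u))) (at x0)"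
    by (simp only: linear_eq_sum_Basis[OF B[OF \<open>x0 \<in> T\<close>], symmetric] diff_0)
  then show ?thesis unfolding u_def[symmetric]
  proof (rule has_derivative_transform_within_open[OF _ \<open>open T\<close> \<open>x0 \<in> T\<close>])
    fix x assume "x \<in> T"
    then show "u - (\<Sum>c\<in>Basis. ((A x u - v) \<bullet> c) *\<^sub>R B x c) = B x v"
      using linear_eq_sum_Basis[OF B[OF \<open>x \<in> T\<close>], of "A x u - v", symmetric]
        linear_diff[OF B[OF \<open>x \<in> T\<close>], of "A x u" v] AB(2)[OF \<open>x \<in> T\<close>, of u] by (simp only:) simp
  qed
qed

text \<open>The formula \<open>- B x (A' x w (B x v))\<close> expresses the derivative of
  \<open>B\<close> by \<open>B\<close> itself and the derivative of \<open>A\<close>, so each order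
  of regularity of \<open>B\<close> yields the next.\<close>

lemma Ck_on_inverse_linear_family:
  fixes A B :: "'a::euclidean_space \<Rightarrow> 'b::euclidean_space \<Rightarrow> 'b"
  assumes "open T"
    and A: "\<And>x. x \<in> T \<Longrightarrow> linear (A x)" and B: "\<And>x. x \<in> T \<Longrightarrow> linear (B x)"
    and AB: "\<And>x v. x \<in> T \<Longrightarrow> A x (B x v) = v" "\<And>x v. x \<in> T \<Longrightarrow> B x (A x v) = v"
    and smooth: "\<And>k v. Ck_on k T (\<lambda>x. A x v)"
  shows "Ck_on k T (\<lambda>x. B x v)"
proof (induction k arbitrary: v)
  define A' where "A' x w v = frechet_derivative (\<lambda>x. A x v) (at x) w" for x w v
  have DA: "((\<lambda>x. A x v) has_derivative (\<lambda>w. A' x w v)) (at x)" if "x \<in> T" for x v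
    using Ck_on_Suc_has_derivative[OF smooth[of "Suc 0"] that] unfolding A'_def .
  have DB: "((\<lambda>x. B x v) has_derivative (\<lambda>w. - B x (A' x w (B x v)))) (at x)" if "x \<in> T" for x v
    by (rule has_derivative_inverse_linear_family[OF \<open>open T\<close> that A B AB DA[OF that]])
  {
    case 0
    show ?case
      using DB by (auto intro!: continuous_at_imp_continuous_on has_derivative_continuous)
  next
    case (Suc k)
    show ?case
    proof (rule Ck_on_SucI[OF \<open>open T\<close> DB])
      fix w
      \<comment> \<open>A Frechet derivative is linear in the direction \<open>w\<close>; linearity
        in the operator argument comes from differentiating the linearity of
        \<open>A x\<close>.\<close>
      have linA': "linear (A' x w)" if "x \<in> T" for x
      proof (rule linearI)
        have "((\<lambda>x. A x a + A x b) has_derivative (\<lambda>w. A' x w a + A' x w b)) (at x)" for a b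
          by (intro has_derivative_add DA that)
        then have add: "((\<lambda>x. A x (a + b)) has_derivative (\<lambda>w. A' x w a + A' x w b)) (at x)" for a b
          by (rule has_derivative_transform_within_open[OF _ \<open>open T\<close> that]) (simp add: linear_add A)
        show "A' x w (a + b) = A' x w a + A' x w b" for a b
          by (rule fun_cong[OF has_derivative_unique[OF DA[OF that] add]])
        have "((\<lambda>x. r *\<^sub>R A x a) has_derivative (\<lambda>w. r *\<^sub>R A' x w a)) (at x)" for a r
          by (intro has_derivative_scaleR_right DA that)
        then have scale: "((\<lambda>x. A x (r *\<^sub>R a)) has_derivative (\<lambda>w. r *\<^sub>R A' x w a)) (at x)" for a r
          by (rule has_derivative_transform_within_open[OF _ \<open>open T\<close> that]) (simp add: linear_scale A)
        show "A' x w (r *\<^sub>R a) = r *\<^sub>R A' x w a" for a r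
          by (rule fun_cong[OF has_derivative_unique[OF DA[OF that] scale]])
      qed
      have "Ck_on k T (\<lambda>x. A' x w v)" for v
        using smooth[of "Suc k" v] unfolding A'_def by simp
      then have "Ck_on k T (\<lambda>x. A' x w (B x v))"
        using Ck_on_linear_family_apply[OF \<open>open T\<close> Suc.IH[of v], of "\<lambda>x. A' x w"] linA' by blast
      then have "Ck_on k T (\<lambda>x. B x (A' x w (B x v)))"
        using Ck_on_linear_family_apply[OF \<open>open T\<close>, of k "\<lambda>x. A' x w (B x v)" B] Suc.IH B by blast
      then have "Ck_on k T (\<lambda>x. (-1) *\<^sub>R B x (A' x w (B x v)))"
        by (intro Ck_on_scaleR Ck_on_const \<open>open T\<close>)
      then show "Ck_on k T (\<lambda>x. - B x (A' x w (B x v)))" by simp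
    qed
  }
qed

section \<open>Smooth maps on arbitrary subsets\<close>

lemma smooth_onE:
  assumes "smooth_on S f" "x \<in> S"
  obtains T g where "open T" "x \<in> T" "\<And>k. Ck_on k T g" "\<And>y. y \<in> S \<Longrightarrow> y \<in> T \<Longrightarrow> g y = f y"
proof -
  obtain T g where "open T \<and> x \<in> T \<and> (\<forall>k. Ck_on k T g) \<and> (\<forall>y\<in>S \<inter> T. g y = f y)"
    using assms(1)[unfolded smooth_on_def, rule_format, OF assms(2)] by (elim exE)
  then show thesis by (intro that[of T g]) simp_all
qed

lemma smooth_onI:
  assumes "\<And>x. x \<in> S \<Longrightarrow> \<exists>T g. open T \<and> x \<in> T \<and> (\<forall>k. Ck_on k T g) \<and> (\<forall>y. y \<in> S \<longrightarrow> y \<in> T \<longrightarrow> g y = f y)"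
  shows "smooth_on S f"
  using assms by (simp only: smooth_on_def Ball_def Int_iff imp_conjL) simp

lemma smooth_on_subset:
  assumes "smooth_on S f" "S' \<subseteq> S"
  shows "smooth_on S' f"
proof (rule smooth_onI)
  fix x assume "x \<in> S'"
  then obtain T g where "open T" "x \<in> T" "\<And>k. Ck_on k T g" "\<And>y. y \<in> S \<Longrightarrow> y \<in> T \<Longrightarrow> g y = f y"
    using smooth_onE[OF assms(1)] assms(2) by (metis subsetD)
  then show "\<exists>T g. open T \<and> x \<in> T \<and> (\<forall>k. Ck_on k T g) \<and> (\<forall>y. y \<in> S' \<longrightarrow> y \<in> T \<longrightarrow> g y = f y)"
    using assms(2) by (intro exI[of _ T] exI[of _ g]) (simp add: subset_iff)
qed

lemma smooth_on_cong:
  assumes "smooth_on S f" "\<And>x. x \<in> S \<Longrightarrow> f x = g x"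
  shows "smooth_on S g"
proof (rule smooth_onI)
  fix x assume "x \<in> S"
  then obtain T h where "open T" "x \<in> T" "\<And>k. Ck_on k T h" "\<And>y. y \<in> S \<Longrightarrow> y \<in> T \<Longrightarrow> h y = f y"
    using smooth_onE[OF assms(1)] by metis
  then show "\<exists>T h. open T \<and> x \<in> T \<and> (\<forall>k. Ck_on k T h) \<and> (\<forall>y. y \<in> S \<longrightarrow> y \<in> T \<longrightarrow> h y = g y)"
    using assms(2) by (intro exI[of _ T] exI[of _ h]) simp
qed

lemma smooth_on_local:
  assumes "\<And>x. x \<in> S \<Longrightarrow> \<exists>T. open T \<and> x \<in> T \<and> smooth_on (S \<inter> T) f"
  shows "smooth_on S f"
proof (rule smooth_onI)
  fix x assume "x \<in> S"
  then obtain T where T: "open T" "x \<in> T" "smooth_on (S \<inter> T) f" using assms by blast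
  obtain U g where U: "open U" "x \<in> U" "\<And>k. Ck_on k U g" "\<And>y. y \<in> S \<inter> T \<Longrightarrow> y \<in> U \<Longrightarrow> g y = f y"
    using smooth_onE[OF T(3), of x] \<open>x \<in> S\<close> T(2) by blast
  show "\<exists>T g. open T \<and> x \<in> T \<and> (\<forall>k. Ck_on k T g) \<and> (\<forall>y. y \<in> S \<longrightarrow> y \<in> T \<longrightarrow> g y = f y)"
    by (intro exI[of _ "T \<inter> U"] exI[of _ g] conjI)
      (use T U in \<open>auto intro: Ck_on_subset[OF U(3)]\<close>)
qed

lemma smooth_on_linear: "linear f \<Longrightarrow> smooth_on S f"
  by (rule smooth_onI, intro exI[of _ UNIV] exI[of _ f]) (simp add: Ck_on_linear)

lemma smooth_on_compose:
  assumes "smooth_on S f" "smooth_on S' g" "f ` S \<subseteq> S'"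
  shows "smooth_on S (g \<circ> f)"
proof (rule smooth_onI)
  fix x assume "x \<in> S"
  obtain T F where T: "open T" "x \<in> T" "\<And>k. Ck_on k T F" "\<And>y. y \<in> S \<Longrightarrow> y \<in> T \<Longrightarrow> F y = f y"
    using smooth_onE[OF assms(1) \<open>x \<in> S\<close>] by metis
  have "f x \<in> S'" using assms(3) \<open>x \<in> S\<close> by blast
  obtain U G where U: "open U" "f x \<in> U" "\<And>k. Ck_on k U G" "\<And>y. y \<in> S' \<Longrightarrow> y \<in> U \<Longrightarrow> G y = g y"
    using smooth_onE[OF assms(2) \<open>f x \<in> S'\<close>] by metis
  have contF: "continuous_on T F" using T(3)[of 0] by simp
  define V where "V = T \<inter> F -` U"
  have "open V" unfolding V_def using contF T(1) U(1) by (metis continuous_on_open_vimage Int_commute)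
  moreover have "x \<in> V" unfolding V_def using T U \<open>x \<in> S\<close> by auto
  moreover have "Ck_on k V (G \<circ> F)" for k
    by (rule Ck_on_compose[OF \<open>open V\<close> U(1) _ Ck_on_subset[OF T(3)] U(3)]) (auto simp: V_def)
  moreover have "\<forall>y\<in>S \<inter> V. (G \<circ> F) y = (g \<circ> f) y"
  proof
    fix y assume y: "y \<in> S \<inter> V"
    then have "F y = f y" "F y \<in> U" "f y \<in> S'" using T(4) assms(3) unfolding V_def by auto
    then show "(G \<circ> F) y = (g \<circ> f) y" using U(4)[of "f y"] by simp
  qed
  ultimately show "\<exists>T h. open T \<and> x \<in> T \<and> (\<forall>k. Ck_on k T h) \<and> (\<forall>y. y \<in> S \<longrightarrow> y \<in> T \<longrightarrow> h y = (g \<circ> f) y)"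
    by (intro exI[of _ V] exI[of _ "G \<circ> F"]) simp
qed

lemma smooth_on_imp_continuous_on:
  assumes "smooth_on S f"
  shows "continuous_on S f"
  unfolding continuous_on
proof
  fix x assume "x \<in> S"
  obtain T F where T: "open T" "x \<in> T" "\<And>k. Ck_on k T F" "\<And>y. y \<in> S \<Longrightarrow> y \<in> T \<Longrightarrow> F y = f y"
    using smooth_onE[OF assms \<open>x \<in> S\<close>] by metis
  have "isCont F x" using T(3)[of 0] T(1,2) by (simp add: continuous_on_eq_continuous_at)
  then have "(F \<longlongrightarrow> f x) (at x within S)"
    using T(4)[OF \<open>x \<in> S\<close> T(2)] isContD tendsto_within_subset by fastforce
  moreover have "\<forall>\<^sub>F y in at x within S. F y = f y"
    using eventually_at_topological T by blast
  ultimately show "(f \<longlongrightarrow> f x) (at x within S)"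
    by (rule Lim_transform_eventually)
qed

text \<open>\<open>D\<close> is the derivative at \<open>x\<close> of a local extension of
  \<open>f\<close>, so a single linear map serves all curves that stay in \<open>S\<close>, even
  when \<open>S\<close> has empty interior.\<close>

lemma smooth_on_curve_derivative:
  fixes f :: "'a::euclidean_space \<Rightarrow> 'b::euclidean_space"
  assumes "smooth_on S f" "x \<in> S"
  obtains D where "linear D"
    "\<And>\<sigma> u. \<sigma> 0 = x \<Longrightarrow> (\<sigma> has_vector_derivative u) (at 0) \<Longrightarrow> \<forall>\<^sub>F t in nhds 0. \<sigma> t \<in> S \<Longrightarrow>
       ((\<lambda>t. f (\<sigma> t)) has_vector_derivative D u) (at (0::real))"
proof -
  obtain T F where T: "open T" "x \<in> T" "\<And>k. Ck_on k T F" "\<And>y. y \<in> S \<Longrightarrow> y \<in> T \<Longrightarrow> F y = f y"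
    using smooth_onE[OF assms] by metis
  define D where "D = frechet_derivative F (at x)"
  have D: "(F has_derivative D) (at x)"
    unfolding D_def using Ck_on_Suc_has_derivative T(2,3) by blast
  show thesis
  proof (rule that)
    show "linear D" using D has_derivative_linear by blast
    fix \<sigma> :: "real \<Rightarrow> 'a" and u
    assume \<sigma>: "\<sigma> 0 = x" "(\<sigma> has_vector_derivative u) (at 0)" "\<forall>\<^sub>F t in nhds 0. \<sigma> t \<in> S"
    have "((F \<circ> \<sigma>) has_vector_derivative D u) (at 0)"
      using vector_derivative_diff_chain_within[of \<sigma> u 0 UNIV F D]
        \<sigma>(1,2) D has_derivative_at_withinI by auto
    moreover have "\<forall>\<^sub>F t in nhds 0. \<sigma> t \<in> T"
    proof -
      have "isCont \<sigma> 0" using \<sigma>(2) has_vector_derivative_continuous by blast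
      then have "(\<sigma> \<longlongrightarrow> x) (nhds 0)" using \<sigma>(1) by (simp add: isCont_def tendsto_nhds_iff)
      then show ?thesis using T(1,2) topological_tendstoD by blast
    qed
    then have "\<forall>\<^sub>F t in nhds 0. (F \<circ> \<sigma>) t = f (\<sigma> t)"
      using \<sigma>(3) by eventually_elim (simp add: T(4))
    ultimately show "((\<lambda>t. f (\<sigma> t)) has_vector_derivative D u) (at 0)"
      by (subst has_vector_derivative_cong_ev[symmetric]) (auto dest: eventually_nhds_x_imp_x)
  qed
qed

section \<open>The inverse function theorem on subspaces\<close>

lemma subspace_projection:
  fixes L :: "'a::euclidean_space set"
  assumes "subspace L"
  obtains P where "linear P" "range P \<subseteq> L" "\<And>x. x \<in> L \<Longrightarrow> P x = x"
  using linear_exists_left_inverse_on[OF linear_id assms inj_on_id] by auto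

text \<open>A linear projection onto \<open>L\<close> fixes the curve near \<open>0\<close> and
  hence, by uniqueness of derivatives, its velocity.\<close>

lemma has_vector_derivative_in_subspace:
  fixes \<sigma> :: "real \<Rightarrow> 'a::euclidean_space"
  assumes L: "subspace L" and \<sigma>: "(\<sigma> has_vector_derivative v) (at 0)"
    and ev: "\<forall>\<^sub>F t in nhds 0. \<sigma> t \<in> L"
  shows "v \<in> L"
proof -
  obtain P where P: "linear P" "range P \<subseteq> L" "\<And>x. x \<in> L \<Longrightarrow> P x = x"
    using subspace_projection[OF L] by metis
  have "(P \<circ> \<sigma> has_vector_derivative P v) (at 0)"
    using vector_derivative_diff_chain_within[OF \<sigma> linear_imp_has_derivative[OF P(1)]] .
  moreover have "\<forall>\<^sub>F t in nhds 0. (P \<circ> \<sigma>) t = \<sigma> t"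
    using ev by eventually_elim (simp add: P(3))
  ultimately have "(\<sigma> has_vector_derivative P v) (at 0)"
    by (subst has_vector_derivative_cong_ev[symmetric]) (auto dest: eventually_nhds_x_imp_x)
  then have "v = P v" using vector_derivative_unique_at[OF \<sigma>] by blast
  then show "v \<in> L" using P(2) by (metis rangeI subsetD)
qed

text \<open>The derivative of the local inverse at \<open>y\<close> is the inverse of
  \<open>D (g y)\<close>. Inverses of a smooth operator family depend smoothly on the point, so
  \<open>g\<close> of class \<open>C\<^sup>k\<close> has a derivative of class
  \<open>C\<^sup>k\<close>, and the induction climbs through all orders.\<close>

lemma smooth_inverse_function:
  fixes f :: "'a::euclidean_space \<Rightarrow> 'a"
  assumes "open U" and smooth: "\<And>k. Ck_on k U f" and "p \<in> U"
    and inj: "inj (frechet_derivative f (at p))"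
  obtains U' V g where "open U'" "U' \<subseteq> U" "p \<in> U'" "open V" "homeomorphism U' V f g" "\<And>k. Ck_on k V g"
proof -
  define D where "D x = frechet_derivative f (at x)" for x
  have D: "(f has_derivative D x) (at x)" if "x \<in> U" for x
    using Ck_on_Suc_has_derivative[OF smooth that] unfolding D_def .
  define D' where "D' x = Blinfun (D x)" for x
  have D': "blinfun_apply (D' x) = D x" if "x \<in> U" for x
    unfolding D'_def using bounded_linear_Blinfun_apply has_derivative_bounded_linear[OF D[OF that]] by blast
  have smoothD: "Ck_on k U (\<lambda>x. D x v)" for k v
    unfolding D_def by (rule Ck_on_frechet_derivative[OF smooth])
  \<comment> \<open>Continuity in the operator norm, the form in which
    \<open>inverse_function_theorem\<close> wants it; in finite dimension continuity on each basis
    vector is enough.\<close>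
  have contD': "continuous_on U D'"
    unfolding continuous_on_eq_continuous_at[OF \<open>open U\<close>]
  proof (intro ballI continuous_blinfun_componentwiseI1)
    fix x i assume "x \<in> U"
    have "continuous_on U (\<lambda>x. D x i)" using smoothD[of 0 i] by simp
    then have "continuous_on U (\<lambda>x. D' x i)" using D' by (simp cong: continuous_on_cong)
    then show "isCont (\<lambda>x. D' x i) x"
      using \<open>x \<in> U\<close> continuous_on_eq_continuous_at[OF \<open>open U\<close>] by blast
  qed
  have linDp: "linear (D p)" using D[OF \<open>p \<in> U\<close>] has_derivative_linear by blast
  obtain L where L: "linear L" "L \<circ> D p = id"
    using linear_injective_left_inverse[OF linDp] inj unfolding D_def by blast
  have "Blinfun L o\<^sub>L D' p = id_blinfun"
  proof (rule blinfun_eqI)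
    show "blinfun_apply (Blinfun L o\<^sub>L D' p) v = blinfun_apply id_blinfun v" for v
      using L D'[OF \<open>p \<in> U\<close>] linear_conv_bounded_linear[of L] bounded_linear_Blinfun_apply[of L]
      by (simp add: fun_eq_iff)
  qed
  then obtain U' V g g' where g: "open U'" "U' \<subseteq> U" "p \<in> U'" "open V" "f p \<in> V" "homeomorphism U' V f g"
    and Dg: "\<And>y. y \<in> V \<Longrightarrow> (g has_derivative (g' y)) (at y)"
    and g': "\<And>y. y \<in> V \<Longrightarrow> g' y = inv (blinfun_apply (D' (g y)))"
    and bij: "\<And>y. y \<in> V \<Longrightarrow> bij (blinfun_apply (D' (g y)))"
    using inverse_function_theorem[OF \<open>open U\<close> _ contD' \<open>p \<in> U\<close>] D D' by metis
  have gV: "g y \<in> U'" "g y \<in> U" if "y \<in> V" for y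
    using g(2,6) that unfolding homeomorphism_def by auto
  have bijD: "bij (D x)" if "x \<in> U'" for x
  proof -
    have "f x \<in> V" "g (f x) = x" "x \<in> U" using g(2,6) that unfolding homeomorphism_def by auto
    then show ?thesis using bij[of "f x"] D' by simp
  qed
  have linD: "linear (D x)" if "x \<in> U'" for x
    using D g(2) that has_derivative_linear by blast
  have linI: "linear (inv (D x))" if "x \<in> U'" for x
    using inj_linear_imp_inv_bounded_linear[of "D x"] linD[OF that] bij_is_inj[OF bijD[OF that]]
    by (simp add: linear_conv_bounded_linear)
  have smooth_inv: "Ck_on k U' (\<lambda>x. inv (D x) v)" for k v
  proof (rule Ck_on_inverse_linear_family[of U' D "\<lambda>x. inv (D x)", OF g(1) linD linI])
    show "D x (inv (D x) v) = v" if "x \<in> U'" for x v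
      using bijD[OF that] by (simp add: bij_is_surj surj_f_inv_f)
    show "inv (D x) (D x v) = v" if "x \<in> U'" for x v
      using bijD[OF that] by (simp add: bij_is_inj inv_f_f)
    show "Ck_on k U' (\<lambda>x. D x v)" for k v using Ck_on_subset[OF smoothD g(2)] .
  qed
  have "Ck_on k V g" for k
  proof (induction k)
    case 0
    show ?case using g(6) by (simp add: homeomorphism_def)
  next
    case (Suc k)
    show ?case
    proof (rule Ck_on_SucI[OF g(4) Dg])
      fix v
      have "Ck_on k V ((\<lambda>x. inv (D x) v) \<circ> g)"
        by (rule Ck_on_compose[OF g(4,1) _ Suc smooth_inv]) (use gV in auto)
      then show "Ck_on k V (\<lambda>y. g' y v)"
        by (rule Ck_on_cong[OF g(4), rotated]) (simp add: g' D' gV)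
    qed
  qed
  with that g show thesis by blast
qed

text \<open>The inverse function theorem between subspaces follows from the one for the ambient space,
  applied to \<open>G x = \<phi> (g (P x)) + (x - P x)\<close> with \<open>P\<close> a projection onto \<open>L\<close> and
  \<open>\<phi>\<close> an isomorphism from \<open>L'\<close> onto \<open>L\<close>.\<close>

lemma smooth_inverse_function_subspace:
  fixes g :: "'a::euclidean_space \<Rightarrow> 'b::euclidean_space"
  assumes L: "subspace L" and L': "subspace L'" and dims: "dim L = dim L'"
    and A: "openin (top_of_set L) A" "p \<in> A" and g: "smooth_on A g" "g ` A \<subseteq> L'"
    and inj: "\<And>u. u \<in> L \<Longrightarrow> ((\<lambda>t. g (p + t *\<^sub>R u)) has_vector_derivative 0) (at 0) \<Longrightarrow> u = 0"
  obtains A' B' h where "openin (top_of_set L) A'" "A' \<subseteq> A" "p \<in> A'" "openin (top_of_set L') B'"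
    "homeomorphism A' B' g h" "smooth_on B' h"
proof -
  obtain T F where T: "open T" "p \<in> T" "\<And>k. Ck_on k T F" "\<And>y. y \<in> A \<Longrightarrow> y \<in> T \<Longrightarrow> F y = g y"
    using smooth_onE[OF g(1) A(2)] by metis
  obtain W where W: "open W" "A = L \<inter> W" using A(1) by (auto simp: openin_open)
  define T0 where "T0 = T \<inter> W"
  have T0: "open T0" "p \<in> T0" using T W A(2) by (auto simp: T0_def)
  have FA: "F x = g x" "x \<in> A" if "x \<in> L" "x \<in> T0" for x using that T(4) W by (auto simp: T0_def)
  have "p \<in> L" using A W by blast
  obtain \<phi> \<psi> where \<phi>: "linear \<phi>" "linear \<psi>" "\<phi> ` L' = L" "\<And>y. y \<in> L' \<Longrightarrow> \<psi> (\<phi> y) = y"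
    using isometries_subspaces[OF L' L dims[symmetric]] by metis
  obtain P where P: "linear P" "range P \<subseteq> L" "\<And>x. x \<in> L \<Longrightarrow> P x = x"
    using subspace_projection[OF L] by metis
  \<comment> \<open>\<open>P\<close> has to land where \<open>F\<close> is a smooth extension and
    where points of \<open>L\<close> belong to \<open>A\<close>; \<open>T0\<close> is that
    region.\<close>
  define U where "U = P -` T0"
  have U: "open U" "p \<in> U"
    using T0 P \<open>p \<in> L\<close> linear_continuous_on[of P] 
    by (auto simp: U_def linear_conv_bounded_linear intro!: open_vimage)
  define G where "G = (\<lambda>x. \<phi> (F (P x)) + (x - P x))"
  have smooth: "Ck_on k U G" for k
  proof -
    have 1: "Ck_on k U (F \<circ> P)"
      by (rule Ck_on_compose[OF U(1) T0(1) _ Ck_on_linear[OF P(1) U(1)] Ck_on_subset[OF T(3)]])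
        (auto simp: U_def T0_def)
    have 2: "Ck_on k U (\<phi> \<circ> (F \<circ> P))"
      by (rule Ck_on_compose[OF U(1) open_UNIV _ 1 Ck_on_linear[OF \<phi>(1)]]) auto
    have "linear (\<lambda>x. x - P x)" using P(1) linear_compose_sub[OF linear_ident] by blast
    then have "Ck_on k U (\<lambda>x. (\<phi> \<circ> (F \<circ> P)) x + (x - P x))"
      using Ck_on_add[OF U(1) 2] Ck_on_linear U(1) by blast
    then show ?thesis by (simp add: G_def)
  qed
  define DF where "DF = frechet_derivative F (at p)"
  have DF: "(F has_derivative DF) (at p)"
    unfolding DF_def by (rule Ck_on_Suc_has_derivative[OF T(3) T(2)])
  have DG: "(G has_derivative (\<lambda>v. \<phi> (DF (P v)) + (v - P v))) (at p)"
  proof -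
    have "((F \<circ> P) has_derivative (DF \<circ> P)) (at p)"
      using diff_chain_at[OF linear_imp_has_derivative[OF P(1)]] DF P(3)[OF \<open>p \<in> L\<close>] by metis
    then have "((\<phi> \<circ> (F \<circ> P)) has_derivative (\<phi> \<circ> (DF \<circ> P))) (at p)"
      using diff_chain_at linear_imp_has_derivative[OF \<phi>(1)] by blast
    then show ?thesis unfolding G_def
      by (auto intro!: derivative_eq_intros linear_imp_has_derivative[OF P(1)] simp: o_def)
  qed
  have linDF: "linear DF" using DF has_derivative_linear by blast
  \<comment> \<open>Along \<open>L\<close> the derivative of the extension is determined by
    \<open>g\<close>: it is the derivative on lines in \<open>L\<close>, and it has values in
    \<open>L'\<close> because \<open>g\<close> does. This links the hypothesis on \<open>g\<close>
    to \<open>DF\<close>.\<close>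
  have curve: "((\<lambda>t. g (p + t *\<^sub>R u)) has_vector_derivative DF u) (at 0)" "DF u \<in> L'" if "u \<in> L" for u
  proof -
    have line: "((\<lambda>t. p + t *\<^sub>R u) has_vector_derivative u) (at 0)"
      by (auto intro!: derivative_eq_intros)
    have "((F \<circ> (\<lambda>t. p + t *\<^sub>R u)) has_vector_derivative DF u) (at 0)"
      using vector_derivative_diff_chain_within[OF line, of F DF] DF has_derivative_at_withinI by auto
    moreover have ev: "\<forall>\<^sub>F t in nhds 0. g (p + t *\<^sub>R u) = (F \<circ> (\<lambda>t. p + t *\<^sub>R u)) t \<and> g (p + t *\<^sub>R u) \<in> L'"
    proof -
      have "((\<lambda>t. p + t *\<^sub>R u) \<longlongrightarrow> p + 0 *\<^sub>R u) (nhds 0)" by (intro tendsto_intros filterlim_ident)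
      then have "\<forall>\<^sub>F t in nhds 0. p + t *\<^sub>R u \<in> T0" using T0 topological_tendstoD by fastforce
      then show ?thesis
      proof eventually_elim
        case (elim t)
        then have "p + t *\<^sub>R u \<in> L" using L that \<open>p \<in> L\<close> by (simp add: subspace_add subspace_scale)
        with elim FA g(2) show ?case by force
      qed
    qed
    ultimately show *: "((\<lambda>t. g (p + t *\<^sub>R u)) has_vector_derivative DF u) (at 0)"
      by (subst has_vector_derivative_cong_ev) (auto dest: eventually_nhds_x_imp_x elim: eventually_mono)
    show "DF u \<in> L'"
      by (rule has_vector_derivative_in_subspace[OF L' *]) (use ev in \<open>auto elim: eventually_mono\<close>)
  qed
  have "inj (frechet_derivative G (at p))"
  proof -
    \<comment> \<open>Modulo \<open>L\<close> the derivative of \<open>G\<close> is the identity, so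
      a kernel vector lies in \<open>L\<close>. There the equation becomes
      \<open>\<phi> (DF v) = 0\<close>, and \<open>\<phi>\<close> is injective on
      \<open>L'\<close>.\<close>
    have "v = 0" if v: "\<phi> (DF (P v)) + (v - P v) = 0" for v
    proof -
      have Pv: "P v \<in> L" using P(2) by blast
      then have \<phi>L: "\<phi> (DF (P v)) \<in> L" using curve(2) \<phi>(3) by blast
      have "v = P v - \<phi> (DF (P v))" using v by (simp add: algebra_simps)
      then have "v \<in> L" using subspace_diff[OF L Pv \<phi>L] by simp
      then have "\<phi> (DF v) = 0" using v P(3) by simp
      then have "DF v = 0" using \<phi>(4)[OF curve(2)[OF \<open>v \<in> L\<close>]] linear_0[OF \<phi>(2)] by simp
      then show "v = 0" using inj[OF \<open>v \<in> L\<close>] curve(1)[OF \<open>v \<in> L\<close>] by simp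
    qed
    then have "inj (\<lambda>v. \<phi> (DF (P v)) + (v - P v))"
      using linear_injective_0[of "\<lambda>v. \<phi> (DF (P v)) + (v - P v)"] has_derivative_linear[OF DG] by blast
    then show ?thesis using frechet_derivative_at[OF DG] by simp
  qed
  then obtain U' V h0 where h0: "open U'" "U' \<subseteq> U" "p \<in> U'" "open V" "homeomorphism U' V G h0" "\<And>k. Ck_on k V h0"
    using smooth_inverse_function[OF U(1) smooth U(2)] by metis
  have G_L: "G x = \<phi> (g x)" "x \<in> A" "g x \<in> L'" if "x \<in> L" "x \<in> U'" for x
  proof -
    have "x \<in> T0" using that h0(2) P(3) by (auto simp: U_def)
    then show "x \<in> A" "G x = \<phi> (g x)" "g x \<in> L'" using FA[OF that(1)] P(3)[OF that(1)] g(2) by (auto simp: G_def)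
  qed
  \<comment> \<open>\<open>G\<close> moves points of \<open>U\<close> only within their cosets of
    \<open>L\<close>, so its inverse sends points of \<open>L\<close> back to
    \<open>L\<close>.\<close>
  have h0_L: "h0 y \<in> L" if "y \<in> V" "y \<in> L" for y
  proof -
    have x: "h0 y \<in> U'" "G (h0 y) = y" using h0(5) that by (auto simp: homeomorphism_def)
    let ?x = "h0 y"
    have "P ?x \<in> T0" "P ?x \<in> L" using x(1) h0(2) P(2) by (auto simp: U_def)
    then have "F (P ?x) \<in> L'" using FA g(2) by auto
    then have "\<phi> (F (P ?x)) \<in> L" using \<phi>(3) by blast
    moreover have "?x = y - \<phi> (F (P ?x)) + P ?x" using x(2) by (simp add: G_def algebra_simps)
    ultimately show ?thesis using that(2) \<open>P ?x \<in> L\<close> subspace_diff[OF L] subspace_add[OF L] by metis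
  qed
  define A' where "A' = L \<inter> U'"
  define B' where "B' = L' \<inter> \<phi> -` V"
  define h where "h = h0 \<circ> \<phi>"
  have cont\<phi>: "continuous_on X \<phi>" for X using \<phi>(1) linear_continuous_on linear_conv_bounded_linear by blast
  have openV: "open (\<phi> -` V)" using h0(4) cont\<phi>[of UNIV] by (simp add: open_vimage)
  show thesis
  proof (rule that)
    show "openin (top_of_set L) A'" using h0(1) by (auto simp: A'_def openin_open)
    show "A' \<subseteq> A" using G_L by (auto simp: A'_def)
    show "p \<in> A'" using h0(3) \<open>p \<in> L\<close> by (simp add: A'_def)
    show "openin (top_of_set L') B'" using openV by (auto simp: B'_def openin_open)
    have "Ck_on k (\<phi> -` V) h" for k
      unfolding h_def by (rule Ck_on_compose[OF openV h0(4) _ Ck_on_linear[OF \<phi>(1) openV] h0(6)]) auto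
    then show "smooth_on B' h"
      by (intro smooth_onI exI[of _ "\<phi> -` V"] exI[of _ h]) (auto simp: openV B'_def simp del: Ck_on.simps)
    have gA': "g x \<in> B'" "h (g x) = x" if "x \<in> A'" for x
      using that G_L[of x] h0(5) by (auto simp: A'_def B'_def h_def homeomorphism_def dest: sym)
    have hB': "h y \<in> A'" "g (h y) = y" if "y \<in> B'" for y
    proof -
      have y: "y \<in> L'" "\<phi> y \<in> V" "\<phi> y \<in> L" using that \<phi>(3) by (auto simp: B'_def)
      then have x: "h y \<in> L" "h y \<in> U'" "G (h y) = \<phi> y"
        using h0_L h0(5) by (auto simp: h_def homeomorphism_def)
      then show "h y \<in> A'" by (simp add: A'_def)
      have "\<phi> (g (h y)) = \<phi> y" "g (h y) \<in> L'" using G_L[OF x(1,2)] x(3) by auto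
      then show "g (h y) = y" using \<phi>(4) y(1) by metis
    qed
    show "homeomorphism A' B' g h"
    proof (rule homeomorphismI)
      show "continuous_on A' g"
        using smooth_on_imp_continuous_on[OF g(1)] \<open>A' \<subseteq> A\<close> continuous_on_subset by blast
      show "continuous_on B' h"
        using smooth_on_imp_continuous_on[OF \<open>smooth_on B' h\<close>] .
    qed (use gA' hB' in auto)
  qed
qed

section \<open>Local homeomorphisms from a compact space\<close>

lemma connected_space_top_of_set: "connected_space (top_of_set S) \<longleftrightarrow> connected S"
  using connectedin_iff_connected[of S] by (simp add: connectedin_def del: connectedin_iff_connected)

text \<open>The local inverse \<open>s\<close> is carried along with its domain because lifts are
  obtained by composing with such sections.\<close>

definition local_homeo :: "'a topology \<Rightarrow> 'b topology \<Rightarrow> ('a \<Rightarrow> 'b) \<Rightarrow> bool" where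
  "local_homeo X Y f \<longleftrightarrow>
     continuous_map X Y f \<and>
     (\<forall>x\<in>topspace X. \<exists>U V s. openin X U \<and> x \<in> U \<and> openin Y V \<and> continuous_map (subtopology Y V) X s \<and>
        f ` U \<subseteq> V \<and> s ` V \<subseteq> U \<and> (\<forall>y\<in>V. f (s y) = y) \<and> (\<forall>x\<in>U. s (f x) = x))"

lemma local_homeoE:
  assumes "local_homeo X Y f" "x \<in> topspace X"
  obtains U V s where "openin X U" "x \<in> U" "openin Y V" "continuous_map (subtopology Y V) X s"
    "f ` U \<subseteq> V" "s ` V \<subseteq> U" "\<And>y. y \<in> V \<Longrightarrow> f (s y) = y" "\<And>x. x \<in> U \<Longrightarrow> s (f x) = x"
proof -
  obtain U V s where "openin X U \<and> x \<in> U \<and> openin Y V \<and> continuous_map (subtopology Y V) X s \<and>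
        f ` U \<subseteq> V \<and> s ` V \<subseteq> U \<and> (\<forall>y\<in>V. f (s y) = y) \<and> (\<forall>x\<in>U. s (f x) = x)"
    using assms(2) assms(1)[unfolded local_homeo_def] by metis
  then show thesis by (intro that[of U V s]) auto
qed

text \<open>The set where the two lifts agree is open, since \<open>f\<close> is injective on the
  sets \<open>U\<close> of \<open>local_homeo\<close>, and closed, since \<open>X\<close> is
  Hausdorff.\<close>

lemma local_homeo_unique_lift:
  assumes f: "local_homeo X Y f" and "Hausdorff_space X" and "connected_space Z"
    and g: "continuous_map Z X g" and h: "continuous_map Z X h"
    and eq: "\<And>z. z \<in> topspace Z \<Longrightarrow> f (g z) = f (h z)"
    and "z0 \<in> topspace Z" "g z0 = h z0" "z \<in> topspace Z"
  shows "g z = h z"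
proof -
  let ?E = "{z \<in> topspace Z. g z = h z}"
  have "openin Z ?E"
  proof (subst openin_subopen, intro ballI)
    fix z assume z: "z \<in> ?E"
    then have "g z \<in> topspace X" using g continuous_map_image_subset_topspace by fastforce
    then obtain U V s where U: "openin X U" "g z \<in> U" "\<And>x. x \<in> U \<Longrightarrow> s (f x) = x"
      using local_homeoE[OF f] by metis
    let ?T = "{z \<in> topspace Z. g z \<in> U} \<inter> {z \<in> topspace Z. h z \<in> U}"
    have "openin Z ?T"
      using openin_continuous_map_preimage[OF g U(1)] openin_continuous_map_preimage[OF h U(1)]
      by (rule openin_Int)
    moreover have "?T \<subseteq> ?E"
    proof
      fix w assume w: "w \<in> ?T"
      then have "g w = s (f (g w))" using U(3) by simp
      also have "\<dots> = h w" using U(3) eq w by simp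
      finally show "w \<in> ?E" using w by simp
    qed
    ultimately show "\<exists>T. openin Z T \<and> z \<in> T \<and> T \<subseteq> ?E" 
      using z U(2) by (intro exI[of _ ?T]) auto
  qed
  moreover have "closedin Z ?E" by (rule closedin_continuous_maps_eq[OF assms(2) g h])
  ultimately have "?E = topspace Z"
    using \<open>connected_space Z\<close> assms(7,8) connected_space_clopen_in by blast
  then show ?thesis using assms(9) by blast
qed

text \<open>By compactness of the fibre over \<open>y\<close>, finitely many local inverses reach every point of the
  fibre; the rest of \<open>X\<close> has a closed image that avoids \<open>y\<close>.\<close>

lemma compact_local_homeo_sections:
  assumes f: "local_homeo X Y f" and X: "compact_space X" and Y: "Hausdorff_space Y"
    and y: "y \<in> topspace Y"
  obtains V where "openin Y V" "y \<in> V"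
    "\<And>x. x \<in> topspace X \<Longrightarrow> f x \<in> V \<Longrightarrow>
      \<exists>s. continuous_map (subtopology Y V) X s \<and> s (f x) = x \<and> (\<forall>y\<in>V. f (s y) = y)"
proof -
  have cont: "continuous_map X Y f" using f by (simp add: local_homeo_def)
  define good where "good W V s \<longleftrightarrow> openin X W \<and> openin Y V \<and> continuous_map (subtopology Y V) X s \<and>
        f ` W \<subseteq> V \<and> (\<forall>y\<in>V. f (s y) = y) \<and> (\<forall>x\<in>W. s (f x) = x)" for W V s
  define K where "K = {x \<in> topspace X. f x \<in> {y}}"
  define \<U> where "\<U> = {W. \<exists>V s. good W V s \<and> y \<in> V}"
  have "closedin X K"
    unfolding K_def using cont closedin_continuous_map_preimage closedin_Hausdorff_singleton[OF Y y] by blast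
  then have "compactin X K" using X closedin_compact_space by blast
  moreover have "openin X W" if "W \<in> \<U>" for W using that by (auto simp: \<U>_def good_def)
  moreover have "K \<subseteq> \<Union>\<U>"
  proof
    fix x assume x: "x \<in> K"
    then have "x \<in> topspace X" by (simp add: K_def)
    then obtain U V s where U: "openin X U" "x \<in> U" "openin Y V" "continuous_map (subtopology Y V) X s"
      "f ` U \<subseteq> V" "s ` V \<subseteq> U" "\<And>y. y \<in> V \<Longrightarrow> f (s y) = y" "\<And>x. x \<in> U \<Longrightarrow> s (f x) = x"
      by (rule local_homeoE[OF f]) (rule that)
    have "good U V s" "y \<in> V" using U x by (auto simp: good_def K_def)
    then show "x \<in> \<Union>\<U>" using U(2) by (auto simp: \<U>_def)
  qed
  ultimately obtain \<F> where \<F>: "finite \<F>" "\<F> \<subseteq> \<U>" "K \<subseteq> \<Union>\<F>"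
    using compactinD[of X K \<U>] by blast
  have "\<forall>W\<in>\<F>. \<exists>Vs. good W (fst Vs) (snd Vs) \<and> y \<in> fst Vs"
    using \<F>(2) by (auto simp: \<U>_def)
  then obtain Vs where Vs: "\<And>W. W \<in> \<F> \<Longrightarrow> good W (fst (Vs W)) (snd (Vs W)) \<and> y \<in> fst (Vs W)"
    by metis
  define V where "V W = fst (Vs W)" for W
  define s where "s W = snd (Vs W)" for W
  have Vs: "openin X W" "openin Y (V W)" "continuous_map (subtopology Y (V W)) X (s W)" "y \<in> V W"
    "\<And>y. y \<in> V W \<Longrightarrow> f (s W y) = y" "\<And>x. x \<in> W \<Longrightarrow> s W (f x) = x" if "W \<in> \<F>" for W
    using Vs[OF that] by (simp_all add: good_def V_def s_def)
  define C where "C = topspace X - \<Union>\<F>"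
  have "openin X (\<Union>\<F>)" using Vs(1) by blast
  then have "closedin X C" unfolding C_def by auto
  then have "closedin Y (f ` C)" using continuous_imp_closed_map[OF cont X Y] by (simp add: closed_map_def)
  \<comment> \<open>The factor \<open>topspace Y\<close> matters when the fibre is empty:
    \<open>\<F>\<close> may then be empty too, and the intersection of no sets is
    \<open>UNIV\<close>.\<close>
  define V0 where "V0 = topspace Y \<inter> (\<Inter>W\<in>\<F>. V W) - f ` C"
  have "openin Y (topspace Y \<inter> (\<Inter>W\<in>\<F>. V W))"
    using \<F>(1) Vs(2) by (cases "\<F> = {}") (auto intro!: openin_Int openin_Inter)
  then have "openin Y V0" unfolding V0_def using \<open>closedin Y (f ` C)\<close> by (rule openin_diff)
  moreover have "y \<in> V0" using y Vs(4) \<F>(3) by (auto simp: V0_def C_def K_def)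
  moreover have "\<exists>s. continuous_map (subtopology Y V0) X s \<and> s (f x) = x \<and> (\<forall>y\<in>V0. f (s y) = y)"
    if x: "x \<in> topspace X" "f x \<in> V0" for x
  proof -
    obtain W where W: "W \<in> \<F>" "x \<in> W" using x by (auto simp: V0_def C_def)
    have "V0 \<subseteq> V W" using W(1) by (auto simp: V0_def)
    then show ?thesis
      using Vs(5,6)[OF W(1)] W(2) continuous_map_from_subtopology_mono[OF Vs(3)[OF W(1)]]
      by (intro exI[of _ "s W"]) auto
  qed
  ultimately show thesis by (rule that)
qed

section \<open>Lifting maps of rectangles\<close>

text \<open>The value may be prescribed at any point of \<open>R\<close>, so that gluing can start
  on either side of a cut.\<close>

definition has_lifts :: "'a topology \<Rightarrow> ('a \<Rightarrow> 'b) \<Rightarrow> ('c::topological_space \<Rightarrow> 'b) \<Rightarrow> 'c set \<Rightarrow> bool" where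
  "has_lifts X f H R \<longleftrightarrow>
     (\<forall>q\<in>R. \<forall>x\<in>topspace X. f x = H q \<longrightarrow>
        (\<exists>g. continuous_map (top_of_set R) X g \<and> g q = x \<and> (\<forall>r\<in>R. f (g r) = H r)))"

lemma has_liftsE:
  assumes "has_lifts X f H R" "q \<in> R" "x \<in> topspace X" "f x = H q"
  obtains g where "continuous_map (top_of_set R) X g" "g q = x" "\<forall>r\<in>R. f (g r) = H r"
  using assms unfolding has_lifts_def by blast

text \<open>The function \<open>p\<close> cuts \<open>R\<close> at the level \<open>b\<close>. The
  half containing the prescribed point is lifted first, the other half then through the value
  reached at a point \<open>c\<close> of the cut. As the cut is connected, unique lifting makes both
  lifts agree on all of it.\<close>

lemma has_lifts_glue:
  fixes p :: "'c::topological_space \<Rightarrow> real"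
  assumes f: "local_homeo X Y f" and X: "Hausdorff_space X"
    and p: "continuous_on UNIV p"
    and R1: "has_lifts X f H (R \<inter> {q. p q \<le> b})" and R2: "has_lifts X f H (R \<inter> {q. b \<le> p q})"
    and conn: "connected (R \<inter> {q. p q = b})" and ne: "R \<inter> {q. p q = b} \<noteq> {}"
  shows "has_lifts X f H R"
proof -
  let ?R1 = "R \<inter> {q. p q \<le> b}" and ?R2 = "R \<inter> {q. b \<le> p q}" and ?I = "R \<inter> {q. p q = b}"
  obtain c where c: "c \<in> ?I" using ne by blast
  then have c1: "c \<in> ?R1" and c2: "c \<in> ?R2" by auto
  have glue: "\<exists>g. continuous_map (top_of_set R) X g \<and> (\<forall>r\<in>?R1. g r = g1 r) \<and> (\<forall>r\<in>?R2. g r = g2 r) \<and> (\<forall>r\<in>R. f (g r) = H r)"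
    if g1: "continuous_map (top_of_set ?R1) X g1" "\<forall>r\<in>?R1. f (g1 r) = H r"
      and g2: "continuous_map (top_of_set ?R2) X g2" "\<forall>r\<in>?R2. f (g2 r) = H r" 
      and eqc: "g1 c = g2 c" for g1 g2
  proof -
    have eq: "g1 r = g2 r" if "r \<in> ?I" for r
    proof (rule local_homeo_unique_lift[OF f X, of "top_of_set ?I" g1 g2 c])
      show "continuous_map (top_of_set ?I) X g1"
        by (rule continuous_map_from_subtopology_mono[OF g1(1)]) auto
      show "continuous_map (top_of_set ?I) X g2"
        by (rule continuous_map_from_subtopology_mono[OF g2(1)]) auto
    qed (use g1 g2 that c eqc conn in \<open>auto simp: connected_space_top_of_set\<close>)
    let ?g = "\<lambda>q. if p q \<le> b then g1 q else g2 q"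
    have "continuous_map (top_of_set R) X ?g"
    proof (rule continuous_map_cases_le)
      have "{x \<in> R. p x \<le> b} = ?R1" "{x \<in> R. b \<le> p x} = ?R2" by auto
      then show "continuous_map (subtopology (top_of_set R) {x \<in> topspace (top_of_set R). p x \<le> b}) X g1"
        "continuous_map (subtopology (top_of_set R) {x \<in> topspace (top_of_set R). b \<le> p x}) X g2"
        using g1(1) g2(1) by (auto simp: subtopology_subtopology Int_absorb1 Int_absorb2)
    qed (use eq p in \<open>auto intro: continuous_on_subset\<close>)
    moreover have "\<forall>r\<in>?R2. ?g r = g2 r" using eq by auto
    ultimately show ?thesis using g1(2) g2(2) by (intro exI[of _ ?g]) auto
  qed
  have inX: "g r \<in> topspace X" if "continuous_map (top_of_set S) X g" "r \<in> S" for g S r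
    using that continuous_map_image_subset_topspace by fastforce
  show ?thesis
    unfolding has_lifts_def
  proof (intro ballI impI)
    fix q x assume q: "q \<in> R" "x \<in> topspace X" "f x = H q"
    show "\<exists>g. continuous_map (top_of_set R) X g \<and> g q = x \<and> (\<forall>r\<in>R. f (g r) = H r)"
    proof (cases "p q \<le> b")
      case True
      then have qR: "q \<in> ?R1" using q(1) by simp
      obtain g1 where g1: "continuous_map (top_of_set ?R1) X g1" "g1 q = x" "\<forall>r\<in>?R1. f (g1 r) = H r"
        by (rule has_liftsE[OF R1 qR q(2,3)])
      have "f (g1 c) = H c" using g1(3) c1 by blast
      from has_liftsE[OF R2 c2 inX[OF g1(1) c1] this] obtain g2
        where g2: "continuous_map (top_of_set ?R2) X g2" "g2 c = g1 c" "\<forall>r\<in>?R2. f (g2 r) = H r" .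
      obtain g where "continuous_map (top_of_set R) X g" "\<forall>r\<in>?R1. g r = g1 r" "\<forall>r\<in>R. f (g r) = H r"
        using glue[OF g1(1,3) g2(1,3) g2(2)[symmetric]] by blast
      then show ?thesis using g1(2) qR by (intro exI[of _ g]) auto
    next
      case False
      then have qR: "q \<in> ?R2" using q(1) by simp
      obtain g2 where g2: "continuous_map (top_of_set ?R2) X g2" "g2 q = x" "\<forall>r\<in>?R2. f (g2 r) = H r"
        by (rule has_liftsE[OF R2 qR q(2,3)])
      have "f (g2 c) = H c" using g2(3) c2 by blast
      from has_liftsE[OF R1 c1 inX[OF g2(1) c2] this] obtain g1
        where g1: "continuous_map (top_of_set ?R1) X g1" "g1 c = g2 c" "\<forall>r\<in>?R1. f (g1 r) = H r" .
      obtain g where "continuous_map (top_of_set R) X g" "\<forall>r\<in>?R2. g r = g2 r" "\<forall>r\<in>R. f (g r) = H r"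
        using glue[OF g1(1,3) g2(1,3) g1(2)] by blast
      then show ?thesis using g2(2) qR by (intro exI[of _ g]) auto
    qed
  qed
qed

text \<open>Subdivision in two stages by \<open>Bolzano\<close>: around a fixed abscissa
  \<open>s\<close> small rectangles are stacked into a thin strip over all of \<open>{c..d}\<close>,
  and then strips are put side by side. Neighbours share a segment, which is connected, so
  \<open>has_lifts_glue\<close> joins them.\<close>

lemma has_lifts_rectangle:
  fixes H :: "real \<times> real \<Rightarrow> 'b"
  assumes f: "local_homeo X Y f" and X: "compact_space X" "Hausdorff_space X" and Y: "Hausdorff_space Y"
    and H: "continuous_map euclidean Y H" and "a \<le> b" "c \<le> d"
  shows "has_lifts X f H ({a..b} \<times> {c..d})"
proof -
  \<comment> \<open>Near \<open>q\<close> the map \<open>H\<close> stays in one set \<open>V\<close>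
    provided by \<open>compact_local_homeo_sections\<close>, so composing with a suitable section
    lifts it through any prescribed point.\<close>
  have loc: "\<exists>e>0. \<forall>R \<subseteq> ball q e. has_lifts X f H R" for q
  proof -
    have "H q \<in> topspace Y" using H continuous_map_image_subset_topspace by fastforce
    then obtain V where V: "openin Y V" "H q \<in> V"
      "\<And>x. x \<in> topspace X \<Longrightarrow> f x \<in> V \<Longrightarrow>
        \<exists>s. continuous_map (subtopology Y V) X s \<and> s (f x) = x \<and> (\<forall>y\<in>V. f (s y) = y)"
      using compact_local_homeo_sections[OF f X(1) Y] by metis
    have "open {q. H q \<in> V}" using openin_continuous_map_preimage[OF H V(1)] by simp
    then obtain e where e: "e > 0" "\<And>r. r \<in> ball q e \<Longrightarrow> H r \<in> V"
      using V(2) unfolding open_contains_ball by blast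
    have "has_lifts X f H R" if R: "R \<subseteq> ball q e" for R
      unfolding has_lifts_def
    proof (intro ballI impI)
      fix r x assume r: "r \<in> R" "x \<in> topspace X" "f x = H r"
      then obtain s where s: "continuous_map (subtopology Y V) X s" "s (f x) = x" "\<forall>y\<in>V. f (s y) = y"
        using V(3)[of x] e(2) R by (metis subsetD)
      have "continuous_map (top_of_set R) (subtopology Y V) H"
        using H R e(2) by (auto simp: continuous_map_in_subtopology intro: continuous_map_from_subtopology)
      then have "continuous_map (top_of_set R) X (s \<circ> H)" using s(1) continuous_map_compose by blast
      then show "\<exists>g. continuous_map (top_of_set R) X g \<and> g r = x \<and> (\<forall>r\<in>R. f (g r) = H r)"
        using s R r e(2) by (intro exI[of _ "s \<circ> H"]) auto
    qed
    then show ?thesis using e(1) by blast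
  qed
  \<comment> \<open>The width \<open>\<delta>\<close> may depend on \<open>s\<close> but not on the
    interval around \<open>s\<close>; stacking two pieces takes the smaller of their widths.\<close>
  have strip: "\<exists>\<delta>>0. \<forall>a b. a \<le> s \<and> s \<le> b \<and> b - a < \<delta> \<longrightarrow> has_lifts X f H ({a..b} \<times> {c..d})" for s
    using \<open>c \<le> d\<close>
  proof (induction c d rule: Bolzano)
    case (trans c t d)
    then obtain \<delta>1 \<delta>2 where \<delta>: "\<delta>1 > 0" "\<delta>2 > 0"
      "\<And>a b. a \<le> s \<and> s \<le> b \<and> b - a < \<delta>1 \<Longrightarrow> has_lifts X f H ({a..b} \<times> {c..t})"
      "\<And>a b. a \<le> s \<and> s \<le> b \<and> b - a < \<delta>2 \<Longrightarrow> has_lifts X f H ({a..b} \<times> {t..d})"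
      by metis
    have "has_lifts X f H ({a..b} \<times> {c..d})" if ab: "a \<le> s" "s \<le> b" "b - a < min \<delta>1 \<delta>2" for a b
    proof (rule has_lifts_glue[OF f X(2), of snd H _ t])
      have "{a..b} \<times> {c..d} \<inter> {q. snd q \<le> t} = {a..b} \<times> {c..t}"
        "{a..b} \<times> {c..d} \<inter> {q. t \<le> snd q} = {a..b} \<times> {t..d}"
        using trans(3,4) by auto
      then show "has_lifts X f H ({a..b} \<times> {c..d} \<inter> {q. snd q \<le> t})"
        "has_lifts X f H ({a..b} \<times> {c..d} \<inter> {q. t \<le> snd q})"
        using \<delta> ab by auto
      have "{a..b} \<times> {c..d} \<inter> {q. snd q = t} = {a..b} \<times> {t}" using trans(3,4) by auto
      then show "connected ({a..b} \<times> {c..d} \<inter> {q. snd q = t})" "{a..b} \<times> {c..d} \<inter> {q. snd q = t} \<noteq> {}"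
        using ab by (auto intro!: connected_Times)
    qed (auto intro: continuous_intros)
    then show ?case using \<delta>(1,2) by (intro exI[of _ "min \<delta>1 \<delta>2"]) auto
  next
    case (local t)
    obtain e where e: "e > 0" "\<And>R. R \<subseteq> ball (s, t) e \<Longrightarrow> has_lifts X f H R" using loc by blast
    \<comment> \<open>Coordinate errors below \<open>e/2\<close> add up to a distance below
      \<open>e\<close>. The same \<open>e/2\<close> bounds the height of the piece and the width of
      the strip.\<close>
    have "{a..b} \<times> {c..d} \<subseteq> ball (s, t) e"
      if "a \<le> s" "s \<le> b" "b - a < e/2" "c \<le> t" "t \<le> d" "d - c < e/2" for a b c d
    proof
      fix q assume "q \<in> {a..b} \<times> {c..d}"
      then obtain u v where q: "q = (u, v)" "a \<le> u" "u \<le> b" "c \<le> v" "v \<le> d" by auto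
      have "dist (s, t) q \<le> dist s u + dist t v" unfolding q dist_Pair_Pair by (rule sqrt_sum_squares_le_sum) auto
      also have "\<dots> < e" using q that by (auto simp: dist_real_def abs_if)
      finally show "q \<in> ball (s, t) e" by simp
    qed
    then show ?case using e by (intro exI[of _ "e/2"]) (auto intro!: exI[of _ "e/2"])
  qed
  show ?thesis
    using \<open>a \<le> b\<close>
  proof (induction a b rule: Bolzano)
    case (trans a t b)
    show ?case
    proof (rule has_lifts_glue[OF f X(2), of fst H _ t])
      have "{a..b} \<times> {c..d} \<inter> {q. fst q \<le> t} = {a..t} \<times> {c..d}"
        "{a..b} \<times> {c..d} \<inter> {q. t \<le> fst q} = {t..b} \<times> {c..d}"
        using trans(3,4) by auto
      then show "has_lifts X f H ({a..b} \<times> {c..d} \<inter> {q. fst q \<le> t})"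
        "has_lifts X f H ({a..b} \<times> {c..d} \<inter> {q. t \<le> fst q})"
        using trans by auto
      have "{a..b} \<times> {c..d} \<inter> {q. fst q = t} = {t} \<times> {c..d}" using trans(3,4) by auto
      then show "connected ({a..b} \<times> {c..d} \<inter> {q. fst q = t})" "{a..b} \<times> {c..d} \<inter> {q. fst q = t} \<noteq> {}"
        using \<open>c \<le> d\<close> by (auto intro!: connected_Times)
    qed (auto intro: continuous_intros)
  next
    case (local s)
    show ?case using strip[of s] by blast
  qed
qed

text \<open>A path in \<open>X\<close> joining two points of a fibre is mapped to a loop, which contracts; lifting
  the contraction shows that the path was a loop.\<close>

lemma compact_local_homeo_inj_on:
  assumes f: "local_homeo X Y f" and X: "compact_space X" "Hausdorff_space X" "path_connected_space X"
    and Y: "Hausdorff_space Y" "simply_connected_space Y"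
  shows "inj_on f (topspace X)"
proof (rule inj_onI)
  fix a b assume ab: "a \<in> topspace X" "b \<in> topspace X" "f a = f b"
  have cont: "continuous_map X Y f" using f by (simp add: local_homeo_def)
  obtain \<gamma> where \<gamma>: "pathin X \<gamma>" "\<gamma> 0 = a" "\<gamma> 1 = b"
    using X(3) ab unfolding path_connected_space_def by blast
  have "pathin Y (f \<circ> \<gamma>)" using \<gamma>(1) cont pathin_compose by blast
  moreover have "pathin Y (\<lambda>_. f a)" using ab(1) cont continuous_map_image_subset_topspace by (fastforce simp: pathin_const)
  ultimately have "homotopic_with (\<lambda>r. r 1 = r 0) (top_of_set {0..1}) Y (f \<circ> \<gamma>) (\<lambda>_. f a)"
    using Y(2)[unfolded simply_connected_space_def, rule_format, of "f \<circ> \<gamma>" "\<lambda>_. f a"] ab \<gamma> by auto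
  then obtain h where hom: "continuous_map (prod_topology (top_of_set {0..1::real}) (top_of_set {0..1})) Y h \<and>
      (\<forall>t. h (0, t) = (f \<circ> \<gamma>) t) \<and> (\<forall>t. h (1, t) = f a) \<and> (\<forall>s\<in>{0..1}. h (s, 1) = h (s, 0))"
    unfolding homotopic_with_def by (elim exE)
  then have h: "continuous_map (prod_topology (top_of_set {0..1}) (top_of_set {0..1})) Y h"
    "h (0, t) = f (\<gamma> t)" "h (1, t) = f a" "s \<in> {0..1} \<Longrightarrow> h (s, 1) = h (s, 0)" for s t
    by simp_all
  \<comment> \<open>Clamping both coordinates to the unit interval extends the homotopy to the whole
    plane, the domain that \<open>has_lifts_rectangle\<close> expects, without changing it on the
    square.\<close>
  define cl where "cl t = max 0 (min 1 t)" for t :: real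
  have cl: "cl t = t" if "t \<in> {0..1}" for t using that by (auto simp: cl_def)
  define H where "H = h \<circ> (\<lambda>q. (cl (fst q), cl (snd q)))"
  have "continuous_map euclidean (prod_topology (top_of_set {0..1}) (top_of_set {0..1})) (\<lambda>q. (cl (fst q), cl (snd q)))"
    unfolding continuous_map_pairwise o_def fst_conv snd_conv continuous_map_in_subtopology
    by (auto simp: cl_def intro!: continuous_intros)
  then have "continuous_map euclidean Y H" unfolding H_def using h(1) continuous_map_compose by blast
  then have "has_lifts X f H ({0..1} \<times> {0..1})"
    using has_lifts_rectangle[OF f X(1,2) Y(1)] by simp
  moreover have H: "H (s, t) = h (s, t)" if "s \<in> {0..1}" "t \<in> {0..1}" for s t
    using cl that by (simp add: H_def)
  moreover have "f a = H (0, 0)" using H[of 0 0] h(2)[of 0] \<gamma>(2) by simp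
  ultimately obtain g where g: "continuous_map (top_of_set ({0..1} \<times> {0..1})) X g" "g (0, 0) = a"
    and fg: "\<forall>r\<in>{0..1} \<times> {0..1}. f (g r) = H r"
    using has_liftsE[of X f H "{0..1} \<times> {0..1}" "(0, 0)" a] ab(1) by auto
  have edge: "continuous_map (top_of_set {0..1}) X (\<lambda>t. g (\<sigma> t))"
    if "continuous_on {0..1} \<sigma>" "\<sigma> ` {0..1} \<subseteq> {0..1} \<times> {0..1}" for \<sigma> :: "real \<Rightarrow> real \<times> real"
    using continuous_map_compose[OF _ g(1), of "top_of_set {0..1}" \<sigma>] that
    by (simp add: o_def continuous_map_in_subtopology image_subset_iff_funcset)
  have conn: "connected_space (top_of_set {0..1::real})" by (simp add: connected_space_top_of_set)
  note unique = local_homeo_unique_lift[OF f X(2) conn]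
  have lift: "f (g (s, t)) = h (s, t)" if "s \<in> {0..1}" "t \<in> {0..1}" for s t
    using fg H that by auto
  have vert: "continuous_map (top_of_set {0..1}) X (\<lambda>t. g (s, t))" if "s \<in> {0..1}" for s
    by (rule edge) (use that in \<open>auto intro!: continuous_intros\<close>)
  have hor: "continuous_map (top_of_set {0..1}) X (\<lambda>s. g (s, t))" if "t \<in> {0..1}" for t
    by (rule edge) (use that in \<open>auto intro!: continuous_intros\<close>)
  \<comment> \<open>On the edge \<open>s = 0\<close> both \<open>g\<close> and
    \<open>\<gamma>\<close> lift \<open>f \<circ> \<gamma>\<close> starting at \<open>a\<close>. On
    the edge \<open>s = 1\<close> the loop is constant, hence so is its lift.\<close>
  have left: "g (0, 1) = \<gamma> 1"
    by (rule unique[OF vert[of 0], of \<gamma> 0 1]) (use \<gamma> g(2) in \<open>auto simp: pathin_def lift h(2)\<close>)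
  have const: "continuous_map (top_of_set {0..1}) X (\<lambda>_. g (1, 0))"
    using continuous_map_image_subset_topspace[OF g(1)] by (auto simp: image_subset_iff)
  have right: "g (1, 1) = g (1, 0)"
    by (rule unique[OF vert[of 1] const, of 0 1]) (auto simp: lift h(3))
  \<comment> \<open>Top and bottom lift the same path, as every stage of the homotopy is a loop.
    They agree at \<open>s = 1\<close> by \<open>right\<close>, hence also at \<open>s = 0\<close>,
    where their values are \<open>b\<close> and \<open>a\<close>.\<close>
  have "g (0, 1) = g (0, 0)"
    by (rule unique[OF hor[of 1] hor[of 0], of 1 0]) (auto simp: lift h(4) right)
  then show "a = b" using left g(2) \<gamma>(3) by simp
qed

section \<open>Charts and tangent vectors\<close>

lemma has_vector_derivative_cong_nhds:
  assumes "(\<sigma> has_vector_derivative v) (at 0)" "\<forall>\<^sub>F t in nhds 0. \<sigma> t = \<tau> t"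
  shows "(\<tau> has_vector_derivative v) (at (0::real))"
  using assms(1)
  by (subst has_vector_derivative_cong_ev[where f = \<tau> and g = \<sigma>])
    (use assms(2) in \<open>auto dest: eventually_nhds_x_imp_x elim: eventually_mono\<close>)

lemma has_vector_derivative_line: "((\<lambda>t. x + t *\<^sub>R u) has_vector_derivative u) (at 0)"
  by (auto intro!: derivative_eq_intros)

lemma curve_eventually_in_openin:
  fixes \<sigma> :: "real \<Rightarrow> 'a::real_normed_vector"
  assumes "openin (top_of_set S) A" "\<sigma> 0 \<in> A" "(\<sigma> has_vector_derivative v) (at 0)"
    and "\<forall>\<^sub>F t in nhds 0. \<sigma> t \<in> S"
  shows "\<forall>\<^sub>F t in nhds 0. \<sigma> t \<in> A"
proof -
  obtain W where W: "open W" "A = S \<inter> W" using assms(1) by (auto simp: openin_open)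
  have "isCont \<sigma> 0" using assms(3) has_vector_derivative_continuous by blast
  then have "(\<sigma> \<longlongrightarrow> \<sigma> 0) (nhds 0)" by (simp add: isCont_def tendsto_nhds_iff)
  then have "\<forall>\<^sub>F t in nhds 0. \<sigma> t \<in> W" using W assms(2) topological_tendstoD by blast
  then show ?thesis using assms(4) by eventually_elim (simp add: W(2))
qed

lemma line_eventually_in_openin:
  fixes x u :: "'a::euclidean_space"
  assumes "subspace L" "openin (top_of_set L) A" "x \<in> A" "u \<in> L"
  shows "\<forall>\<^sub>F t in nhds 0. x + t *\<^sub>R u \<in> A"
proof (rule curve_eventually_in_openin[OF assms(2) _ has_vector_derivative_line])
  have "x \<in> L" using assms(2,3) openin_imp_subset by blast
  then show "\<forall>\<^sub>F t in nhds 0. x + t *\<^sub>R u \<in> L"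
    using assms(1,4) by (simp add: subspace_add subspace_scale)
qed (simp add: assms(3))

text \<open>Any inverse homeomorphism coincides with \<open>inv_into\<close> on the image, by
  injectivity; this is the source of the continuity of \<open>param c\<close>.\<close>

lemma is_chart_homeomorphic_maps:
  assumes "is_chart X c"
  shows "homeomorphic_maps (subtopology (mtop X) (cdom c)) (top_of_set (coord c ` cdom c)) (coord c) (param c)"
proof -
  have top: "topspace (subtopology (mtop X) (cdom c)) = cdom c"
    using assms openin_subset unfolding is_chart_def by fastforce
  have hom: "homeomorphic_map (subtopology (mtop X) (cdom c)) (top_of_set (coord c ` cdom c)) (coord c)"
    using assms by (simp add: is_chart_def)
  obtain g where g: "homeomorphic_maps (subtopology (mtop X) (cdom c)) (top_of_set (coord c ` cdom c)) (coord c) g"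
    using hom homeomorphic_map_maps by blast
  have inj: "inj_on (coord c) (cdom c)" using homeomorphic_imp_injective_map[OF hom] top by simp
  show ?thesis
  proof (rule homeomorphic_maps_eq[OF g])
    fix y assume "y \<in> topspace (top_of_set (coord c ` cdom c))"
    then obtain p where p: "p \<in> cdom c" "y = coord c p" by auto
    have "g (coord c p) = p" using g p(1) top by (simp add: homeomorphic_maps_def)
    then show "g y = param c y" using p inj by simp
  qed simp
qed

context
  fixes X :: "('a, 'e::euclidean_space) mfd" and c :: "('a, 'e) chart"
  assumes c: "is_chart X c"
begin

lemma chart_dom_openin: "openin (mtop X) (cdom c)"
  using c by (simp add: is_chart_def)

lemma chart_dom_subset: "cdom c \<subseteq> topspace (mtop X)"
  using chart_dom_openin openin_subset by blast

lemma chart_inj_on: "inj_on (coord c) (cdom c)"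
  using c homeomorphic_imp_injective_map chart_dom_subset unfolding is_chart_def
  by (metis topspace_subtopology_subset)

lemma chart_param_coord: "p \<in> cdom c \<Longrightarrow> param c (coord c p) = p"
  using chart_inj_on by simp

lemma chart_image_openin_model: "openin (top_of_set (model X)) (coord c ` cdom c)"
  using c by (simp add: is_chart_def)

lemma chart_coord_model: "p \<in> cdom c \<Longrightarrow> coord c p \<in> model X"
  using chart_image_openin_model openin_imp_subset by blast

lemma chart_continuous_coord: "continuous_map (subtopology (mtop X) (cdom c)) euclidean (coord c)"
  using is_chart_homeomorphic_maps[OF c] by (simp add: homeomorphic_maps_def continuous_map_in_subtopology)

lemma chart_continuous_param: "continuous_map (top_of_set (coord c ` cdom c)) (mtop X) (param c)"
  using is_chart_homeomorphic_maps[OF c] by (simp add: homeomorphic_maps_def continuous_map_in_subtopology)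

lemma chart_image_openin:
  assumes "openin (mtop X) U"
  shows "openin (top_of_set (model X)) (coord c ` (cdom c \<inter> U))"
proof -
  have "openin (top_of_set (coord c ` cdom c)) {x \<in> coord c ` cdom c. param c x \<in> U}"
    using openin_continuous_map_preimage[OF chart_continuous_param assms] by simp
  moreover have "{x \<in> coord c ` cdom c. param c x \<in> U} = coord c ` (cdom c \<inter> U)"
    using chart_param_coord by auto
  ultimately show ?thesis using chart_image_openin_model openin_trans by metis
qed

lemma chart_preimage_openin:
  assumes "openin (top_of_set (coord c ` (cdom c \<inter> S))) A"
  shows "openin (subtopology (mtop X) S) {p \<in> S \<inter> cdom c. coord c p \<in> A}"
proof -
  obtain W where W: "open W" "A = coord c ` (cdom c \<inter> S) \<inter> W" using assms by (auto simp: openin_open)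
  have "openin (subtopology (mtop X) (cdom c)) {p \<in> topspace (subtopology (mtop X) (cdom c)). coord c p \<in> W}"
    by (rule openin_continuous_map_preimage[OF chart_continuous_coord]) (simp add: W(1))
  then have "openin (mtop X) {p \<in> topspace (subtopology (mtop X) (cdom c)). coord c p \<in> W}"
    using chart_dom_openin openin_trans_full by blast
  moreover have "{p \<in> S \<inter> cdom c. coord c p \<in> A} = {p \<in> topspace (subtopology (mtop X) (cdom c)). coord c p \<in> W} \<inter> S"
    using W(2) chart_dom_subset by auto
  ultimately show ?thesis unfolding openin_subtopology by blast
qed

end

text \<open>The common ground of \<open>M\<close> and \<open>tangent_bundle M\<close>:
  \<open>charted_tangent_bundle\<close> establishes it for the bundle, and tangent vectors are built
  from it together with one chart of the maximal atlas.\<close>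

definition charted :: "('a, 'e::euclidean_space) mfd \<Rightarrow> bool" where
  "charted X \<longleftrightarrow> subspace (model X) \<and> (\<forall>c\<in>atlas X. is_chart X c) \<and>
     (\<Union>c\<in>atlas X. cdom c) = topspace (mtop X)"

lemma max_atlas_is_chart: "c \<in> max_atlas X \<Longrightarrow> is_chart X c"
  by (simp add: max_atlas_def)

lemma max_atlas_smooth_on:
  assumes "c \<in> max_atlas X" "d \<in> atlas X"
  shows "smooth_on (coord c ` (cdom c \<inter> cdom d)) (coord d \<circ> param c)"
    "smooth_on (coord d ` (cdom d \<inter> cdom c)) (coord c \<circ> param d)"
  using assms by (auto simp: max_atlas_def compatible_def Int_commute)

lemma smooth_manifold_charted: "smooth_manifold n M \<Longrightarrow> charted M"
  by (simp add: smooth_manifold_def charted_def)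

lemma smooth_manifold_atlas_max: "smooth_manifold n M \<Longrightarrow> c \<in> atlas M \<Longrightarrow> c \<in> max_atlas M"
  by (simp add: smooth_manifold_def max_atlas_def)

lemma charted_obtain_chart:
  assumes "charted X" "p \<in> topspace (mtop X)"
  obtains c where "c \<in> atlas X" "p \<in> cdom c" "is_chart X c"
  using assms unfolding charted_def by blast

section \<open>Tangent vectors as compatible families of coordinate vectors\<close>

lemma tangent_spaceI:
  assumes "\<And>c. c \<in> atlas X \<Longrightarrow> p \<in> cdom c \<Longrightarrow> v c \<in> model X"
    and "\<And>c. \<not> (c \<in> atlas X \<and> p \<in> cdom c) \<Longrightarrow> v c = 0"
    and "\<And>c d. c \<in> atlas X \<Longrightarrow> d \<in> atlas X \<Longrightarrow> p \<in> cdom c \<Longrightarrow> p \<in> cdom d \<Longrightarrow>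
      ((\<lambda>t. coord d (param c (coord c p + t *\<^sub>R v c))) has_vector_derivative v d) (at 0)"
  shows "v \<in> tangent_space X p"
  unfolding tangent_space_def mem_Collect_eq using assms by (intro conjI allI impI ballI) blast+

lemma tangent_spaceD:
  assumes "v \<in> tangent_space X p"
  shows "c \<in> atlas X \<Longrightarrow> p \<in> cdom c \<Longrightarrow> v c \<in> model X"
    and "\<not> (c \<in> atlas X \<and> p \<in> cdom c) \<Longrightarrow> v c = 0"
    and "c \<in> atlas X \<Longrightarrow> d \<in> atlas X \<Longrightarrow> p \<in> cdom c \<Longrightarrow> p \<in> cdom d \<Longrightarrow>
      ((\<lambda>t. coord d (param c (coord c p + t *\<^sub>R v c))) has_vector_derivative v d) (at 0)"
  using assms unfolding tangent_space_def mem_Collect_eq by blast+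

text \<open>The transformation rule out of the chart \<open>c\<close> determines every other
  component, by uniqueness of derivatives.\<close>

lemma tangent_space_eqI:
  assumes "v \<in> tangent_space X p" "w \<in> tangent_space X p" "c \<in> atlas X" "p \<in> cdom c" "v c = w c"
  shows "v = w"
proof
  fix d
  show "v d = w d"
  proof (cases "d \<in> atlas X \<and> p \<in> cdom d")
    case True
    have "((\<lambda>t. coord d (param c (coord c p + t *\<^sub>R v c))) has_vector_derivative v d) (at 0)"
      "((\<lambda>t. coord d (param c (coord c p + t *\<^sub>R v c))) has_vector_derivative w d) (at 0)"
      using tangent_spaceD(3)[OF assms(1,3)] tangent_spaceD(3)[OF assms(2,3)] assms(4,5) True by auto
    then show ?thesis by (rule vector_derivative_unique_at)
  next
    case False
    then show ?thesis using tangent_spaceD(2)[OF assms(1)] tangent_spaceD(2)[OF assms(2)] by simp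
  qed
qed

lemma zero_in_tangent_space:
  assumes "charted X"
  shows "(\<lambda>_. 0) \<in> tangent_space X p"
  by (rule tangent_spaceI) (use assms in \<open>simp_all add: charted_def subspace_0\<close>)

text \<open>The chart \<open>c0\<close>, such as a slice chart, may lie outside the atlas and then
  is no index of a tangent vector. The component at \<open>c\<close> is the velocity, read in
  \<open>c\<close>, of the line with direction \<open>u\<close> in \<open>c0\<close>. The last
  conclusion lets the vanishing of \<open>v\<close>, which transversality will provide, be turned
  back into the vanishing of \<open>u\<close>.\<close>

lemma tangent_vector_exists:
  fixes X :: "('a, 'e::euclidean_space) mfd"
  assumes X: "charted X" and c0: "c0 \<in> max_atlas X" and p: "p \<in> cdom c0" and u: "u \<in> model X"
  obtains v where "v \<in> tangent_space X p"
    "\<And>c. c \<in> atlas X \<Longrightarrow> p \<in> cdom c \<Longrightarrow>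
      ((\<lambda>t. coord c (param c0 (coord c0 p + t *\<^sub>R u))) has_vector_derivative v c) (at 0)"
    "v = (\<lambda>_. 0) \<Longrightarrow> u = 0"
proof -
  have sub: "subspace (model X)" using X by (simp add: charted_def)
  note ch0 = max_atlas_is_chart[OF c0]
  define \<sigma> where "\<sigma> t = coord c0 p + t *\<^sub>R u" for t :: real
  have \<sigma>: "(\<sigma> has_vector_derivative u) (at 0)" "\<sigma> 0 = coord c0 p"
    unfolding \<sigma>_def by (rule has_vector_derivative_line, simp)
  have ev\<sigma>: "\<forall>\<^sub>F t in nhds 0. \<sigma> t \<in> coord c0 ` (cdom c0 \<inter> cdom c)" if "is_chart X c" "p \<in> cdom c" for c
    unfolding \<sigma>_def
    by (rule line_eventually_in_openin[OF sub chart_image_openin[OF ch0 chart_dom_openin[OF that(1)]] _ u])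
      (use p that in blast)
  define v where "v c = (if c \<in> atlas X \<and> p \<in> cdom c
      then vector_derivative (\<lambda>t. coord c (param c0 (\<sigma> t))) (at 0) else 0)" for c
  \<comment> \<open>\<open>D\<close> is needed for all curves and not just for the line
    \<open>\<sigma>\<close>: in \<open>trans\<close> it is applied to a line of another chart, seen
    in \<open>c0\<close>.\<close>
  have fwd: "\<exists>D. linear D \<and> v c = D u \<and>
      (\<forall>\<tau> w. \<tau> 0 = coord c0 p \<longrightarrow> (\<tau> has_vector_derivative w) (at 0) \<longrightarrow>
        (\<forall>\<^sub>F t in nhds 0. \<tau> t \<in> coord c0 ` (cdom c0 \<inter> cdom c)) \<longrightarrow>
        ((\<lambda>t. coord c (param c0 (\<tau> t))) has_vector_derivative D w) (at 0))"
    if cX: "c \<in> atlas X" and pc: "p \<in> cdom c" for c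
  proof -
    have x0: "coord c0 p \<in> coord c0 ` (cdom c0 \<inter> cdom c)" using p pc by blast
    have ch: "is_chart X c" using X cX by (simp add: charted_def)
    obtain D where D: "linear D"
      "\<And>\<tau> w. \<tau> 0 = coord c0 p \<Longrightarrow> (\<tau> has_vector_derivative w) (at 0) \<Longrightarrow>
        \<forall>\<^sub>F t in nhds 0. \<tau> t \<in> coord c0 ` (cdom c0 \<inter> cdom c) \<Longrightarrow>
        ((\<lambda>t. (coord c \<circ> param c0) (\<tau> t)) has_vector_derivative D w) (at 0)"
      by (rule smooth_on_curve_derivative[OF max_atlas_smooth_on(1)[OF c0 cX] x0]) (rule that)
    have "((\<lambda>t. coord c (param c0 (\<sigma> t))) has_vector_derivative D u) (at 0)"
      using D(2)[OF \<sigma>(2,1) ev\<sigma>[OF ch pc]] by simp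
    then have "v c = D u" using cX pc by (simp add: v_def vector_derivative_at)
    then show ?thesis using D by (intro exI[of _ D]) simp
  qed
  have v: "((\<lambda>t. coord c (param c0 (\<sigma> t))) has_vector_derivative v c) (at 0)"
    if "c \<in> atlas X" "p \<in> cdom c" for c
    using fwd[OF that] \<sigma> ev\<sigma>[of c] X that by (auto simp: charted_def)
  have ch: "is_chart X c" if "c \<in> atlas X" for c using X that by (simp add: charted_def)
  have ev_dom: "\<forall>\<^sub>F t in nhds 0. param c0 (\<sigma> t) \<in> cdom c0 \<inter> cdom c \<and> \<sigma> t \<in> coord c0 ` (cdom c0 \<inter> cdom c)"
    if "c \<in> atlas X" "p \<in> cdom c" for c
    using ev\<sigma>[OF ch[OF that(1)] that(2)]
    by eventually_elim (auto simp: chart_param_coord[OF ch0])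
  have v_model: "v c \<in> model X" if "c \<in> atlas X" "p \<in> cdom c" for c
    by (rule has_vector_derivative_in_subspace[OF sub v[OF that]])
      (use ev_dom[OF that] in \<open>eventually_elim, simp add: chart_coord_model[OF ch[OF that(1)]]\<close>)
  have bwd: "\<exists>E. linear E \<and> u = E (v c) \<and>
      (\<forall>\<tau> w. \<tau> 0 = coord c p \<longrightarrow> (\<tau> has_vector_derivative w) (at 0) \<longrightarrow>
        (\<forall>\<^sub>F t in nhds 0. \<tau> t \<in> coord c ` (cdom c \<inter> cdom c0)) \<longrightarrow>
        ((\<lambda>t. coord c0 (param c (\<tau> t))) has_vector_derivative E w) (at 0))"
    if cX: "c \<in> atlas X" and pc: "p \<in> cdom c" for c
  proof -
    have x0: "coord c p \<in> coord c ` (cdom c \<inter> cdom c0)" using p pc by blast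
    obtain E where E: "linear E"
      "\<And>\<tau> w. \<tau> 0 = coord c p \<Longrightarrow> (\<tau> has_vector_derivative w) (at 0) \<Longrightarrow>
        \<forall>\<^sub>F t in nhds 0. \<tau> t \<in> coord c ` (cdom c \<inter> cdom c0) \<Longrightarrow>
        ((\<lambda>t. (coord c0 \<circ> param c) (\<tau> t)) has_vector_derivative E w) (at 0)"
      by (rule smooth_on_curve_derivative[OF max_atlas_smooth_on(2)[OF c0 cX] x0]) (rule that)
    have "((\<lambda>t. (coord c0 \<circ> param c) (coord c (param c0 (\<sigma> t)))) has_vector_derivative E (v c)) (at 0)"
    proof (rule E(2)[OF _ v[OF cX pc]])
      show "coord c (param c0 (\<sigma> 0)) = coord c p" using \<sigma>(2) p by (simp add: chart_param_coord[OF ch0])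
      show "\<forall>\<^sub>F t in nhds 0. coord c (param c0 (\<sigma> t)) \<in> coord c ` (cdom c \<inter> cdom c0)"
        using ev_dom[OF cX pc] by eventually_elim blast
    qed
    moreover have "\<forall>\<^sub>F t in nhds 0. (coord c0 \<circ> param c) (coord c (param c0 (\<sigma> t))) = \<sigma> t"
      using ev_dom[OF cX pc]
      by eventually_elim (auto simp: chart_param_coord[OF ch[OF cX]] chart_param_coord[OF ch0])
    ultimately have "(\<sigma> has_vector_derivative E (v c)) (at 0)"
      by (rule has_vector_derivative_cong_nhds)
    then have "u = E (v c)" using \<sigma>(1) vector_derivative_unique_at by blast
    then show ?thesis using E by (intro exI[of _ E]) simp
  qed
  \<comment> \<open>\<open>charted\<close> gives no compatibility between \<open>c\<close> and
    \<open>d\<close>, so their coordinate change is routed through \<open>c0\<close>: the direction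
    \<open>v c\<close> becomes \<open>u\<close> in \<open>c0\<close>, and \<open>u\<close> becomes
    \<open>v d\<close>.\<close>
  have trans: "((\<lambda>t. coord d (param c (coord c p + t *\<^sub>R v c))) has_vector_derivative v d) (at 0)"
    if cX: "c \<in> atlas X" and dX: "d \<in> atlas X" and pc: "p \<in> cdom c" and pd: "p \<in> cdom d" for c d
  proof -
    let ?\<tau> = "\<lambda>t. coord c p + t *\<^sub>R v c"
    have ev: "\<forall>\<^sub>F t in nhds 0. ?\<tau> t \<in> coord c ` (cdom c \<inter> (cdom c0 \<inter> cdom d))"
      by (rule line_eventually_in_openin[OF sub chart_image_openin[OF ch[OF cX]] _ v_model[OF cX pc]])
        (use p pc pd chart_dom_openin[OF ch0] chart_dom_openin[OF ch[OF dX]] in auto)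
    obtain E where E: "u = E (v c)"
      "\<forall>\<tau> w. \<tau> 0 = coord c p \<longrightarrow> (\<tau> has_vector_derivative w) (at 0) \<longrightarrow>
        (\<forall>\<^sub>F t in nhds 0. \<tau> t \<in> coord c ` (cdom c \<inter> cdom c0)) \<longrightarrow>
        ((\<lambda>t. coord c0 (param c (\<tau> t))) has_vector_derivative E w) (at 0)"
      using bwd[OF cX pc] by blast
    have 1: "((\<lambda>t. coord c0 (param c (?\<tau> t))) has_vector_derivative u) (at 0)"
      unfolding E(1)
      by (rule E(2)[rule_format, OF _ has_vector_derivative_line])
        (simp, use ev in \<open>eventually_elim, blast\<close>)
    obtain D where D: "v d = D u"
      "\<forall>\<tau> w. \<tau> 0 = coord c0 p \<longrightarrow> (\<tau> has_vector_derivative w) (at 0) \<longrightarrow>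
        (\<forall>\<^sub>F t in nhds 0. \<tau> t \<in> coord c0 ` (cdom c0 \<inter> cdom d)) \<longrightarrow>
        ((\<lambda>t. coord d (param c0 (\<tau> t))) has_vector_derivative D w) (at 0)"
      using fwd[OF dX pd] by blast
    have "((\<lambda>t. coord d (param c0 (coord c0 (param c (?\<tau> t))))) has_vector_derivative v d) (at 0)"
      unfolding D(1)
    proof (rule D(2)[rule_format, OF _ 1])
      show "coord c0 (param c (coord c p + 0 *\<^sub>R v c)) = coord c0 p"
        using pc by (simp add: chart_param_coord[OF ch[OF cX]])
      show "\<forall>\<^sub>F t in nhds 0. coord c0 (param c (?\<tau> t)) \<in> coord c0 ` (cdom c0 \<inter> cdom d)"
        using ev by eventually_elim (auto simp: chart_param_coord[OF ch[OF cX]])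
    qed
    then show ?thesis
    proof (rule has_vector_derivative_cong_nhds)
      show "\<forall>\<^sub>F t in nhds 0. coord d (param c0 (coord c0 (param c (?\<tau> t)))) = coord d (param c (?\<tau> t))"
        using ev by eventually_elim (auto simp: chart_param_coord[OF ch[OF cX]] chart_param_coord[OF ch0])
    qed
  qed
  show thesis
  proof (rule that)
    show "v \<in> tangent_space X p"
      by (rule tangent_spaceI[OF v_model _ trans]) (auto simp: v_def)
    show "((\<lambda>t. coord c (param c0 (coord c0 p + t *\<^sub>R u))) has_vector_derivative v c) (at 0)"
      if "c \<in> atlas X" "p \<in> cdom c" for c
      using v[OF that] by (simp add: \<sigma>_def)
    assume "v = (\<lambda>_. 0)"
    obtain c where c: "c \<in> atlas X" "p \<in> cdom c"
      using charted_obtain_chart[OF X, of p] chart_dom_subset[OF ch0] p by blast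
    obtain E where "linear E" "u = E (v c)" using bwd[OF c] by blast
    then show "u = 0" using \<open>v = (\<lambda>_. 0)\<close> by (simp add: linear_0)
  qed
qed

section \<open>The tangent bundle\<close>

lemma atlas_tangent_bundle: "b \<in> atlas (tangent_bundle M) \<longleftrightarrow> (\<exists>c\<in>atlas M. b = bundle_chart M c)"
  by (auto simp: tangent_bundle_def)

lemma model_tangent_bundle: "model (tangent_bundle M) = model M \<times> model M"
  by (simp add: tangent_bundle_def)

lemma mem_tangent_total:
  "z \<in> tangent_total M \<longleftrightarrow> fst z \<in> topspace (mtop M) \<and> snd z \<in> tangent_space M (fst z)"
  by (cases z) (simp add: tangent_total_def)

lemma mem_cdom_bundle_chart:
  "z \<in> cdom (bundle_chart M c) \<longleftrightarrow>
     fst z \<in> topspace (mtop M) \<and> snd z \<in> tangent_space M (fst z) \<and> fst z \<in> cdom c"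
  by (simp add: bundle_chart_def mem_tangent_total)

lemma coord_bundle_chart: "coord (bundle_chart M c) z = (coord c (fst z), snd z c)"
  by (simp add: bundle_chart_def)

lemma openin_bundle_chart:
  assumes "c \<in> atlas M" "open W"
  shows "openin (mtop (tangent_bundle M)) {z \<in> cdom (bundle_chart M c). coord (bundle_chart M c) z \<in> W}"
  unfolding tangent_bundle_def mfd.simps using assms
  by (intro topology_generated_by_Basis CollectI exI[of _ c] exI[of _ W]) simp

lemma openin_cdom_bundle_chart:
  "c \<in> atlas M \<Longrightarrow> openin (mtop (tangent_bundle M)) (cdom (bundle_chart M c))"
  using openin_bundle_chart[of c M UNIV] by simp

context
  fixes n :: nat and M :: "('a, 'e::euclidean_space) mfd"
  assumes M: "smooth_manifold n M"
begin

lemma topspace_tangent_bundle: "topspace (mtop (tangent_bundle M)) = tangent_total M"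
proof
  show "topspace (mtop (tangent_bundle M)) \<subseteq> tangent_total M"
    by (auto simp: tangent_bundle_def mem_cdom_bundle_chart mem_tangent_total)
  show "tangent_total M \<subseteq> topspace (mtop (tangent_bundle M))"
  proof
    fix z assume z: "z \<in> tangent_total M"
    obtain c where c: "c \<in> atlas M" "fst z \<in> cdom c"
      using charted_obtain_chart[OF smooth_manifold_charted[OF M], of "fst z"] z mem_tangent_total by blast
    then have "z \<in> cdom (bundle_chart M c)" using z by (auto simp: mem_cdom_bundle_chart mem_tangent_total)
    then show "z \<in> topspace (mtop (tangent_bundle M))"
      using openin_subset[OF openin_cdom_bundle_chart[OF c(1)]] by blast
  qed
qed

lemma bundle_chart_inj_on:
  assumes "c \<in> atlas M"
  shows "inj_on (coord (bundle_chart M c)) (cdom (bundle_chart M c))"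
proof (rule inj_onI)
  fix z z' assume z: "z \<in> cdom (bundle_chart M c)" "z' \<in> cdom (bundle_chart M c)"
    "coord (bundle_chart M c) z = coord (bundle_chart M c) z'"
  have "is_chart M c" using M assms by (simp add: smooth_manifold_def)
  then have eq: "fst z = fst z'"
    using inj_onD[OF chart_inj_on[of M c], of "fst z" "fst z'"] z by (simp add: mem_cdom_bundle_chart coord_bundle_chart)
  then have "snd z = snd z'"
    using z tangent_space_eqI[of "snd z" M "fst z" "snd z'" c] assms
    by (simp add: mem_cdom_bundle_chart coord_bundle_chart)
  with eq show "z = z'" by (simp add: prod_eq_iff)
qed

lemma param_bundle_chart:
  assumes "c \<in> atlas M" "y \<in> coord (bundle_chart M c) ` cdom (bundle_chart M c)"
  shows "param (bundle_chart M c) y \<in> cdom (bundle_chart M c)"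
    "fst (param (bundle_chart M c) y) = param c (fst y)"
    "snd (param (bundle_chart M c) y) c = snd y"
    "coord (bundle_chart M c) (param (bundle_chart M c) y) = y"
proof -
  have ch: "is_chart M c" using M assms by (simp add: smooth_manifold_def)
  show 1: "param (bundle_chart M c) y \<in> cdom (bundle_chart M c)" using assms(2) by (rule inv_into_into)
  show 2: "coord (bundle_chart M c) (param (bundle_chart M c) y) = y" using assms(2) by (rule f_inv_into_f)
  show "fst (param (bundle_chart M c) y) = param c (fst y)"
    using 1 chart_param_coord[OF ch] arg_cong[OF 2, of fst] by (metis coord_bundle_chart fst_conv mem_cdom_bundle_chart)
  show "snd (param (bundle_chart M c) y) c = snd y"
    using arg_cong[OF 2, of snd] by (simp add: coord_bundle_chart)
qed

text \<open>The fibres are filled by \<open>tangent_vector_exists\<close> with \<open>c\<close>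
  itself as the starting chart: the line is then its own coordinate expression, so the component at
  \<open>c\<close> is \<open>u\<close>. The set \<open>U\<close> allows for the whole domain
  (\<open>UNIV\<close>) as well as for the overlap with another chart.\<close>

lemma bundle_chart_image:
  assumes c: "c \<in> atlas M"
  shows "coord (bundle_chart M c) ` (cdom (bundle_chart M c) \<inter> {z. fst z \<in> U}) = coord c ` (cdom c \<inter> U) \<times> model M"
proof
  have ch: "is_chart M c" using M c by (simp add: smooth_manifold_def)
  show "coord (bundle_chart M c) ` (cdom (bundle_chart M c) \<inter> {z. fst z \<in> U}) \<subseteq> coord c ` (cdom c \<inter> U) \<times> model M"
    using tangent_spaceD(1)[OF _ c] by (auto simp: mem_cdom_bundle_chart coord_bundle_chart)
  show "coord c ` (cdom c \<inter> U) \<times> model M \<subseteq> coord (bundle_chart M c) ` (cdom (bundle_chart M c) \<inter> {z. fst z \<in> U})"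
  proof
    fix y assume "y \<in> coord c ` (cdom c \<inter> U) \<times> model M"
    then obtain p u where y: "y = (coord c p, u)" and p: "p \<in> cdom c" "p \<in> U" and u: "u \<in> model M" by auto
    obtain v where v: "v \<in> tangent_space M p"
      "\<And>d. d \<in> atlas M \<Longrightarrow> p \<in> cdom d \<Longrightarrow>
        ((\<lambda>t. coord d (param c (coord c p + t *\<^sub>R u))) has_vector_derivative v d) (at 0)"
      by (rule tangent_vector_exists[OF smooth_manifold_charted[OF M] smooth_manifold_atlas_max[OF M c] p(1) u]) (rule that)
    have sub: "subspace (model M)" using M by (simp add: smooth_manifold_def)
    have "\<forall>\<^sub>F t in nhds 0. coord c p + t *\<^sub>R u \<in> coord c ` cdom c"
      by (rule line_eventually_in_openin[OF sub chart_image_openin_model[OF ch] _ u]) (use p in blast)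
    then have "\<forall>\<^sub>F t in nhds 0. coord c (param c (coord c p + t *\<^sub>R u)) = coord c p + t *\<^sub>R u"
      by eventually_elim (rule f_inv_into_f)
    with v(2)[OF c p(1)] have "((\<lambda>t. coord c p + t *\<^sub>R u) has_vector_derivative v c) (at 0)"
      by (rule has_vector_derivative_cong_nhds)
    then have "v c = u" using has_vector_derivative_line vector_derivative_unique_at by blast
    moreover have "(p, v) \<in> cdom (bundle_chart M c)"
      using v(1) p chart_dom_subset[OF ch] by (auto simp: mem_cdom_bundle_chart)
    ultimately show "y \<in> coord (bundle_chart M c) ` (cdom (bundle_chart M c) \<inter> {z. fst z \<in> U})"
      using p by (intro image_eqI[of _ _ "(p, v)"]) (auto simp: y coord_bundle_chart)
  qed
qed

text \<open>A coordinate change of the bundle is \<open>(x, v) \<mapsto> (\<tau> x, D\<tau>(x) v)\<close> for the coordinate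
  change \<open>\<tau>\<close> of \<open>M\<close>.\<close>

lemma bundle_chart_transition_smooth:
  assumes c: "c \<in> atlas M" and d: "d \<in> atlas M"
  shows "smooth_on (coord c ` (cdom c \<inter> cdom d) \<times> model M) (coord (bundle_chart M d) \<circ> param (bundle_chart M c))"
proof (rule smooth_onI)
  fix y assume y: "y \<in> coord c ` (cdom c \<inter> cdom d) \<times> model M"
  have ch: "is_chart M c" "is_chart M d" using M c d by (auto simp: smooth_manifold_def)
  have sub: "subspace (model M)" using M by (simp add: smooth_manifold_def)
  have sm: "smooth_on (coord c ` (cdom c \<inter> cdom d)) (coord d \<circ> param c)"
    by (rule max_atlas_smooth_on(1)[OF smooth_manifold_atlas_max[OF M c] d])
  have "fst y \<in> coord c ` (cdom c \<inter> cdom d)" using y by auto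
  from smooth_onE[OF sm this] obtain T F where T: "open T" "fst y \<in> T" and F: "\<And>k. Ck_on k T F"
    and eq: "\<And>x. x \<in> coord c ` (cdom c \<inter> cdom d) \<Longrightarrow> x \<in> T \<Longrightarrow> F x = (coord d \<circ> param c) x" by metis
  define DF where "DF x = frechet_derivative F (at x)" for x
  have DF: "(F has_derivative DF x) (at x)" if "x \<in> T" for x
    unfolding DF_def by (rule Ck_on_Suc_has_derivative[OF F that])
  define G where "G = (\<lambda>y. (F (fst y), DF (fst y) (snd y)))"
  \<comment> \<open>The fibre coordinate enters linearly, so the extension is defined for all second
    coordinates.\<close>
  have open': "open (T \<times> (UNIV :: 'e set))" using T(1) by (simp add: open_Times)
  have "Ck_on k (T \<times> UNIV) G" for k
    unfolding G_def
  proof (rule Ck_on_Pair[OF open'])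
    have fst: "Ck_on k (T \<times> (UNIV :: 'e set)) fst" for k by (rule Ck_on_linear[OF linear_fst open'])
    have img: "fst ` (T \<times> (UNIV :: 'e set)) \<subseteq> T" by auto
    show "Ck_on k (T \<times> (UNIV :: 'e set)) (\<lambda>y. F (fst y))"
      using Ck_on_compose[OF open' T(1) img fst F] by (simp add: o_def)
    show "Ck_on k (T \<times> (UNIV :: 'e set)) (\<lambda>y. DF (fst y) (snd y))"
    proof (rule Ck_on_linear_family_apply[OF open' Ck_on_linear[OF linear_snd open'], of _ "\<lambda>y. DF (fst y)"])
      show "Ck_on k (T \<times> (UNIV :: 'e set)) (\<lambda>y. DF (fst y) v)" for v
        using Ck_on_compose[OF open' T(1) img fst Ck_on_frechet_derivative[OF F]] by (simp add: o_def DF_def)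
      show "linear (DF (fst y))" if "y \<in> T \<times> (UNIV :: 'e set)" for y
        using that DF has_derivative_linear by fastforce
    qed
  qed
  \<comment> \<open>As \<open>u\<close> lies in the model, \<open>x + t *\<^sub>R u\<close> stays in
    the overlap for small \<open>t\<close>, where \<open>F\<close> is the coordinate change. Hence
    \<open>DF x u\<close> is the velocity that the transformation rule prescribes for the component
    at \<open>d\<close>.\<close>
  moreover have "G w = (coord (bundle_chart M d) \<circ> param (bundle_chart M c)) w"
    if w: "w \<in> coord c ` (cdom c \<inter> cdom d) \<times> model M" and wT: "w \<in> T \<times> UNIV" for w
  proof -
    obtain x u where xu: "w = (x, u)" "x \<in> coord c ` (cdom c \<inter> cdom d)" "u \<in> model M" "x \<in> T"
      using w wT by auto
    then have img: "w \<in> coord (bundle_chart M c) ` cdom (bundle_chart M c)"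
      using bundle_chart_image[OF c, of UNIV] by auto
    define z where "z = param (bundle_chart M c) w"
    have z: "fst z = param c x" "snd z c = u" "snd z \<in> tangent_space M (fst z)" 
      using param_bundle_chart[OF c img] by (auto simp: z_def xu(1) mem_cdom_bundle_chart)
    have p: "param c x \<in> cdom c" "param c x \<in> cdom d" "coord c (param c x) = x"
      using xu(2) by (auto simp: chart_param_coord[OF ch(1)])
    have "((\<lambda>t. coord d (param c (x + t *\<^sub>R u))) has_vector_derivative snd z d) (at 0)"
      using tangent_spaceD(3)[OF z(3) c d] z p by simp
    moreover have "((F \<circ> (\<lambda>t. x + t *\<^sub>R u)) has_vector_derivative DF x u) (at 0)"
      using vector_derivative_diff_chain_within[OF has_vector_derivative_line, of F "DF x" x u] DF[OF xu(4)]
        has_derivative_at_withinI by auto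
    then have "((\<lambda>t. coord d (param c (x + t *\<^sub>R u))) has_vector_derivative DF x u) (at 0)"
    proof (rule has_vector_derivative_cong_nhds)
      have "openin (top_of_set (model M)) (coord c ` (cdom c \<inter> cdom d) \<inter> T)"
        by (rule openin_Int_open[OF chart_image_openin[OF ch(1) chart_dom_openin[OF ch(2)]] T(1)])
      then have "\<forall>\<^sub>F t in nhds 0. x + t *\<^sub>R u \<in> coord c ` (cdom c \<inter> cdom d) \<inter> T"
        by (rule line_eventually_in_openin[OF sub _ _ xu(3)]) (use xu in blast)
      then show "\<forall>\<^sub>F t in nhds 0. (F \<circ> (\<lambda>t. x + t *\<^sub>R u)) t = coord d (param c (x + t *\<^sub>R u))"
        by eventually_elim (simp add: eq)
    qed
    ultimately have "snd z d = DF x u" by (rule vector_derivative_unique_at)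
    then show ?thesis
      using z(1) eq[OF xu(2,4)] by (simp add: G_def xu(1) coord_bundle_chart z_def)
  qed
  moreover have "y \<in> T \<times> UNIV" using T(2) by (cases y) auto
  ultimately show "\<exists>T G. open T \<and> y \<in> T \<and> (\<forall>k. Ck_on k T G) \<and>
      (\<forall>w. w \<in> coord c ` (cdom c \<inter> cdom d) \<times> model M \<longrightarrow> w \<in> T \<longrightarrow>
        G w = (coord (bundle_chart M d) \<circ> param (bundle_chart M c)) w)"
    using open' by (intro exI[of _ "T \<times> UNIV"] exI[of _ G]) simp
qed

text \<open>Continuity of \<open>param\<close> is tested on the generators of the topology. Each
  comes from the bundle chart of some \<open>d\<close>, and its preimage is open because the
  transition from \<open>c\<close> to \<open>d\<close> is continuous on the open overlap.\<close>

lemma is_chart_bundle_chart: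
  assumes c: "c \<in> atlas M"
  shows "is_chart (tangent_bundle M) (bundle_chart M c)"
proof -
  let ?b = "bundle_chart M c"
  have ch: "is_chart M c" using M c by (simp add: smooth_manifold_def)
  have img: "coord ?b ` cdom ?b = coord c ` cdom c \<times> model M"
    using bundle_chart_image[OF c, of UNIV] by simp
  have top: "topspace (subtopology (mtop (tangent_bundle M)) (cdom ?b)) = cdom ?b"
    using openin_subset[OF openin_cdom_bundle_chart[OF c]] by auto
  have 1: "continuous_map (subtopology (mtop (tangent_bundle M)) (cdom ?b)) (top_of_set (coord ?b ` cdom ?b)) (coord ?b)"
  proof (rule continuous_map_into_subtopology)
    show "continuous_map (subtopology (mtop (tangent_bundle M)) (cdom ?b)) euclidean (coord ?b)"
      unfolding continuous_map_def top
    proof (intro conjI allI impI)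
      fix W :: "('e \<times> 'e) set" assume "openin euclidean W"
      then have "openin (mtop (tangent_bundle M)) {z \<in> cdom ?b. coord ?b z \<in> W}"
        using openin_bundle_chart[OF c] by simp
      then show "openin (subtopology (mtop (tangent_bundle M)) (cdom ?b)) {z \<in> cdom ?b. coord ?b z \<in> W}"
        by (simp add: openin_open_subtopology[OF openin_cdom_bundle_chart[OF c]] subset_iff)
    qed simp
  qed (use top in auto)
  have 2: "continuous_map (top_of_set (coord ?b ` cdom ?b)) (mtop (tangent_bundle M)) (param ?b)"
    unfolding tangent_bundle_def mfd.simps
  proof (rule continuous_on_generated_topo)
    let ?\<S> = "{{z \<in> cdom (bundle_chart M c). coord (bundle_chart M c) z \<in> W} |c W. c \<in> atlas M \<and> open W}"
    have "cdom ?b \<in> ?\<S>" using c by (intro CollectI exI[of _ c] exI[of _ UNIV]) simp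
    then have "cdom ?b \<subseteq> \<Union>?\<S>" by (rule Union_upper)
    moreover have "param ?b ` (coord ?b ` cdom ?b) \<subseteq> cdom ?b"
      using param_bundle_chart(1)[OF c] by (rule image_subsetI)
    ultimately show "param ?b ` topspace (top_of_set (coord ?b ` cdom ?b)) \<subseteq> \<Union>?\<S>"
      by (simp only: topspace_euclidean_subtopology)
    fix U assume "U \<in> ?\<S>"
    then obtain d W where d: "d \<in> atlas M" "open W" 
      and U: "U = {z \<in> cdom (bundle_chart M d). coord (bundle_chart M d) z \<in> W}" by blast
    let ?E = "coord c ` (cdom c \<inter> cdom d) \<times> model M"
    have chd: "is_chart M d" using M d by (simp add: smooth_manifold_def)
    have E: "?E = coord ?b ` (cdom ?b \<inter> {z. fst z \<in> cdom d})" by (rule bundle_chart_image[OF c, symmetric])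
    have "openin (top_of_set (model M \<times> model M)) ?E"
      by (rule openin_Times[OF chart_image_openin[OF ch chart_dom_openin[OF chd]]]) simp
    then have openE: "openin (top_of_set (coord ?b ` cdom ?b)) ?E"
      unfolding img by (rule openin_subset_trans) (use chart_coord_model[OF ch] in auto)
    have "continuous_on ?E (coord (bundle_chart M d) \<circ> param ?b)"
      by (rule smooth_on_imp_continuous_on[OF bundle_chart_transition_smooth[OF c d(1)]])
    then have "openin (top_of_set ?E) (?E \<inter> (coord (bundle_chart M d) \<circ> param ?b) -` W)"
      using continuous_openin_preimage_gen d(2) by blast
    then have "openin (top_of_set (coord ?b ` cdom ?b)) (?E \<inter> (coord (bundle_chart M d) \<circ> param ?b) -` W)"
      using openE openin_trans by blast
    moreover have "?E \<inter> (coord (bundle_chart M d) \<circ> param ?b) -` W = param ?b -` U \<inter> topspace (top_of_set (coord ?b ` cdom ?b))"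
    proof -
      have mem: "y \<in> ?E \<longleftrightarrow> y \<in> coord ?b ` cdom ?b \<and> param ?b y \<in> cdom (bundle_chart M d)" for y
        unfolding E using bundle_chart_inj_on[OF c] by (auto simp: mem_cdom_bundle_chart)
      show ?thesis
        by (rule set_eqI)
          (simp only: Int_iff mem vimage_eq U mem_Collect_eq comp_apply topspace_euclidean_subtopology, blast)
    qed
    ultimately show "openin (top_of_set (coord ?b ` cdom ?b)) (param ?b -` U \<inter> topspace (top_of_set (coord ?b ` cdom ?b)))"
      by simp
  qed
  have "homeomorphic_maps (subtopology (mtop (tangent_bundle M)) (cdom ?b)) (top_of_set (coord ?b ` cdom ?b)) (coord ?b) (param ?b)"
    unfolding homeomorphic_maps_def
    using 1 2 param_bundle_chart(1,4)[OF c] bundle_chart_inj_on[OF c] top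
    by (auto intro!: continuous_map_into_subtopology)
  then have "homeomorphic_map (subtopology (mtop (tangent_bundle M)) (cdom ?b)) (top_of_set (coord ?b ` cdom ?b)) (coord ?b)"
    using homeomorphic_map_maps by blast
  moreover have "openin (top_of_set (model (tangent_bundle M))) (coord ?b ` cdom ?b)"
    unfolding img model_tangent_bundle by (rule openin_Times[OF chart_image_openin_model[OF ch]]) simp
  ultimately show ?thesis
    using openin_cdom_bundle_chart[OF c] by (simp add: is_chart_def)
qed

lemma charted_tangent_bundle: "charted (tangent_bundle M)"
  unfolding charted_def
proof (intro conjI ballI)
  show "subspace (model (tangent_bundle M))"
    using M by (simp add: model_tangent_bundle smooth_manifold_def subspace_Times)
  show ch: "is_chart (tangent_bundle M) b" if "b \<in> atlas (tangent_bundle M)" for b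
    using that is_chart_bundle_chart by (auto simp: atlas_tangent_bundle)
  show "(\<Union>c\<in>atlas (tangent_bundle M). cdom c) = topspace (mtop (tangent_bundle M))"
  proof
    show "(\<Union>c\<in>atlas (tangent_bundle M). cdom c) \<subseteq> topspace (mtop (tangent_bundle M))"
      using chart_dom_subset[OF ch] by (intro UN_least)
    show "topspace (mtop (tangent_bundle M)) \<subseteq> (\<Union>c\<in>atlas (tangent_bundle M). cdom c)"
    proof
      fix z assume "z \<in> topspace (mtop (tangent_bundle M))"
      then have z: "fst z \<in> topspace (mtop M)" "snd z \<in> tangent_space M (fst z)"
        by (simp_all add: topspace_tangent_bundle mem_tangent_total)
      obtain c where c: "c \<in> atlas M" "fst z \<in> cdom c"
        by (rule charted_obtain_chart[OF smooth_manifold_charted[OF M] z(1)])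
      then have "z \<in> cdom (bundle_chart M c)" using z by (simp add: mem_cdom_bundle_chart)
      then show "z \<in> (\<Union>c\<in>atlas (tangent_bundle M). cdom c)"
        using c(1) by (intro UN_I[of "bundle_chart M c"]) (simp_all only: atlas_tangent_bundle, blast)
    qed
  qed
qed

text \<open>The bundle topology is generated by chart preimages, so openness is checked around each
  point, where \<open>W \<times> UNIV\<close> in a single bundle chart gives a neighbourhood inside
  the preimage of \<open>U\<close>.\<close>

lemma continuous_map_bundle_projection: "continuous_map (mtop (tangent_bundle M)) (mtop M) fst"
  unfolding continuous_map_def
proof (intro conjI allI impI)
  show "fst \<in> topspace (mtop (tangent_bundle M)) \<rightarrow> topspace (mtop M)"
    by (auto simp: topspace_tangent_bundle mem_tangent_total)
  fix U assume U: "openin (mtop M) U"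
  show "openin (mtop (tangent_bundle M)) {z \<in> topspace (mtop (tangent_bundle M)). fst z \<in> U}"
  proof (subst openin_subopen, intro ballI)
    fix z assume z: "z \<in> {z \<in> topspace (mtop (tangent_bundle M)). fst z \<in> U}"
    then have pz: "fst z \<in> topspace (mtop M)" by (simp add: topspace_tangent_bundle mem_tangent_total)
    obtain c where c: "c \<in> atlas M" "fst z \<in> cdom c" "is_chart M c"
      by (rule charted_obtain_chart[OF smooth_manifold_charted[OF M] pz])
    obtain W where W: "open W" "coord c ` (cdom c \<inter> U) = model M \<inter> W"
      using chart_image_openin[OF c(3) U] by (auto simp: openin_open)
    let ?T = "{z \<in> cdom (bundle_chart M c). coord (bundle_chart M c) z \<in> W \<times> UNIV}"
    have "openin (mtop (tangent_bundle M)) ?T"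
      by (rule openin_bundle_chart[OF c(1)]) (simp add: W(1) open_Times)
    moreover have "z \<in> ?T"
    proof -
      have "coord c (fst z) \<in> model M \<inter> W" using z c(2) W(2) by blast
      then show ?thesis
        using z c(2) by (simp add: mem_cdom_bundle_chart coord_bundle_chart topspace_tangent_bundle mem_tangent_total)
    qed
    moreover have "?T \<subseteq> {z \<in> topspace (mtop (tangent_bundle M)). fst z \<in> U}"
    proof
      fix w assume w: "w \<in> ?T"
      then have p: "fst w \<in> cdom c" "coord c (fst w) \<in> model M \<inter> W"
        using chart_coord_model[OF c(3)] by (simp_all add: mem_cdom_bundle_chart coord_bundle_chart)
      then obtain q where q: "q \<in> cdom c" "q \<in> U" "coord c (fst w) = coord c q"
        unfolding W(2)[symmetric] by blast
      then have "fst w \<in> U" using inj_onD[OF chart_inj_on[OF c(3)] q(3) p(1) q(1)] by simp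
      then show "w \<in> {z \<in> topspace (mtop (tangent_bundle M)). fst z \<in> U}"
        using w by (simp add: mem_cdom_bundle_chart topspace_tangent_bundle mem_tangent_total)
    qed
    ultimately show "\<exists>T. openin (mtop (tangent_bundle M)) T \<and> z \<in> T \<and>
        T \<subseteq> {z \<in> topspace (mtop (tangent_bundle M)). fst z \<in> U}"
      by (intro exI[of _ ?T] conjI)
  qed
qed

text \<open>Different base points are separated in \<open>M\<close>; vectors at the same point lie
  in one bundle chart, whose injectivity separates them.\<close>

lemma Hausdorff_tangent_bundle: "Hausdorff_space (mtop (tangent_bundle M))"
  unfolding Hausdorff_space_def
proof (intro allI impI, elim conjE)
  fix z w assume z: "z \<in> topspace (mtop (tangent_bundle M))" and w: "w \<in> topspace (mtop (tangent_bundle M))"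
    and "z \<noteq> w"
  show "\<exists>U V. openin (mtop (tangent_bundle M)) U \<and> openin (mtop (tangent_bundle M)) V \<and> z \<in> U \<and> w \<in> V \<and> disjnt U V"
  proof (cases "fst z = fst w")
    case False
    have "fst z \<in> topspace (mtop M)" "fst w \<in> topspace (mtop M)"
      using z w by (auto simp: topspace_tangent_bundle mem_tangent_total)
    then obtain U V where UV: "openin (mtop M) U" "openin (mtop M) V" "fst z \<in> U" "fst w \<in> V" "disjnt U V"
      using M False unfolding smooth_manifold_def Hausdorff_space_def by metis
    note pre = openin_continuous_map_preimage[OF continuous_map_bundle_projection]
    show ?thesis
      using pre[OF UV(1)] pre[OF UV(2)] UV(3-5) z w
      by (intro exI[of _ "{z \<in> topspace (mtop (tangent_bundle M)). fst z \<in> U}"]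
          exI[of _ "{z \<in> topspace (mtop (tangent_bundle M)). fst z \<in> V}"] conjI) (auto simp: disjnt_iff)
  next
    case True
    have "fst z \<in> topspace (mtop M)" using z by (simp add: topspace_tangent_bundle mem_tangent_total)
    then obtain c where c: "c \<in> atlas M" "fst z \<in> cdom c"
      using charted_obtain_chart[OF smooth_manifold_charted[OF M]] by blast
    then have dom: "z \<in> cdom (bundle_chart M c)" "w \<in> cdom (bundle_chart M c)"
      using z w True by (auto simp: mem_cdom_bundle_chart topspace_tangent_bundle mem_tangent_total)
    then have "coord (bundle_chart M c) z \<noteq> coord (bundle_chart M c) w"
      using \<open>z \<noteq> w\<close> bundle_chart_inj_on[OF c(1)] by (auto dest: inj_onD)
    then obtain U V where UV: "open U" "open V" "coord (bundle_chart M c) z \<in> U"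
      "coord (bundle_chart M c) w \<in> V" "U \<inter> V = {}"
      using hausdorff by metis
    then show ?thesis
      using openin_bundle_chart[OF c(1) UV(1)] openin_bundle_chart[OF c(1) UV(2)] dom
      by (intro exI[of _ "{z \<in> cdom (bundle_chart M c). coord (bundle_chart M c) z \<in> U}"]
          exI[of _ "{z \<in> cdom (bundle_chart M c). coord (bundle_chart M c) z \<in> V}"] conjI)
        (auto simp: disjnt_iff)
  qed
qed

end

section \<open>The projection of a transverse submanifold\<close>

lemma submanifoldE:
  assumes "submanifold X l S" "p \<in> S"
  obtains c L where "c \<in> max_atlas X" "p \<in> cdom c" "subspace L" "L \<subseteq> model X" "dim L = l"
    "coord c ` (cdom c \<inter> S) = coord c ` cdom c \<inter> L"
  using assms unfolding submanifold_def by blast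

text \<open>Openness in \<open>L\<close> keeps short segments with directions in \<open>L\<close>
  inside the submanifold and provides the domain for the inverse function theorem on
  \<open>L\<close>.\<close>

lemma slice_openin:
  assumes c: "is_chart X c" and L: "L \<subseteq> model X" and slice: "coord c ` (cdom c \<inter> S) = coord c ` cdom c \<inter> L"
    and U: "openin (mtop X) U"
  shows "openin (top_of_set L) (coord c ` (cdom c \<inter> S \<inter> U))"
proof -
  have "(cdom c \<inter> S) \<inter> (cdom c \<inter> U) = cdom c \<inter> S \<inter> U" by blast
  then have "coord c ` (cdom c \<inter> S \<inter> U) = coord c ` (cdom c \<inter> S) \<inter> coord c ` (cdom c \<inter> U)"
    using inj_on_image_Int[OF chart_inj_on[OF c], of "cdom c \<inter> S" "cdom c \<inter> U"] by simp
  also have "\<dots> = L \<inter> coord c ` (cdom c \<inter> U)" using slice by blast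
  finally have eq: "coord c ` (cdom c \<inter> S \<inter> U) = L \<inter> coord c ` (cdom c \<inter> U)" .
  obtain W where "open W" "coord c ` (cdom c \<inter> U) = model X \<inter> W"
    using chart_image_openin[OF c U] unfolding openin_open by blast
  then have "open W \<and> coord c ` (cdom c \<inter> S \<inter> U) = L \<inter> W" using eq L by blast
  then show ?thesis unfolding openin_open by blast
qed

text \<open>A small ball cut with \<open>L\<close> is convex, and \<open>param c\<close> carries it
  to a path connected neighbourhood. Through this, connectedness of \<open>N\<close> supplies the
  path whose endpoints the lifting argument compares.\<close>

lemma submanifold_locally_path_connected:
  assumes S: "submanifold X l S"
  shows "locally_path_connected_space (subtopology (mtop X) S)"
  unfolding locally_path_connected_space
proof (intro allI impI, elim conjE)
  fix V p assume V: "openin (subtopology (mtop X) S) V" and p: "p \<in> V"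
  then obtain U where U: "openin (mtop X) U" "V = U \<inter> S" unfolding openin_subtopology by blast
  then have "p \<in> S" "p \<in> U" using p by auto
  obtain c L where cL: "c \<in> max_atlas X" "p \<in> cdom c" "subspace L" "L \<subseteq> model X"
    "coord c ` (cdom c \<inter> S) = coord c ` cdom c \<inter> L"
    by (rule submanifoldE[OF S \<open>p \<in> S\<close>])
  note c = max_atlas_is_chart[OF cL(1)]
  obtain W where W: "open W" "coord c ` (cdom c \<inter> S \<inter> U) = L \<inter> W"
    using slice_openin[OF c cL(4,5) U(1)] unfolding openin_open by blast
  have "coord c p \<in> coord c ` (cdom c \<inter> S \<inter> U)" using cL(2) \<open>p \<in> S\<close> \<open>p \<in> U\<close> by blast
  then have pL: "coord c p \<in> L" "coord c p \<in> W" using W(2) by auto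
  obtain e where e: "e > 0" "ball (coord c p) e \<subseteq> W" using W(1) pL(2) open_contains_ball by blast
  define P where "P = L \<inter> ball (coord c p) e"
  define T where "T = {q \<in> S \<inter> cdom c. coord c q \<in> P}"
  have P: "P \<subseteq> coord c ` (cdom c \<inter> S \<inter> U)" using e W(2) by (auto simp: P_def)
  have "openin (top_of_set (coord c ` (cdom c \<inter> S))) P"
  proof (rule openin_subset_trans)
    show "openin (top_of_set L) P" unfolding P_def by (rule openin_open_Int) simp
    show "P \<subseteq> coord c ` (cdom c \<inter> S)" using P by blast
    show "coord c ` (cdom c \<inter> S) \<subseteq> L" using cL(5) by blast
  qed
  then have "openin (subtopology (mtop X) S) T"
    unfolding T_def by (rule chart_preimage_openin[OF c])
  moreover have "path_connectedin (subtopology (mtop X) S) T"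
  proof -
    have T: "T = param c ` P"
    proof
      show "T \<subseteq> param c ` P"
      proof
        fix q assume "q \<in> T"
        then show "q \<in> param c ` P"
          using chart_param_coord[OF c, of q] by (intro image_eqI[of _ _ "coord c q"]) (auto simp: T_def)
      qed
      show "param c ` P \<subseteq> T"
      proof
        fix q assume "q \<in> param c ` P"
        then obtain x where x: "x \<in> P" "q = param c x" by blast
        then obtain r where r: "r \<in> cdom c" "r \<in> S" "x = coord c r" using P by blast
        then have "q = r" using x(2) chart_param_coord[OF c] by simp
        then show "q \<in> T" using x r by (simp add: T_def)
      qed
    qed
    have "convex P" unfolding P_def using cL(3) by (intro convex_Int subspace_imp_convex convex_ball)
    then have "path_connectedin (top_of_set (coord c ` cdom c)) P"
      unfolding path_connectedin_subtopology path_connectedin_euclidean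
      using P convex_imp_path_connected[of P] by blast
    then have "path_connectedin (mtop X) T"
      unfolding T by (rule path_connectedin_continuous_map_image[OF chart_continuous_param[OF c]])
    then show ?thesis by (simp add: path_connectedin_subtopology T_def)
  qed
  moreover have "p \<in> T" using \<open>p \<in> S\<close> cL(2) pL e(1) by (simp add: T_def P_def)
  moreover have "T \<subseteq> V"
  proof
    fix q assume "q \<in> T"
    then have q: "q \<in> S" "q \<in> cdom c" "coord c q \<in> P" by (auto simp: T_def)
    then obtain r where r: "r \<in> cdom c" "r \<in> U" "coord c q = coord c r" using P by blast
    then have "q = r" using inj_onD[OF chart_inj_on[OF c] r(3) q(2) r(1)] by simp
    then show "q \<in> V" using r U q by blast
  qed
  ultimately show "\<exists>T. openin (subtopology (mtop X) S) T \<and> path_connectedin (subtopology (mtop X) S) T \<and> p \<in> T \<and> T \<subseteq> V"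
    by blast
qed

lemma connected_locally_path_connected_imp_path_connected:
  assumes "connected_space X" "locally_path_connected_space X"
  shows "path_connected_space X"
  unfolding path_connected_space_def
proof (intro ballI)
  fix x y assume x: "x \<in> topspace X" and y: "y \<in> topspace X"
  let ?C = "Collect (path_component_of X x)"
  have "openin X ?C" "closedin X ?C"
    using openin_path_component_of_locally_path_connected_space[OF assms(2)]
      closedin_path_component_of_locally_path_connected_space[OF assms(2)] by auto
  moreover have "x \<in> ?C" using x by (simp add: path_component_of_refl)
  ultimately have "?C = topspace X" using assms(1) connected_space_clopen_in by blast
  then show "\<exists>g. pathin X g \<and> g 0 = x \<and> g 1 = y" using y unfolding path_component_of_def by blast
qed

section \<open>Transversality in slice coordinates\<close>

lemma smooth_on_line: "smooth_on S (\<lambda>t::real. x + t *\<^sub>R (u :: 'a::euclidean_space))"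
proof (rule smooth_onI)
  have "linear (\<lambda>t::real. t *\<^sub>R u)" by (auto intro!: linearI simp: scaleR_add_left)
  then have "Ck_on k UNIV (\<lambda>t::real. x + t *\<^sub>R u)" for k
    by (intro Ck_on_add Ck_on_const Ck_on_linear open_UNIV)
  then show "\<exists>T g. open T \<and> s \<in> T \<and> (\<forall>k. Ck_on k T g) \<and> (\<forall>t. t \<in> S \<longrightarrow> t \<in> T \<longrightarrow> g t = x + t *\<^sub>R u)" for s
    by (intro exI[of _ UNIV] exI[of _ "\<lambda>t. x + t *\<^sub>R u"]) simp
qed

text \<open>Lines in chart coordinates are the test curves by which a vector is shown to belong to
  \<open>tangent_space_sub\<close>.\<close>

lemma smooth_map_param_line:
  assumes c: "c \<in> max_atlas X" and line: "\<And>t. t \<in> S \<Longrightarrow> x + t *\<^sub>R u \<in> coord c ` cdom c"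
  shows "smooth_map real_mfd S X (\<lambda>t. param c (x + t *\<^sub>R u))"
  unfolding smooth_map_def
proof (intro conjI ballI)
  note ch = max_atlas_is_chart[OF c]
  let ?\<sigma> = "\<lambda>t. x + t *\<^sub>R u"
  have "continuous_map (top_of_set S) (top_of_set (coord c ` cdom c)) ?\<sigma>"
    using line by (intro continuous_map_into_subtopology) (auto intro!: continuous_intros)
  from continuous_map_compose[OF this chart_continuous_param[OF ch]]
  show "continuous_map (subtopology (mtop real_mfd) S) (mtop X) (\<lambda>t. param c (x + t *\<^sub>R u))"
    by (simp add: real_mfd_def o_def)
  fix r d assume r: "r \<in> atlas real_mfd" and d: "d \<in> atlas X"
  have r: "r = (UNIV, \<lambda>t. t)" using r by (simp add: real_mfd_def)
  let ?B = "{t \<in> S. param c (?\<sigma> t) \<in> cdom d}"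
  have "?\<sigma> ` ?B \<subseteq> coord c ` (cdom c \<inter> cdom d)"
  proof (rule image_subsetI)
    fix t assume t: "t \<in> ?B"
    then obtain p where p: "p \<in> cdom c" "?\<sigma> t = coord c p" using line by blast
    then have "p \<in> cdom d" using t chart_param_coord[OF ch p(1)] by simp
    then show "?\<sigma> t \<in> coord c ` (cdom c \<inter> cdom d)" using p by blast
  qed
  from smooth_on_compose[OF smooth_on_line max_atlas_smooth_on(1)[OF c d] this]
  have "smooth_on ?B (coord d \<circ> (\<lambda>t. param c (?\<sigma> t)))" by (simp add: o_def)
  moreover have "inv_into UNIV (\<lambda>t::real. t) = (\<lambda>t. t)" using inv_id unfolding id_def .
  ultimately show "smooth_on (coord r ` {p \<in> S \<inter> cdom r. param c (?\<sigma> p) \<in> cdom d})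
      (coord d \<circ> (\<lambda>t. param c (?\<sigma> t)) \<circ> param r)"
    by (simp add: r o_def)
qed

text \<open>\<open>differential\<close> is a definite description, so the zero vector must be shown
  to be its only solution. Uniqueness of the component at \<open>d\<close> uses the bundle chart of
  \<open>d\<close> itself around \<open>z\<close>.\<close>

lemma differential_projection_eq_zero:
  assumes M: "smooth_manifold n M" and z: "z \<in> topspace (mtop (tangent_bundle M))"
    and zero: "\<And>c d. c \<in> atlas M \<Longrightarrow> d \<in> atlas M \<Longrightarrow> fst z \<in> cdom c \<Longrightarrow> fst z \<in> cdom d \<Longrightarrow>
      ((\<lambda>t. coord d (fst (param (bundle_chart M c) (coord (bundle_chart M c) z + t *\<^sub>R w (bundle_chart M c)))))
        has_vector_derivative 0) (at 0)"
  shows "differential (tangent_bundle M) M fst z w = (\<lambda>_. 0)"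
  unfolding differential_def
proof (rule the_equality)
  have z': "fst z \<in> topspace (mtop M)" "snd z \<in> tangent_space M (fst z)"
    using z by (simp_all add: topspace_tangent_bundle[OF M] mem_tangent_total)
  show "(\<lambda>_. 0) \<in> tangent_space M (fst z) \<and>
    (\<forall>b\<in>atlas (tangent_bundle M). \<forall>d\<in>atlas M. z \<in> cdom b \<and> fst z \<in> cdom d \<longrightarrow>
      ((\<lambda>t. coord d (fst (param b (coord b z + t *\<^sub>R w b)))) has_vector_derivative 0) (at 0))"
  proof (intro conjI ballI impI)
    show "(\<lambda>_. 0) \<in> tangent_space M (fst z)"
      by (rule zero_in_tangent_space[OF smooth_manifold_charted[OF M]])
    fix b d assume b: "b \<in> atlas (tangent_bundle M)" and d: "d \<in> atlas M" and dom: "z \<in> cdom b \<and> fst z \<in> cdom d"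
    obtain c where c: "c \<in> atlas M" "b = bundle_chart M c" using b unfolding atlas_tangent_bundle by blast
    have "fst z \<in> cdom c" using dom c(2) mem_cdom_bundle_chart by blast
    then show "((\<lambda>t. coord d (fst (param b (coord b z + t *\<^sub>R w b)))) has_vector_derivative 0) (at 0)"
      using zero[OF c(1) d] dom unfolding c(2) by blast
  qed
  fix v assume v: "v \<in> tangent_space M (fst z) \<and>
    (\<forall>b\<in>atlas (tangent_bundle M). \<forall>d\<in>atlas M. z \<in> cdom b \<and> fst z \<in> cdom d \<longrightarrow>
      ((\<lambda>t. coord d (fst (param b (coord b z + t *\<^sub>R w b)))) has_vector_derivative v d) (at 0))"
  show "v = (\<lambda>_. 0)"
  proof
    fix d
    show "v d = 0"
    proof (cases "d \<in> atlas M \<and> fst z \<in> cdom d")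
      case True
      then have "bundle_chart M d \<in> atlas (tangent_bundle M)" "z \<in> cdom (bundle_chart M d)"
        using z' by (auto simp: atlas_tangent_bundle mem_cdom_bundle_chart)
      then have "((\<lambda>t. coord d (fst (param (bundle_chart M d) (coord (bundle_chart M d) z + t *\<^sub>R w (bundle_chart M d)))))
          has_vector_derivative v d) (at 0)"
        using v True by blast
      then show "v d = 0" using zero[of d d] True vector_derivative_unique_at by blast
    next
      case False
      then show "v d = 0" using tangent_spaceD(2)[OF conjunct1[OF v]] by blast
    qed
  qed
qed

text \<open>A direction of the slice that the projection annihilates gives a vertical velocity of a
  curve in \<open>N\<close>.\<close>

lemma transverse_slice_projection_immersion:
  fixes M :: "('a, 'e::euclidean_space) mfd"
  assumes M: "smooth_manifold n M" and trans: "transverse_to_fibers M N"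
    and cN: "cN \<in> max_atlas (tangent_bundle M)" "z \<in> cdom cN" "z \<in> N"
    and L: "subspace L" "L \<subseteq> model (tangent_bundle M)" "coord cN ` (cdom cN \<inter> N) = coord cN ` cdom cN \<inter> L"
    and cF: "cF \<in> max_atlas M" "fst z \<in> cdom cF"
    and u: "u \<in> L" "((\<lambda>t. coord cF (fst (param cN (coord cN z + t *\<^sub>R u)))) has_vector_derivative 0) (at 0)"
  shows "u = 0"
proof -
  let ?TM = "tangent_bundle M"
  note TM = charted_tangent_bundle[OF M] and chN = max_atlas_is_chart[OF cN(1)] and chF = max_atlas_is_chart[OF cF(1)]
  have subTM: "subspace (model ?TM)" using TM by (simp add: charted_def)
  have subM: "subspace (model M)" using M by (simp add: smooth_manifold_def)
  have ztop: "z \<in> topspace (mtop ?TM)" using chart_dom_subset[OF chN] cN(2) by blast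
  define \<sigma> where "\<sigma> t = coord cN z + t *\<^sub>R u" for t :: real
  define \<gamma> where "\<gamma> t = param cN (\<sigma> t)" for t
  have \<gamma>0: "\<gamma> 0 = z" using chart_param_coord[OF chN cN(2)] by (simp add: \<gamma>_def \<sigma>_def)
  have uTM: "u \<in> model ?TM" using u(1) L(2) by blast
  obtain w where w: "w \<in> tangent_space ?TM z"
    and dw: "\<And>b. b \<in> atlas ?TM \<Longrightarrow> z \<in> cdom b \<Longrightarrow>
      ((\<lambda>t. coord b (param cN (coord cN z + t *\<^sub>R u))) has_vector_derivative w b) (at 0)"
    and w0: "w = (\<lambda>_. 0) \<Longrightarrow> u = 0"
    by (rule tangent_vector_exists[OF TM cN(1,2) uTM]) (rule that)
  note dw = dw[folded \<sigma>_def, folded \<gamma>_def]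
  \<comment> \<open>In the chart \<open>cN\<close> the submanifold is open in \<open>L\<close>, so
    the segment stays in \<open>N\<close> for a time \<open>\<epsilon>\<close>, as
    \<open>tangent_space_sub\<close> requires.\<close>
  have "\<forall>\<^sub>F t in nhds 0. \<sigma> t \<in> coord cN ` (cdom cN \<inter> N \<inter> topspace (mtop ?TM))"
    unfolding \<sigma>_def
    by (rule line_eventually_in_openin[OF L(1) slice_openin[OF chN L(2,3) openin_topspace] _ u(1)])
      (use cN ztop in blast)
  then obtain \<epsilon> where \<epsilon>: "\<epsilon> > 0" "\<And>t. dist t 0 < \<epsilon> \<Longrightarrow> \<sigma> t \<in> coord cN ` (cdom cN \<inter> N \<inter> topspace (mtop ?TM))"
    unfolding eventually_nhds_metric by blast
  have \<sigma>in: "\<sigma> t \<in> coord cN ` (cdom cN \<inter> N)" if "t \<in> {-\<epsilon><..<\<epsilon>}" for t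
    using \<epsilon>(2)[of t] that by (force simp: dist_real_def)
  have \<gamma>N: "\<gamma> ` {-\<epsilon><..<\<epsilon>} \<subseteq> N"
  proof (rule image_subsetI)
    fix t assume "t \<in> {-\<epsilon><..<\<epsilon>}"
    then obtain q where "q \<in> cdom cN" "q \<in> N" "\<sigma> t = coord cN q" using \<sigma>in by blast
    then show "\<gamma> t \<in> N" using chart_param_coord[OF chN] by (simp add: \<gamma>_def)
  qed
  have "smooth_map real_mfd {-\<epsilon><..<\<epsilon>} ?TM \<gamma>"
    unfolding \<gamma>_def \<sigma>_def
    by (rule smooth_map_param_line[OF cN(1)]) (use \<sigma>in in \<open>unfold \<sigma>_def, blast\<close>)
  then have "w \<in> tangent_space_sub ?TM N z"
    unfolding tangent_space_sub_def mem_Collect_eq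
    using w \<epsilon>(1) \<gamma>0 \<gamma>N dw by (intro conjI exI[of _ \<gamma>] exI[of _ \<epsilon>] ballI impI)
  moreover have "differential ?TM M fst z w = (\<lambda>_. 0)"
  proof (rule differential_projection_eq_zero[OF M ztop])
    fix c d assume c: "c \<in> atlas M" and d: "d \<in> atlas M" and zc: "fst z \<in> cdom c" and zd: "fst z \<in> cdom d"
    let ?b = "bundle_chart M c"
    have chc: "is_chart M c" and chd: "is_chart M d" using M c d by (auto simp: smooth_manifold_def)
    have b: "?b \<in> atlas ?TM" "z \<in> cdom ?b"
      using c zc ztop by (auto simp: atlas_tangent_bundle mem_cdom_bundle_chart topspace_tangent_bundle[OF M] mem_tangent_total)
    have ev: "\<forall>\<^sub>F t in nhds 0. fst (\<gamma> t) \<in> cdom c \<and> fst (\<gamma> t) \<in> cdom d \<and> fst (\<gamma> t) \<in> cdom cF"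
    proof -
      let ?U = "{z \<in> topspace (mtop ?TM). fst z \<in> cdom c \<inter> cdom d \<inter> cdom cF}"
      have "openin (mtop ?TM) ?U"
        by (rule openin_continuous_map_preimage[OF continuous_map_bundle_projection[OF M]])
          (intro openin_Int chart_dom_openin[OF chc] chart_dom_openin[OF chd] chart_dom_openin[OF chF])
      note U = chart_image_openin[OF chN this]
      have "z \<in> ?U" using ztop zc zd cF(2) by simp
      then have "coord cN z \<in> coord cN ` (cdom cN \<inter> ?U)" using cN(2) by (intro imageI IntI)
      then have "\<forall>\<^sub>F t in nhds 0. \<sigma> t \<in> coord cN ` (cdom cN \<inter> ?U)"
        unfolding \<sigma>_def by (rule line_eventually_in_openin[OF subTM U _ uTM])
      then show ?thesis
      proof eventually_elim
        case (elim t)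
        then obtain q where "q \<in> cdom cN" "q \<in> ?U" "\<sigma> t = coord cN q" by blast
        then show ?case using chart_param_coord[OF chN] by (simp add: \<gamma>_def)
      qed
    qed
    have dc: "((\<lambda>t. coord c (fst (\<gamma> t))) has_vector_derivative fst (w ?b)) (at 0)"
      using bounded_linear.has_vector_derivative[OF bounded_linear_fst dw[OF b]] by (simp add: coord_bundle_chart)
    have x0: "coord c (fst z) \<in> coord c ` (cdom c \<inter> cdom d)" using zc zd by blast
    obtain D where D: "linear D"
      "\<And>\<tau> v. \<tau> 0 = coord c (fst z) \<Longrightarrow> (\<tau> has_vector_derivative v) (at 0) \<Longrightarrow>
        \<forall>\<^sub>F t in nhds 0. \<tau> t \<in> coord c ` (cdom c \<inter> cdom d) \<Longrightarrow>
        ((\<lambda>t. (coord d \<circ> param c) (\<tau> t)) has_vector_derivative D v) (at 0)"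
      by (rule smooth_on_curve_derivative[OF max_atlas_smooth_on(1)[OF smooth_manifold_atlas_max[OF M c] d] x0]) (rule that)
    have "((\<lambda>t. (coord d \<circ> param c) (coord c (fst (\<gamma> t)))) has_vector_derivative D (fst (w ?b))) (at 0)"
      by (rule D(2)[OF _ dc]) (simp add: \<gamma>0, use ev in \<open>eventually_elim, blast\<close>)
    then have 1: "((\<lambda>t. coord d (fst (\<gamma> t))) has_vector_derivative D (fst (w ?b))) (at 0)"
      by (rule has_vector_derivative_cong_nhds)
        (use ev in \<open>eventually_elim, simp add: chart_param_coord[OF chc]\<close>)
    have y0: "coord cF (fst z) \<in> coord cF ` (cdom cF \<inter> cdom d)" using cF(2) zd by blast
    obtain E where E: "linear E"
      "\<And>\<tau> v. \<tau> 0 = coord cF (fst z) \<Longrightarrow> (\<tau> has_vector_derivative v) (at 0) \<Longrightarrow>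
        \<forall>\<^sub>F t in nhds 0. \<tau> t \<in> coord cF ` (cdom cF \<inter> cdom d) \<Longrightarrow>
        ((\<lambda>t. (coord d \<circ> param cF) (\<tau> t)) has_vector_derivative E v) (at 0)"
      by (rule smooth_on_curve_derivative[OF max_atlas_smooth_on(1)[OF cF(1) d] y0]) (rule that)
    have dF: "((\<lambda>t. coord cF (fst (\<gamma> t))) has_vector_derivative 0) (at 0)"
      using u(2) by (simp add: \<gamma>_def \<sigma>_def)
    have "((\<lambda>t. (coord d \<circ> param cF) (coord cF (fst (\<gamma> t)))) has_vector_derivative E 0) (at 0)"
      by (rule E(2)[OF _ dF]) (simp add: \<gamma>0, use ev in \<open>eventually_elim, blast\<close>)
    then have "((\<lambda>t. coord d (fst (\<gamma> t))) has_vector_derivative E 0) (at 0)"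
      by (rule has_vector_derivative_cong_nhds)
        (use ev in \<open>eventually_elim, simp add: chart_param_coord[OF chF]\<close>)
    \<comment> \<open>The velocity of \<open>fst (\<gamma> t)\<close> in \<open>d\<close> has been
      computed twice: through \<open>c\<close>, as the image under \<open>D\<close> of the base part
      of \<open>w\<close>, and through \<open>cF\<close>, where the hypothesis on \<open>u\<close>
      makes it \<open>E 0\<close>.\<close>
    then have D0: "D (fst (w ?b)) = 0"
      using vector_derivative_unique_at[OF 1] linear_0[OF E(1)] by simp
    have wb: "w ?b \<in> model M \<times> model M"
      using tangent_spaceD(1)[OF w b] by (simp add: model_tangent_bundle)
    then have "fst (w ?b) \<in> model M" by (simp add: mem_Times_iff)
    then have "\<forall>\<^sub>F t in nhds 0. coord c (fst z) + t *\<^sub>R fst (w ?b) \<in> coord c ` (cdom c \<inter> cdom d)"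
      by (rule line_eventually_in_openin[OF subM chart_image_openin[OF chc chart_dom_openin[OF chd]] x0])
    then have "((\<lambda>t. (coord d \<circ> param c) (coord c (fst z) + t *\<^sub>R fst (w ?b))) has_vector_derivative D (fst (w ?b))) (at 0)"
      by (intro D(2)[OF _ has_vector_derivative_line]) simp_all
    \<comment> \<open>\<open>differential\<close> looks at the straight line in the bundle chart
      instead of \<open>\<gamma>\<close>; its base part is the line with direction
      \<open>fst (w ?b)\<close>, to which \<open>D\<close> applies as well.\<close>
    then show "((\<lambda>t. coord d (fst (param ?b (coord ?b z + t *\<^sub>R w ?b)))) has_vector_derivative 0) (at 0)"
      unfolding D0
    proof (rule has_vector_derivative_cong_nhds)
      have "\<forall>\<^sub>F t in nhds 0. coord ?b z + t *\<^sub>R w ?b \<in> coord ?b ` cdom ?b"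
        by (rule line_eventually_in_openin[OF subTM chart_image_openin_model[OF is_chart_bundle_chart[OF M c]]])
          (use b(2) wb in \<open>auto simp: model_tangent_bundle\<close>)
      then show "\<forall>\<^sub>F t in nhds 0. (coord d \<circ> param c) (coord c (fst z) + t *\<^sub>R fst (w ?b)) =
          coord d (fst (param ?b (coord ?b z + t *\<^sub>R w ?b)))"
        by eventually_elim (simp add: param_bundle_chart(2)[OF M c], simp add: coord_bundle_chart)
    qed
  qed
  ultimately have "w = (\<lambda>_. 0)"
    using trans w cN(3) unfolding transverse_to_fibers_def by blast
  then show "u = 0" by (rule w0)
qed

section \<open>Local smooth inverses of the projection\<close>

text \<open>\<open>cN\<close> and \<open>cF\<close> are arbitrary charts of the maximal atlases, so
  the projection is factored locally through a bundle chart, in which it is the linear map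
  \<open>fst\<close>; compatibility takes care of the coordinate changes on both sides.\<close>

lemma smooth_on_slice_projection:
  assumes M: "smooth_manifold n M" and cN: "cN \<in> max_atlas (tangent_bundle M)" and cF: "cF \<in> max_atlas M"
    and A: "A \<subseteq> coord cN ` (cdom cN \<inter> {z \<in> topspace (mtop (tangent_bundle M)). fst z \<in> cdom cF})"
  shows "smooth_on A (\<lambda>a. coord cF (fst (param cN a)))"
proof (rule smooth_on_local)
  let ?TM = "tangent_bundle M"
  note chN = max_atlas_is_chart[OF cN]
  fix x assume "x \<in> A"
  then obtain z where z: "z \<in> cdom cN" "z \<in> topspace (mtop ?TM)" "x = coord cN z" using A by blast
  have "fst z \<in> topspace (mtop M)" using z(2) by (simp add: topspace_tangent_bundle[OF M] mem_tangent_total)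
  then obtain c where c: "c \<in> atlas M" "fst z \<in> cdom c"
    using charted_obtain_chart[OF smooth_manifold_charted[OF M]] by blast
  let ?b = "bundle_chart M c"
  have b: "?b \<in> atlas ?TM" "z \<in> cdom ?b"
    using c z(2) by (auto simp: atlas_tangent_bundle mem_cdom_bundle_chart topspace_tangent_bundle[OF M] mem_tangent_total)
  obtain W where W: "open W" "coord cN ` (cdom cN \<inter> cdom ?b) = model ?TM \<inter> W"
    using chart_image_openin[OF chN openin_cdom_bundle_chart[OF c(1)]] unfolding openin_open by blast
  have AW: "A \<inter> W \<subseteq> coord cN ` (cdom cN \<inter> cdom ?b)"
  proof
    fix y assume y: "y \<in> A \<inter> W"
    then obtain q where "q \<in> cdom cN" "y = coord cN q" using A by blast
    then have "y \<in> model ?TM" using chart_coord_model[OF chN] by simp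
    then show "y \<in> coord cN ` (cdom cN \<inter> cdom ?b)" using y W(2) by blast
  qed
  have 1: "smooth_on (A \<inter> W) (fst \<circ> (coord ?b \<circ> param cN))"
    by (rule smooth_on_compose[OF smooth_on_subset[OF max_atlas_smooth_on(1)[OF cN b(1)] AW] smooth_on_linear[OF linear_fst] subset_UNIV])
  have eq: "fst ((coord ?b \<circ> param cN) y) = coord c (fst (param cN y))" for y
    by (simp add: coord_bundle_chart)
  have dom: "fst (param cN y) \<in> cdom c \<and> fst (param cN y) \<in> cdom cF" if y: "y \<in> A \<inter> W" for y
  proof -
    obtain q where q: "q \<in> cdom cN" "q \<in> cdom ?b" "y = coord cN q" using AW y by blast
    obtain r where r: "r \<in> cdom cN" "fst r \<in> cdom cF" "y = coord cN r" using A y by blast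
    have "param cN y = q" "param cN y = r"
      using chart_param_coord[OF chN q(1)] chart_param_coord[OF chN r(1)] q(3) r(3) by auto
    then show ?thesis using q(2) r(2) by (metis mem_cdom_bundle_chart)
  qed
  have "(fst \<circ> (coord ?b \<circ> param cN)) ` (A \<inter> W) \<subseteq> coord c ` (cdom c \<inter> cdom cF)"
  proof (rule image_subsetI)
    fix y assume "y \<in> A \<inter> W"
    from dom[OF this] have "fst (param cN y) \<in> cdom c \<inter> cdom cF" by blast
    then show "(fst \<circ> (coord ?b \<circ> param cN)) y \<in> coord c ` (cdom c \<inter> cdom cF)"
      unfolding comp_apply[of fst] eq by (rule imageI)
  qed
  from smooth_on_compose[OF 1 max_atlas_smooth_on(2)[OF cF c(1)] this]
  have "smooth_on (A \<inter> W) ((coord cF \<circ> param c) \<circ> (fst \<circ> (coord ?b \<circ> param cN)))" .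
  then have "smooth_on (A \<inter> W) (\<lambda>a. coord cF (fst (param cN a)))"
  proof (rule smooth_on_cong)
    fix y assume y: "y \<in> A \<inter> W"
    have "is_chart M c" using M c(1) by (simp add: smooth_manifold_def)
    then show "((coord cF \<circ> param c) \<circ> (fst \<circ> (coord ?b \<circ> param cN))) y = coord cF (fst (param cN y))"
      using dom[OF y] chart_param_coord[of M c] by (simp add: coord_bundle_chart)
  qed
  moreover have "x \<in> W" using W(2) z(1,3) b(2) by blast
  ultimately show "\<exists>T. open T \<and> x \<in> T \<and> smooth_on (A \<inter> T) (\<lambda>a. coord cF (fst (param cN a)))"
    using W(1) by blast
qed

text \<open>The slices of \<open>N\<close> and \<open>F\<close> have the same dimension
  \<open>l\<close>, so the immersion of one into the other falls under
  \<open>smooth_inverse_function_subspace\<close>. Openness is stated relative to the coordinate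
  images of \<open>N\<close> and \<open>F\<close>, as \<open>chart_preimage_openin\<close> needs
  it.\<close>

lemma projection_local_inverse:
  fixes M :: "('a, 'e::euclidean_space) mfd"
  assumes M: "smooth_manifold n M" and N: "submanifold (tangent_bundle M) l N"
    and trans: "transverse_to_fibers M N" and F: "fst ` N = F" "submanifold M l F" and z: "z \<in> N"
  obtains cN cF A B h where "cN \<in> max_atlas (tangent_bundle M)" "z \<in> cdom cN" "cF \<in> max_atlas M"
    "openin (top_of_set (coord cN ` (cdom cN \<inter> N))) A" "coord cN z \<in> A"
    "openin (top_of_set (coord cF ` (cdom cF \<inter> F))) B" "smooth_on B h"
    "\<forall>a\<in>A. fst (param cN a) \<in> cdom cF \<and> coord cF (fst (param cN a)) \<in> B \<and> h (coord cF (fst (param cN a))) = a"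
    "\<forall>y\<in>B. h y \<in> A \<and> coord cF (fst (param cN (h y))) = y"
proof -
  let ?TM = "tangent_bundle M"
  obtain cN L where cN: "cN \<in> max_atlas ?TM" "z \<in> cdom cN" "subspace L" "L \<subseteq> model ?TM" "dim L = l"
    "coord cN ` (cdom cN \<inter> N) = coord cN ` cdom cN \<inter> L"
    by (rule submanifoldE[OF N z])
  have "fst z \<in> F" using F(1) z by blast
  obtain cF L' where cF: "cF \<in> max_atlas M" "fst z \<in> cdom cF" "subspace L'" "L' \<subseteq> model M" "dim L' = l"
    "coord cF ` (cdom cF \<inter> F) = coord cF ` cdom cF \<inter> L'"
    by (rule submanifoldE[OF F(2) \<open>fst z \<in> F\<close>])
  note chN = max_atlas_is_chart[OF cN(1)] and chF = max_atlas_is_chart[OF cF(1)]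
  define g where "g a = coord cF (fst (param cN a))" for a
  define U where "U = {z \<in> topspace (mtop ?TM). fst z \<in> cdom cF}"
  define A0 where "A0 = coord cN ` (cdom cN \<inter> N \<inter> U)"
  have "openin (mtop ?TM) U"
    unfolding U_def by (rule openin_continuous_map_preimage[OF continuous_map_bundle_projection[OF M] chart_dom_openin[OF chF]])
  then have A0: "openin (top_of_set L) A0" unfolding A0_def by (rule slice_openin[OF chN cN(4,6)])
  have A0E: "\<exists>q. q \<in> cdom cN \<and> q \<in> N \<and> fst q \<in> cdom cF \<and> param cN a = q \<and> a = coord cN q" if "a \<in> A0" for a
    using that chart_param_coord[OF chN] unfolding A0_def U_def by blast
  have zA0: "coord cN z \<in> A0"
    using cN(2) z cF(2) chart_dom_subset[OF chN] unfolding A0_def U_def by blast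
  have gA0: "g a \<in> coord cF ` (cdom cF \<inter> F)" if a: "a \<in> A0" for a
  proof -
    obtain q where "q \<in> N" "fst q \<in> cdom cF" "param cN a = q" using A0E[OF a] by blast
    then have "fst (param cN a) \<in> cdom cF \<inter> F" using F(1) by blast
    then show ?thesis unfolding g_def by (rule imageI)
  qed
  have gL': "g ` A0 \<subseteq> L'" using gA0 cF(6) by blast
  have "A0 \<subseteq> coord cN ` (cdom cN \<inter> {z \<in> topspace (mtop ?TM). fst z \<in> cdom cF})"
    unfolding A0_def U_def by blast
  then have smooth: "smooth_on A0 g"
    unfolding g_def by (rule smooth_on_slice_projection[OF M cN(1) cF(1)])
  have inj: "u = 0" if "u \<in> L" "((\<lambda>t. g (coord cN z + t *\<^sub>R u)) has_vector_derivative 0) (at 0)" for u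
    using that(2) unfolding g_def
    by (rule transverse_slice_projection_immersion[OF M trans cN(1,2) z cN(3,4,6) cF(1,2) that(1)])
  have dims: "dim L = dim L'" using cN(5) cF(5) by simp
  obtain A B h where AB: "openin (top_of_set L) A" "A \<subseteq> A0" "coord cN z \<in> A" "openin (top_of_set L') B"
    "homeomorphism A B g h" "smooth_on B h"
    by (rule smooth_inverse_function_subspace[OF cN(3) cF(3) dims A0 zA0 smooth gL' inj])
      (assumption, assumption, rule that)
  have gh: "g ` A = B" "h ` B = A" "\<forall>a\<in>A. h (g a) = a" "\<forall>y\<in>B. g (h y) = y"
    using AB(5) by (auto simp: homeomorphism_def)
  have AN: "A \<subseteq> coord cN ` (cdom cN \<inter> N)" using AB(2) unfolding A0_def by blast
  have BF: "B \<subseteq> coord cF ` (cdom cF \<inter> F)" using gA0 AB(2) gh(1) by blast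
  show thesis
  proof (rule that[OF cN(1,2) cF(1) _ AB(3) _ AB(6)])
    show "openin (top_of_set (coord cN ` (cdom cN \<inter> N))) A"
      by (rule openin_subset_trans[OF AB(1) AN]) (use cN(6) in blast)
    show "openin (top_of_set (coord cF ` (cdom cF \<inter> F))) B"
      by (rule openin_subset_trans[OF AB(4) BF]) (use cF(6) in blast)
    show "\<forall>a\<in>A. fst (param cN a) \<in> cdom cF \<and> coord cF (fst (param cN a)) \<in> B \<and> h (coord cF (fst (param cN a))) = a"
    proof
      fix a assume a: "a \<in> A"
      then have "fst (param cN a) \<in> cdom cF" using A0E AB(2) by blast
      moreover have "g a \<in> B" "h (g a) = a" using gh a by auto
      ultimately show "fst (param cN a) \<in> cdom cF \<and> coord cF (fst (param cN a)) \<in> B \<and> h (coord cF (fst (param cN a))) = a"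
        by (simp add: g_def)
    qed
    show "\<forall>y\<in>B. h y \<in> A \<and> coord cF (fst (param cN (h y))) = y"
      using gh(2,4) unfolding g_def by blast
  qed
qed

text \<open>Carries \<open>h\<close> back to the manifolds as
  \<open>param cN \<circ> h \<circ> coord cF\<close>. The topological conclusions give the local
  homeomorphism; the last one keeps the coordinate formula for the smoothness of the global
  section.\<close>

lemma projection_local_section:
  fixes M :: "('a, 'e::euclidean_space) mfd"
  assumes M: "smooth_manifold n M" and N: "submanifold (tangent_bundle M) l N"
    and trans: "transverse_to_fibers M N" and F: "fst ` N = F" "submanifold M l F" and z: "z \<in> N"
  obtains U V s cN cF B h where "openin (subtopology (mtop (tangent_bundle M)) N) U" "z \<in> U"
    "openin (subtopology (mtop M) F) V" 
    "continuous_map (subtopology (subtopology (mtop M) F) V) (subtopology (mtop (tangent_bundle M)) N) s"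
    "fst ` U \<subseteq> V" "s ` V \<subseteq> U" "\<forall>q\<in>V. fst (s q) = q" "\<forall>w\<in>U. s (fst w) = w"
    "cN \<in> max_atlas (tangent_bundle M)" "cF \<in> max_atlas M" "smooth_on B h"
    "\<forall>q\<in>V. q \<in> cdom cF \<and> coord cF q \<in> B \<and> s q = param cN (h (coord cF q)) \<and> s q \<in> cdom cN \<and> h (coord cF q) = coord cN (s q)"
proof -
  let ?TM = "tangent_bundle M"
  obtain cN cF A B h where cN: "cN \<in> max_atlas ?TM" "z \<in> cdom cN" and cF: "cF \<in> max_atlas M"
    and A: "openin (top_of_set (coord cN ` (cdom cN \<inter> N))) A" "coord cN z \<in> A"
    and B: "openin (top_of_set (coord cF ` (cdom cF \<inter> F))) B" and h: "smooth_on B h"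
    and hA: "\<forall>a\<in>A. fst (param cN a) \<in> cdom cF \<and> coord cF (fst (param cN a)) \<in> B \<and> h (coord cF (fst (param cN a))) = a"
    and hB: "\<forall>y\<in>B. h y \<in> A \<and> coord cF (fst (param cN (h y))) = y"
    by (rule projection_local_inverse[OF M N trans F z])
  note chN = max_atlas_is_chart[OF cN(1)] and chF = max_atlas_is_chart[OF cF]
  define U where "U = {w \<in> N \<inter> cdom cN. coord cN w \<in> A}"
  define V where "V = {q \<in> F \<inter> cdom cF. coord cF q \<in> B}"
  define s where "s q = param cN (h (coord cF q))" for q
  have AN: "A \<subseteq> coord cN ` (cdom cN \<inter> N)" using A(1) openin_imp_subset by blast
  have sV: "s q \<in> cdom cN \<and> s q \<in> N \<and> coord cN (s q) = h (coord cF q) \<and> s q \<in> U \<and> fst (s q) = q" if "q \<in> V" for q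
  proof -
    have q: "q \<in> cdom cF" "coord cF q \<in> B" using that by (auto simp: V_def)
    then have hq: "h (coord cF q) \<in> A" "coord cF (fst (s q)) = coord cF q" using hB by (auto simp: s_def)
    obtain w where w: "w \<in> cdom cN" "w \<in> N" "h (coord cF q) = coord cN w" using AN hq(1) by blast
    then have "s q = w" using chart_param_coord[OF chN] by (simp add: s_def)
    moreover have "fst (s q) \<in> cdom cF" using hA hq(1) unfolding s_def by blast
    then have "fst (s q) = q" using inj_onD[OF chart_inj_on[OF chF] hq(2) _ q(1)] by blast
    ultimately show ?thesis using w hq(1) by (simp add: U_def)
  qed
  have fstU: "fst w \<in> V \<and> s (fst w) = w" if "w \<in> U" for w
  proof -
    have w: "w \<in> N" "w \<in> cdom cN" "coord cN w \<in> A" using that by (auto simp: U_def)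
    have p: "param cN (coord cN w) = w" by (rule chart_param_coord[OF chN w(2)])
    have "fst w \<in> cdom cF" "coord cF (fst w) \<in> B" "h (coord cF (fst w)) = coord cN w"
      using bspec[OF hA w(3)] unfolding p by auto
    then show ?thesis using w(1) F(1) p by (auto simp: V_def s_def)
  qed
  show thesis
  proof (rule that[of U V s cN cF B h])
    show "openin (subtopology (mtop ?TM) N) U" unfolding U_def by (rule chart_preimage_openin[OF chN A(1)])
    show "z \<in> U" using z cN(2) A(2) by (simp add: U_def)
    show "openin (subtopology (mtop M) F) V" unfolding V_def by (rule chart_preimage_openin[OF chF B])
    have Y: "subtopology (subtopology (mtop M) F) V = subtopology (subtopology (mtop M) (cdom cF)) V"
      by (simp add: subtopology_subtopology V_def Int_absorb1 Int_assoc subset_iff inf_absorb2) 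
    have 1: "continuous_map (subtopology (subtopology (mtop M) F) V) (top_of_set B) (coord cF)"
      unfolding Y
      by (rule continuous_map_into_subtopology[OF continuous_map_from_subtopology[OF chart_continuous_coord[OF chF]]])
        (auto simp: V_def)
    have 2: "continuous_map (top_of_set B) (top_of_set (coord cN ` cdom cN)) h"
      by (rule continuous_map_into_subtopology)
        (use smooth_on_imp_continuous_on[OF h] hB AN in auto)
    have "continuous_map (subtopology (subtopology (mtop M) F) V) (mtop ?TM) (param cN \<circ> (h \<circ> coord cF))"
      by (rule continuous_map_compose[OF continuous_map_compose[OF 1 2] chart_continuous_param[OF chN]])
    then show "continuous_map (subtopology (subtopology (mtop M) F) V) (subtopology (mtop ?TM) N) s"
      by (intro continuous_map_into_subtopology) (use sV in \<open>auto simp: s_def[abs_def] o_def\<close>)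
    show "cN \<in> max_atlas ?TM" by (rule cN(1))
    show "cF \<in> max_atlas M" by (rule cF)
    show "smooth_on B h" by (rule h)
    show "fst ` U \<subseteq> V" "s ` V \<subseteq> U" "\<forall>q\<in>V. fst (s q) = q" "\<forall>w\<in>U. s (fst w) = w"
      using fstU sV by blast+
    show "\<forall>q\<in>V. q \<in> cdom cF \<and> coord cF q \<in> B \<and> s q = param cN (h (coord cF q)) \<and> s q \<in> cdom cN \<and> h (coord cF q) = coord cN (s q)"
      using sV by (simp add: s_def V_def)
  qed
qed

lemma projection_local_homeo:
  assumes M: "smooth_manifold n M" and N: "submanifold (tangent_bundle M) l N"
    and trans: "transverse_to_fibers M N" and F: "fst ` N = F" "submanifold M l F"
  shows "local_homeo (subtopology (mtop (tangent_bundle M)) N) (subtopology (mtop M) F) fst"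
  unfolding local_homeo_def
proof (intro conjI ballI)
  show "continuous_map (subtopology (mtop (tangent_bundle M)) N) (subtopology (mtop M) F) fst"
    by (rule continuous_map_into_subtopology[OF continuous_map_from_subtopology[OF continuous_map_bundle_projection[OF M]]])
      (use F(1) in auto)
  fix z assume "z \<in> topspace (subtopology (mtop (tangent_bundle M)) N)"
  then have "z \<in> N" by simp
  show "\<exists>U V s. openin (subtopology (mtop (tangent_bundle M)) N) U \<and> z \<in> U \<and> openin (subtopology (mtop M) F) V \<and>
      continuous_map (subtopology (subtopology (mtop M) F) V) (subtopology (mtop (tangent_bundle M)) N) s \<and>
      fst ` U \<subseteq> V \<and> s ` V \<subseteq> U \<and> (\<forall>y\<in>V. fst (s y) = y) \<and> (\<forall>x\<in>U. s (fst x) = x)"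
    by (rule projection_local_section[OF M N trans F \<open>z \<in> N\<close>]) (intro exI conjI)
qed

text \<open>Over a point of \<open>F\<close> the local section and \<open>\<xi>\<close> both pick an
  element of \<open>N\<close>. Injectivity of \<open>fst\<close> on \<open>N\<close> forces them to
  agree, so \<open>\<xi>\<close> inherits the coordinate formula of
  \<open>projection_local_section\<close>.\<close>

lemma smooth_map_section:
  assumes M: "smooth_manifold n M" and N: "submanifold (tangent_bundle M) l N"
    and trans: "transverse_to_fibers M N" and F: "fst ` N = F" "submanifold M l F"
    and inj: "inj_on fst N"
    and cont: "continuous_map (subtopology (mtop M) F) (mtop (tangent_bundle M)) \<xi>"
    and \<xi>: "\<And>p. p \<in> F \<Longrightarrow> \<xi> p \<in> N \<and> fst (\<xi> p) = p"
  shows "smooth_map M F (tangent_bundle M) \<xi>"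
  unfolding smooth_map_def
proof (intro conjI ballI)
  let ?TM = "tangent_bundle M"
  show "continuous_map (subtopology (mtop M) F) (mtop ?TM) \<xi>" by (rule cont)
  fix c b assume c: "c \<in> atlas M" and b: "b \<in> atlas ?TM"
  have chc: "is_chart M c" using M c by (simp add: smooth_manifold_def)
  let ?S = "{p \<in> F \<inter> cdom c. \<xi> p \<in> cdom b}"
  show "smooth_on (coord c ` ?S) (coord b \<circ> \<xi> \<circ> param c)"
  proof (rule smooth_on_local)
    fix x assume "x \<in> coord c ` ?S"
    then obtain p where p: "p \<in> F" "p \<in> cdom c" "\<xi> p \<in> cdom b" "x = coord c p" by blast
    obtain U V s cN cF B h where U: "\<xi> p \<in> U" and V: "openin (subtopology (mtop M) F) V" and "fst ` U \<subseteq> V" and "s ` V \<subseteq> U"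
      and s: "\<forall>q\<in>V. fst (s q) = q" and UN: "openin (subtopology (mtop ?TM) N) U"
      and cN: "cN \<in> max_atlas ?TM" and cF: "cF \<in> max_atlas M" and h: "smooth_on B h"
      and hV: "\<forall>q\<in>V. q \<in> cdom cF \<and> coord cF q \<in> B \<and> s q = param cN (h (coord cF q)) \<and> s q \<in> cdom cN \<and> h (coord cF q) = coord cN (s q)"
      by (rule projection_local_section[OF M N trans F conjunct1[OF \<xi>[OF p(1)]]]) (rule that)
    have "U \<subseteq> N" using openin_imp_subset[OF UN] by blast
    have "p \<in> V" using \<open>fst ` U \<subseteq> V\<close> U \<xi>[OF p(1)] by force
    have s\<xi>: "s q = \<xi> q" if "q \<in> V" "q \<in> F" for q
      using inj_onD[OF inj, of "s q" "\<xi> q"] \<xi>[OF that(2)] s that(1) \<open>s ` V \<subseteq> U\<close> \<open>U \<subseteq> N\<close> by auto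
    obtain V0 where V0: "openin (mtop M) V0" "V = V0 \<inter> F" using V unfolding openin_subtopology by blast
    obtain W where W: "open W" "coord c ` (cdom c \<inter> V0) = model M \<inter> W"
      using chart_image_openin[OF chc V0(1)] unfolding openin_open by blast
    \<comment> \<open>A coordinate in \<open>W\<close> comes from a point of \<open>V0\<close>; as
      \<open>c\<close> is injective, this is the point \<open>q\<close> of \<open>F\<close> at hand,
      so \<open>q\<close> lies in \<open>V\<close>, where the section \<open>s\<close> is
      available.\<close>
    have SW: "\<exists>q. q \<in> ?S \<and> q \<in> V \<and> y = coord c q \<and> param c y = q" if y: "y \<in> coord c ` ?S \<inter> W" for y
    proof -
      obtain q where q: "q \<in> ?S" "y = coord c q" using y by blast
      then have "y \<in> model M \<inter> W" using y chart_coord_model[OF chc] by blast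
      then obtain r where r: "r \<in> cdom c" "r \<in> V0" "y = coord c r" using W(2) by blast
      have "param c y = r" using chart_param_coord[OF chc r(1)] r(3) by simp
      moreover have "param c y = q" using chart_param_coord[OF chc, of q] q by simp
      ultimately have "q \<in> V" using V0(2) q r(2) by simp
      then show ?thesis using q \<open>param c y = q\<close> by blast
    qed
    let ?D = "coord c ` ?S \<inter> W"
    have 1: "smooth_on ?D (coord cF \<circ> param c)"
    proof (rule smooth_on_subset[OF max_atlas_smooth_on(2)[OF cF c]])
      show "?D \<subseteq> coord c ` (cdom c \<inter> cdom cF)" using SW hV by blast
    qed
    have "(coord cF \<circ> param c) ` ?D \<subseteq> B"
    proof (rule image_subsetI)
      fix y assume "y \<in> ?D"
      then obtain q where "q \<in> V" "param c y = q" using SW by blast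
      moreover have "coord cF q \<in> B" using hV \<open>q \<in> V\<close> by blast
      ultimately show "(coord cF \<circ> param c) y \<in> B" by simp
    qed
    from smooth_on_compose[OF 1 h this] have 2: "smooth_on ?D (h \<circ> (coord cF \<circ> param c))" .
    have "(h \<circ> (coord cF \<circ> param c)) ` ?D \<subseteq> coord cN ` (cdom cN \<inter> cdom b)"
    proof (rule image_subsetI)
      fix y assume "y \<in> ?D"
      then obtain q where q: "q \<in> ?S" "q \<in> V" "param c y = q" using SW by blast
      have sq: "s q \<in> cdom cN" "h (coord cF q) = coord cN (s q)" using hV q(2) by blast+
      have "s q \<in> cdom b" using s\<xi>[of q] q(1,2) by simp
      moreover have "(h \<circ> (coord cF \<circ> param c)) y = coord cN (s q)" using sq(2) q(3) by simp
      ultimately show "(h \<circ> (coord cF \<circ> param c)) y \<in> coord cN ` (cdom cN \<inter> cdom b)" using sq(1) by simp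
    qed
    from smooth_on_compose[OF 2 max_atlas_smooth_on(1)[OF cN b] this]
    have "smooth_on ?D ((coord b \<circ> param cN) \<circ> (h \<circ> (coord cF \<circ> param c)))" .
    then have "smooth_on ?D (coord b \<circ> \<xi> \<circ> param c)"
    proof (rule smooth_on_cong)
      fix y assume "y \<in> ?D"
      then obtain q where q: "q \<in> ?S" "q \<in> V" "param c y = q" using SW by blast
      have "s q = param cN (h (coord cF q))" using hV q(2) by blast
      then have "\<xi> q = param cN (h (coord cF q))" using s\<xi>[of q] q(1,2) by simp
      then show "((coord b \<circ> param cN) \<circ> (h \<circ> (coord cF \<circ> param c))) y = (coord b \<circ> \<xi> \<circ> param c) y"
        using q(3) by simp
    qed
    moreover have "x \<in> W" using W(2) p \<open>p \<in> V\<close> V0(2) by blast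
    ultimately show "\<exists>T. open T \<and> x \<in> T \<and> smooth_on (coord c ` ?S \<inter> T) (coord b \<circ> \<xi> \<circ> param c)"
      using W(1) by blast
  qed
qed

theorem theorem2p2:
  fixes M :: "('a, 'e::euclidean_space) mfd"
    and N :: "('a \<times> ('a, 'e) tvec) set"
    and F :: "'a set"
    and n l :: nat
  assumes "smooth_manifold n M"
    and "connected_space (mtop M)"
    and "simply_connected_space (mtop M)"
    and "submanifold (tangent_bundle M) l N"
    and "connectedin (mtop (tangent_bundle M)) N"
    and "compactin (mtop (tangent_bundle M)) N"
    and "transverse_to_fibers M N"
    and "fst ` N = F"
    and "submanifold M l F"
    and "simply_connected_space (subtopology (mtop M) F)"
  shows "compactin (mtop M) F \<and> (\<exists>\<xi>. vector_field_along M F \<xi> \<and> \<xi> ` F = N)"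
proof -
  note M = assms(1) and N = assms(4) and trans = assms(7) and F = assms(8,9)
  let ?X = "subtopology (mtop (tangent_bundle M)) N" and ?Y = "subtopology (mtop M) F"
  have topX: "topspace ?X = N" using N by (auto simp: submanifold_def)
  have topY: "topspace ?Y = F" using F(2) by (auto simp: submanifold_def)
  have "compactin (mtop M) F"
    using image_compactin[OF assms(6) continuous_map_bundle_projection[OF M]] F(1) by simp
  moreover have X: "compact_space ?X" "Hausdorff_space ?X" "path_connected_space ?X"
    using assms(5,6) Hausdorff_space_subtopology[OF Hausdorff_tangent_bundle[OF M]]
      connected_locally_path_connected_imp_path_connected[OF _ submanifold_locally_path_connected[OF N]]
    by (simp_all add: compactin_subspace connectedin_def)
  have Y: "Hausdorff_space ?Y" using M by (simp add: smooth_manifold_def Hausdorff_space_subtopology)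
  note loc = projection_local_homeo[OF M N trans F]
  have inj: "inj_on fst N"
    using compact_local_homeo_inj_on[OF loc X Y assms(10)] topX by simp
  \<comment> \<open>A continuous bijection from a compact space onto a Hausdorff space has a
    continuous inverse; only its smoothness is left to the local sections.\<close>
  have "homeomorphic_map ?X ?Y fst"
    using loc X(1) Y inj F(1) topX topY
    by (intro continuous_imp_homeomorphic_map) (simp_all add: local_homeo_def)
  then obtain \<xi> where \<xi>: "homeomorphic_maps ?X ?Y fst \<xi>" using homeomorphic_map_maps by blast
  have \<xi>F: "\<xi> p \<in> N \<and> fst (\<xi> p) = p" if "p \<in> F" for p
    using \<xi> that topX topY unfolding homeomorphic_maps_def continuous_map_def by blast
  have \<xi>N: "\<xi> (fst z) = z" if "z \<in> N" for z
    using \<xi> that topX unfolding homeomorphic_maps_def by blast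
  have "continuous_map ?Y (mtop (tangent_bundle M)) \<xi>"
    using \<xi> unfolding homeomorphic_maps_def continuous_map_in_subtopology by blast
  then have "smooth_map M F (tangent_bundle M) \<xi>"
    by (rule smooth_map_section[OF M N trans F inj _ \<xi>F])
  then have "vector_field_along M F \<xi>" using \<xi>F by (simp add: vector_field_along_def)
  moreover have "\<xi> ` F = N"
  proof
    show "\<xi> ` F \<subseteq> N" using \<xi>F by blast
    show "N \<subseteq> \<xi> ` F"
    proof
      fix z assume "z \<in> N"
      then show "z \<in> \<xi> ` F" using \<xi>N[of z] F(1) by (intro image_eqI[of _ _ "fst z"]) auto
    qed
  qed
  ultimately show ?thesis by blast
qed

end
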